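(* Let $m\in\mathbb{N}$ with $m\ge1$, $p\in[1,\infty)$ and $n\ge2$. For $B > 0$, $\ell \in \mathbb{N}$, there exist constants $c= c(n,m,B,p,\ell) > 0$ and $s=s(n,m,B,p,\ell)>0$ such that for every $f \in \mathcal{G}^{B,\ell}_{m,n,p}$ and $0<\varepsilon < 1/2$, there is a ReLU neural network $\Phi_\varepsilon^f: \mathbb{R}^n \to \mathbb{R}$ with \begin{itemize} \item $\|\Phi_\varepsilon^f\|_{\max} \leq \varepsilon^{-s}$, \item $\mathrm{size}(\Phi_\varepsilon^f) \leq c \cdot \varepsilon^{-p(n-1)/m}$, \item $\mathrm{depth}(\Phi_\varepsilon^f) \leq (5+\lceil\log_2(mn)\rceil)\left(25+\frac{2m}{n}+\frac{m}{p(n-1)}\right)$, \end{itemize} and $$\|f - \Phi_\varepsilon^f\|_{L^p(Q_n)} \leq \varepsilon.$$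
   Context: Notation: $\mathbb{N}=\{0,1,\dots\}$, $[n]=\{1,\dots,n\}$, $Q_n=[-1/2,1/2]^n$; $\mathbb{R}^0=Q_0=\{*\}$ is a singleton and a map on $\mathbb{R}^0$ is identified with its value. $\pi_{i}:\mathbb{R}^{i}\to\mathbb{R}^{i-1}$ is the projection onto the first $i-1$ coordinates. $\chi_A$ is the characteristic function of $A$; $\bigsqcup$ is a disjoint union. A function $g:A\to\mathbb{R}$ on an arbitrary set $A\subseteq\mathbb{R}^n$ is $C^m$ if it is the restriction of a $C^m$ function defined on an open set containing $A$; every function on $\mathbb{R}^0$ is $C^m$. For a $C^m$ function $F$ on (a neighborhood of) $Q_i$, $\|F\|_{W^{m,\infty}(Q_i)}:=\max_{|\alpha|\le m}\|\partial^\alpha F\|_{L^\infty(Q_i)}$. For $f,g:A\to\mathbb{R}$, write $f<g$ if $f(x)<g(x)$ for all $x\in A$; then $(f,g)_A:=\{(x,y): x\in A,\ f(x)<y<g(x)\}$, and $(f,f)_A$ is the graph of $f$. Traceable sets: $A\subseteq\mathbb{R}^n$ is $m$-traceable if there exist sets $A_0,\dots,A_n$ and bounded $C^m$ maps $f_i,g_i:A_{i-1}\to\mathbb{R}$ such that for each $i\in[n]$: $A_i\subseteq\mathbb{R}^i$, $A_n=A$, $A_0=\{*\}$; $f_i<g_i$ or $f_i=g_i$; $\pi_i(A_i)=A_{i-1}$ and $A_i=(f_i,g_i)_{A_{i-1}}$. $\mathcal{K}_{m,n}^B$ ($B>0$) is the set of all $m$-traceable $A\subseteq Q_n$ (where $A_0,\dots,A_n$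 and $f_i,g_i:A_{i-1}\to\mathbb{R}$, $i\in[n]$, are the sets and bounded $C^m$ maps witnessing that $A$ is $m$-traceable) such that for each $i\in[n]$ there are $C^m$ functions $F_i,G_i:\mathbb{R}^{i-1}\to\mathbb{R}$ with $F_i|_{A_{i-1}}=f_i$, $G_i|_{A_{i-1}}=g_i$, $\|F_i\|_{W^{m,\infty}(Q_{i-1})}\le B$ and $\|G_i\|_{W^{m,\infty}(Q_{i-1})}\le B$. Function classes: for an integer $M\ge1$, $\mathcal{F}_{M,n}^B:=\{f\in C^M(Q_n):\|f\|_{W^{M,\infty}(Q_n)}\le B\}$. With $M:=\lceil mn/(p(n-1))\rceil$, $$\mathcal{G}^{B,\ell}_{m,n,p}:=\Bigl\{\sum_{i=1}^\ell g_i\cdot\chi_{A^i}:\ g_i\in\mathcal{F}_{M,n}^B,\ A^i\in\mathcal{K}_{m,n}^B,\ Q_n=\bigsqcup_{i=1}^\ell A^i\Bigr\}.$$ ReLU neural networks: a ReLU neural network $\Phi$ is a tuple $((W^{(0)},b^{(0)}),\ldots,(W^{(L)},b^{(L)}))$ with $L\ge1$, $W^{(i)}\in\mathbb{R}^{d_{i+1}\times d_i}$, $b^{(i)}\in\mathbb{R}^{d_{i+1}}$, all $d_i\ge 1$, identified with the function given by $x^{(0)}=x$, $x^{(i)}=\rho(W^{(i-1)}x^{(i-1)}+b^{(i-1)})$ for $i=1,\dots,L$, $\Phi(x)=W^{(L)}x^{(L)}+b^{(L)}$, where $\rho(t)=\max\{0,t\}$ acts componentwise. $\mathrm{depth}(\Phi)=L$,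 $\mathrm{size}(\Phi)$ is the number of non-zero entries of all $W^{(i)},b^{(i)}$, and $\|\Phi\|_{\max}$ is the maximal absolute value of these entries. *)

theory Defs
  imports
    "HOL-Probability.Probability"
    "Jordan_Normal_Form.Matrix"
begin

section \<open>Euclidean spaces of varying dimension\<close>

text \<open>
  Traceable sets relate subsets of spaces of consecutive dimensions, so the dimension cannot be
  a type. The i-dimensional space consists of the extensional functions on \<open>{..<i}\<close>; its topology
  is the subspace topology inherited from \<open>nat \<Rightarrow> real\<close>. Coordinates are
  numbered from 0. For \<open>i = 0\<close> the space is the singleton of \<open>\<lambda>_. undefined\<close>, and the
  measure \<open>leb 0\<close> is the unit point mass, so that a map on it is measured by its value.
\<close>

definition RR :: "nat \<Rightarrow> (nat \<Rightarrow> real) set" where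
  "RR i = (\<Pi>\<^sub>E j\<in>{..<i}. UNIV)"

definition Qcube :: "nat \<Rightarrow> (nat \<Rightarrow> real) set" where
  "Qcube i = (\<Pi>\<^sub>E j\<in>{..<i}. {-1/2..1/2})"

definition leb :: "nat \<Rightarrow> (nat \<Rightarrow> real) measure" where
  "leb i = (\<Pi>\<^sub>M j\<in>{..<i}. lborel)"

definition proj :: "nat \<Rightarrow> (nat \<Rightarrow> real) \<Rightarrow> (nat \<Rightarrow> real)" where
  "proj i z = restrict z {..<i - 1}"

section \<open>Differentiability classes and norms\<close>

definition pd :: "nat \<Rightarrow> ((nat \<Rightarrow> real) \<Rightarrow> real) \<Rightarrow> (nat \<Rightarrow> real) \<Rightarrow> real" where
  "pd j f = (\<lambda>x. deriv (\<lambda>t. f (x(j := t))) (x j))"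

definition multi_pd :: "nat \<Rightarrow> (nat \<Rightarrow> nat) \<Rightarrow> ((nat \<Rightarrow> real) \<Rightarrow> real) \<Rightarrow> (nat \<Rightarrow> real) \<Rightarrow> real" where
  "multi_pd i \<alpha> f = foldr (\<lambda>j. pd j ^^ \<alpha> j) [0..<i] f"

definition multi_indices :: "nat \<Rightarrow> nat \<Rightarrow> (nat \<Rightarrow> nat) set" where
  "multi_indices i m = {\<alpha> \<in> (\<Pi>\<^sub>E j\<in>{..<i}. UNIV). (\<Sum>j<i. \<alpha> j) \<le> m}"

text \<open>
  \<open>C_open i m U f\<close> is meant for \<open>U\<close> open in \<open>RR i\<close>: all iterated partial derivatives of order at
  most \<open>m\<close> exist and are continuous on \<open>U\<close>.
\<close>

primrec C_open :: "nat \<Rightarrow> nat \<Rightarrow> (nat \<Rightarrow> real) set \<Rightarrow> ((nat \<Rightarrow> real) \<Rightarrow> real) \<Rightarrow> bool" where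
  "C_open i 0 U f \<longleftrightarrow> continuous_on U f"
| "C_open i (Suc m) U f \<longleftrightarrow> continuous_on U f \<and>
     (\<forall>j<i. (\<forall>x\<in>U. (\<lambda>t. f (x(j := t))) differentiable (at (x j))) \<and> C_open i m U (pd j f))"

definition C_on :: "nat \<Rightarrow> nat \<Rightarrow> (nat \<Rightarrow> real) set \<Rightarrow> ((nat \<Rightarrow> real) \<Rightarrow> real) \<Rightarrow> bool" where
  "C_on i m A g \<longleftrightarrow>
     (\<exists>U G. openin (top_of_set (RR i)) U \<and> A \<subseteq> U \<and> C_open i m U G \<and> (\<forall>x\<in>A. G x = g x))"

definition Linf_norm :: "nat \<Rightarrow> ((nat \<Rightarrow> real) \<Rightarrow> real) \<Rightarrow> ereal" where
  "Linf_norm i f = esssup (restrict_space (leb i) (Qcube i)) (\<lambda>x. ereal \<bar>f x\<bar>)"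

text \<open>To be applied to functions that are \<open>C\<^sup>m\<close> on a neighbourhood of the cube.\<close>

definition Wnorm :: "nat \<Rightarrow> nat \<Rightarrow> ((nat \<Rightarrow> real) \<Rightarrow> real) \<Rightarrow> ereal" where
  "Wnorm i m F = Max ((\<lambda>\<alpha>. Linf_norm i (multi_pd i \<alpha> F)) ` multi_indices i m)"

definition Lp_norm :: "nat \<Rightarrow> real \<Rightarrow> ((nat \<Rightarrow> real) \<Rightarrow> real) \<Rightarrow> ennreal" where
  "Lp_norm n p h =
     (let I = (\<integral>\<^sup>+x\<in>Qcube n. ennreal (\<bar>h x\<bar> powr p) \<partial>leb n)
      in if I = \<infinity> then \<infinity> else ennreal (enn2real I powr (1 / p)))"

section \<open>Traceable sets\<close>

definition open_region ::
  "nat \<Rightarrow> ((nat \<Rightarrow> real) \<Rightarrow> real) \<Rightarrow> ((nat \<Rightarrow> real) \<Rightarrow> real) \<Rightarrow> (nat \<Rightarrow> real) set \<Rightarrow> (nat \<Rightarrow> real) set"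
  where "open_region i f g A = {x(i - 1 := y) |x y. x \<in> A \<and> f x < y \<and> y < g x}"

definition graph_region ::
  "nat \<Rightarrow> ((nat \<Rightarrow> real) \<Rightarrow> real) \<Rightarrow> (nat \<Rightarrow> real) set \<Rightarrow> (nat \<Rightarrow> real) set"
  where "graph_region i f A = {x(i - 1 := f x) |x. x \<in> A}"

definition trace_witness ::
  "nat \<Rightarrow> nat \<Rightarrow> (nat \<Rightarrow> real) set \<Rightarrow> (nat \<Rightarrow> (nat \<Rightarrow> real) set) \<Rightarrow>
   (nat \<Rightarrow> (nat \<Rightarrow> real) \<Rightarrow> real) \<Rightarrow> (nat \<Rightarrow> (nat \<Rightarrow> real) \<Rightarrow> real) \<Rightarrow> bool" where
  "trace_witness m n A As f g \<longleftrightarrow>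
     As 0 = RR 0 \<and> As n = A \<and>
     (\<forall>i\<in>{1..n}.
        As i \<subseteq> RR i \<and>
        C_on (i - 1) m (As (i - 1)) (f i) \<and> bounded (f i ` As (i - 1)) \<and>
        C_on (i - 1) m (As (i - 1)) (g i) \<and> bounded (g i ` As (i - 1)) \<and>
        proj i ` As i = As (i - 1) \<and>
        ((\<forall>x\<in>As (i - 1). f i x < g i x) \<and> As i = open_region i (f i) (g i) (As (i - 1)) \<or>
         (\<forall>x\<in>As (i - 1). f i x = g i x) \<and> As i = graph_region i (f i) (As (i - 1))))"

definition traceable :: "nat \<Rightarrow> nat \<Rightarrow> (nat \<Rightarrow> real) set \<Rightarrow> bool" where
  "traceable m n A \<longleftrightarrow> (\<exists>As f g. trace_witness m n A As f g)"

definition Kclass :: "nat \<Rightarrow> nat \<Rightarrow> real \<Rightarrow> (nat \<Rightarrow> real) set set" where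
  "Kclass m n B = {A. A \<subseteq> Qcube n \<and>
     (\<exists>As f g. trace_witness m n A As f g \<and>
       (\<forall>i\<in>{1..n}. \<exists>F G.
          C_open (i - 1) m (RR (i - 1)) F \<and> C_open (i - 1) m (RR (i - 1)) G \<and>
          (\<forall>x\<in>As (i - 1). F x = f i x) \<and> (\<forall>x\<in>As (i - 1). G x = g i x) \<and>
          Wnorm (i - 1) m F \<le> ereal B \<and> Wnorm (i - 1) m G \<le> ereal B))}"

section \<open>Function classes\<close>

text \<open>
  Only the values on the cube matter. The norm is taken of an extension that is smooth near the
  cube; for \<open>n \<ge> 1\<close> it does not depend on the extension, since the interior of the cube determines
  all derivatives on the cube.
\<close>

definition Fclass :: "nat \<Rightarrow> nat \<Rightarrow> real \<Rightarrow> ((nat \<Rightarrow> real) \<Rightarrow> real) set" where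
  "Fclass M n B = {f. \<exists>U F. openin (top_of_set (RR n)) U \<and> Qcube n \<subseteq> U \<and> C_open n M U F \<and>
     (\<forall>x\<in>Qcube n. F x = f x) \<and> Wnorm n M F \<le> ereal B}"

definition Gclass :: "nat \<Rightarrow> nat \<Rightarrow> real \<Rightarrow> real \<Rightarrow> nat \<Rightarrow> ((nat \<Rightarrow> real) \<Rightarrow> real) set" where
  "Gclass m n p B l = {f. \<exists>g A.
     (\<forall>i\<in>{1..l}. g i \<in> Fclass (nat \<lceil>real (m * n) / (p * real (n - 1))\<rceil>) n B) \<and>
     (\<forall>i\<in>{1..l}. A i \<in> Kclass m n B) \<and>
     disjoint_family_on A {1..l} \<and> Qcube n = (\<Union>i\<in>{1..l}. A i) \<and>
     (\<forall>x\<in>Qcube n. f x = (\<Sum>i\<in>{1..l}. g i x * indicator (A i) x))}"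

section \<open>ReLU neural networks\<close>

text \<open>A network with \<open>L + 1\<close> affine layers is a list of length \<open>L + 1\<close>; its depth is \<open>L\<close>.\<close>

type_synonym network = "(real mat \<times> real Matrix.vec) list"

definition relu_network :: "nat \<Rightarrow> nat \<Rightarrow> network \<Rightarrow> bool" where
  "relu_network d_in d_out \<Phi> \<longleftrightarrow>
     length \<Phi> \<ge> 2 \<and>
     dim_col (fst (hd \<Phi>)) = d_in \<and> dim_row (fst (last \<Phi>)) = d_out \<and>
     (\<forall>(W, b)\<in>set \<Phi>. dim_vec b = dim_row W \<and> dim_row W \<ge> 1 \<and> dim_col W \<ge> 1) \<and>
     (\<forall>k. Suc k < length \<Phi> \<longrightarrow> dim_col (fst (\<Phi> ! Suc k)) = dim_row (fst (\<Phi> ! k)))"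

definition affine :: "real mat \<times> real Matrix.vec \<Rightarrow> real Matrix.vec \<Rightarrow> real Matrix.vec" where
  "affine layer x = fst layer *\<^sub>v x + snd layer"

definition relu :: "real Matrix.vec \<Rightarrow> real Matrix.vec" where
  "relu = map_vec (\<lambda>t. max 0 t)"

fun realize :: "network \<Rightarrow> real Matrix.vec \<Rightarrow> real Matrix.vec" where
  "realize [] x = x"
| "realize [layer] x = affine layer x"
| "realize (layer # layer' # \<Phi>) x = realize (layer' # \<Phi>) (relu (affine layer x))"

definition net_fun :: "nat \<Rightarrow> network \<Rightarrow> (nat \<Rightarrow> real) \<Rightarrow> real" where
  "net_fun n \<Phi> x = vec_index (realize \<Phi> (Matrix.vec n x)) 0"

definition net_depth :: "network \<Rightarrow> nat" where
  "net_depth \<Phi> = length \<Phi> - 1"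

definition net_size :: "network \<Rightarrow> nat" where
  "net_size \<Phi> = (\<Sum>(W, b)\<leftarrow>\<Phi>.
     card {(i, j). i < dim_row W \<and> j < dim_col W \<and> W $$ (i, j) \<noteq> 0} +
     card {i. i < dim_vec b \<and> vec_index b i \<noteq> 0})"

text \<open>Including the zero entries only matters for the all-zero network, whose maximum is 0.\<close>

definition net_max :: "network \<Rightarrow> real" where
  "net_max \<Phi> = Max (\<Union>(W, b)\<in>set \<Phi>. abs ` (elements_mat W \<union> set\<^sub>v b))"

end

theory Submission
  imports Defs
begin

text \<open>
  Write \<open>\<delta> = \<epsilon>\<^sup>p\<close>. Multiplying a smooth function by a characteristic function is harmless for ReLU
  networks if an error is tolerated on a set of measure \<open>O(\<delta>)\<close>, because a bounded error on such a
  set contributes \<open>O(\<epsilon>)\<close> to the \<open>L\<^sup>p\<close> norm. So it suffices to approximate the smooth pieces up to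
  \<open>\<epsilon>\<close> and the boundary functions, which depend on at most \<open>n - 1\<close> variables, up to \<open>\<delta>\<close>, off a small
  exceptional set. The set consists of thin slabs along grid hyperplanes and of the
  \<open>O(\<delta>)\<close>-neighbourhoods of the boundary graphs; by Fubini these are small, and in particular pieces
  that lie in a graph disappear in them.

  A \<open>C\<^sup>m\<close> function of \<open>d\<close> variables is approximated with error \<open>N\<^sup>-\<^sup>m\<close> by interpolation polynomials on
  the \<open>N\<^sup>d\<close> cells of a grid (lemma \<open>local_ridge_approximation\<close>). In local coordinates of a cell the
  interpolants are combinations of one fixed power of finitely many fixed affine forms, with coefficients
  that depend on the cell. Off the slabs, the local coordinates are the same piecewise linear
  functions of the input for all cells, so the powers are computed once, and every cell then costs a
  bounded number of weights: one neuron forms its interpolant and vanishes outside the cell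
  (lemma \<open>cell_selection\<close>). The total size is \<open>O(N\<^sup>d + K)\<close> if the powers cost \<open>O(K)\<close>.

  The exponent is a power of 2, so only squaring has to be approximated. A layer of \<open>K\<close> neurons
  replaces \<open>t(1 - t)\<close> by its interpolant at the points \<open>k/K\<close>, and the remainder is \<open>K\<^sup>-\<^sup>2\<close> times the
  same parabola in a zigzag function of \<open>t\<close>. After \<open>R\<close> rounds the error is \<open>K\<^sup>-\<^sup>2\<^sup>R\<close> (lemma
  \<open>hidden_square\<close>), so a depth that does not depend on \<open>\<epsilon>\<close> makes the cost of the powers as small as
  the number of cells; this is why no logarithm of \<open>\<epsilon>\<close> appears in the size.

  With \<open>N = \<delta>\<^sup>-\<^sup>1\<^sup>/\<^sup>m\<close> for the boundaries, \<open>N = \<epsilon>\<^sup>-\<^sup>1\<^sup>/\<^sup>M\<close> for the pieces and \<open>K = \<epsilon>\<^sup>-\<^sup>p\<^sup>(\<^sup>n\<^sup>-\<^sup>1\<^sup>)\<^sup>/\<^sup>m\<close> all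
  sizes are \<open>O(K)\<close> (lemma \<open>parameter_choice\<close>). Lemma \<open>piecewise_smooth_rate\<close> puts the parts together
  and yields the error \<open>C \<epsilon>\<close>; rescaling \<open>\<epsilon>\<close> gives the theorem.
\<close>

section \<open>Layered circuits of ReLU neurons\<close>

text \<open>
  The cost of a linear combination is its number of summands. The summands form a list of weighted
  functions, so no numbering of neurons is needed to build and merge circuits.
\<close>
definition wire_sum :: "real \<Rightarrow> ('x \<Rightarrow> real) set \<Rightarrow> ('x \<Rightarrow> real) \<Rightarrow> nat \<Rightarrow> bool" where
  "wire_sum W F g c \<longleftrightarrow> (\<exists>ts. (\<forall>(w, f)\<in>set ts. \<bar>w\<bar> \<le> W \<and> f \<in> F) \<and> length ts \<le> c \<and>
     g = (\<lambda>x. \<Sum>(w, f)\<leftarrow>ts. w * f x))"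

lemma wire_sum_wire: "f \<in> F \<Longrightarrow> \<bar>w\<bar> \<le> W \<Longrightarrow> wire_sum W F (\<lambda>x. w * f x) 1"
  unfolding wire_sum_def by (rule exI[of _ "[(w, f)]"]) auto

lemma wire_sum_zero: "wire_sum W F (\<lambda>x. 0) 0"
  unfolding wire_sum_def by (rule exI[of _ "[]"]) auto

lemma wire_sum_add:
  assumes "wire_sum W F g c" "wire_sum W F h d"
  shows "wire_sum W F (\<lambda>x. g x + h x) (c + d)"
proof -
  obtain ts where ts: "\<forall>(w, f)\<in>set ts. \<bar>w\<bar> \<le> W \<and> f \<in> F" "length ts \<le> c"
     "g = (\<lambda>x. \<Sum>(w, f)\<leftarrow>ts. w * f x)" using assms(1) unfolding wire_sum_def by auto
  obtain us where us: "\<forall>(w, f)\<in>set us. \<bar>w\<bar> \<le> W \<and> f \<in> F" "length us \<le> d"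
     "h = (\<lambda>x. \<Sum>(w, f)\<leftarrow>us. w * f x)" using assms(2) unfolding wire_sum_def by auto
  show ?thesis unfolding wire_sum_def
    by (rule exI[of _ "ts @ us"]) (use ts us in auto)
qed

lemma wire_sum_sum:
  assumes "finite I" "\<And>i. i \<in> I \<Longrightarrow> wire_sum W F (g i) (c i)"
  shows "wire_sum W F (\<lambda>x. \<Sum>i\<in>I. g i x) (\<Sum>i\<in>I. c i)"
  using assms by (induction I rule: finite_induct) (simp_all add: wire_sum_zero wire_sum_add)

lemma wire_sum_wires:
  assumes "finite I" "\<And>i. i \<in> I \<Longrightarrow> f i \<in> F" "\<And>i. i \<in> I \<Longrightarrow> \<bar>w i\<bar> \<le> W"
  shows "wire_sum W F (\<lambda>x. \<Sum>i\<in>I. w i * f i x) (card I)"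
proof -
  have "wire_sum W F (\<lambda>x. w i * f i x) 1" if "i \<in> I" for i using that assms wire_sum_wire by metis
  then show ?thesis using wire_sum_sum[of I W F "\<lambda>i x. w i * f i x" "\<lambda>i. 1"] assms(1) by simp
qed

lemma wire_sum_mono:
  assumes "wire_sum W F g c" "F \<subseteq> F'" "c \<le> c'" "W \<le> W'" shows "wire_sum W' F' g c'"
  using assms unfolding wire_sum_def by (fastforce split: prod.splits)

definition neuron :: "real \<Rightarrow> ('x \<Rightarrow> real) set \<Rightarrow> ('x \<Rightarrow> real) \<Rightarrow> nat \<Rightarrow> bool" where
  "neuron W F g c \<longleftrightarrow>
     (\<exists>b h d. \<bar>b\<bar> \<le> W \<and> wire_sum W F h d \<and> Suc d \<le> c \<and> g = (\<lambda>x. max 0 (b + h x)))"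

lemma neuronI: "\<bar>b\<bar> \<le> W \<Longrightarrow> wire_sum W F h d \<Longrightarrow> Suc d \<le> c \<Longrightarrow> neuron W F (\<lambda>x. max 0 (b + h x)) c"
  unfolding neuron_def by blast

lemma neuron_mono:
  assumes "neuron W F g c" "F \<subseteq> F'" "c \<le> c'" "W \<le> W'" shows "neuron W' F' g c'"
proof -
  obtain b h d where "\<bar>b\<bar> \<le> W" and h: "wire_sum W F h d" and "Suc d \<le> c" "g = (\<lambda>x. max 0 (b + h x))"
    using assms(1) unfolding neuron_def by auto
  then show ?thesis
    using neuronI[OF _ wire_sum_mono[OF h assms(2) order_refl assms(4)], of b c'] assms by auto
qed

text \<open>
  \<open>F\<close> is computed by the neurons of the \<open>L\<close>-th hidden layer, with weights and biases at most \<open>W\<close> and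
  at most \<open>S\<close> nonzero ones among them up to this layer. A layer is a set of functions: circuits of equal
  depth run in parallel by taking unions, and one element may feed any number of later neurons.
\<close>
primrec hidden_layer :: "nat \<Rightarrow> real \<Rightarrow> nat \<Rightarrow> nat \<Rightarrow> ((nat \<Rightarrow> real) \<Rightarrow> real) set \<Rightarrow> bool" where
  "hidden_layer n W 0 S F \<longleftrightarrow> F \<subseteq> (\<lambda>j x. x j) ` {..<n}"
| "hidden_layer n W (Suc L) S F \<longleftrightarrow> finite F \<and> (\<exists>F' S' cost. hidden_layer n W L S' F' \<and>
     (\<forall>g\<in>F. neuron W F' g (cost g)) \<and> S' + (\<Sum>g\<in>F. cost g) \<le> S)"

lemma hidden_SucI:
  assumes "finite F" "hidden_layer n W L S' F'" "\<And>g. g \<in> F \<Longrightarrow> neuron W F' g (cost g)" "S' + (\<Sum>g\<in>F. cost g) \<le> S"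
  shows "hidden_layer n W (Suc L) S F"
  using assms by auto

lemma hidden_finite: "hidden_layer n W L S F \<Longrightarrow> finite F"
  by (cases L) (auto intro: finite_subset)

lemma hidden_mono: "hidden_layer n W L S F \<Longrightarrow> G \<subseteq> F \<Longrightarrow> S \<le> T \<Longrightarrow> hidden_layer n W L T G"
proof (cases L)
  case (Suc k)
  assume a: "hidden_layer n W L S F" "G \<subseteq> F" "S \<le> T"
  then obtain F' S' cost where *: "finite F" "hidden_layer n W k S' F'"
     "\<forall>g\<in>F. neuron W F' g (cost g)" "S' + (\<Sum>g\<in>F. cost g) \<le> S" using Suc by auto
  have "(\<Sum>g\<in>G. cost g) \<le> (\<Sum>g\<in>F. cost g)" using a * by (intro sum_mono2) auto
  then show ?thesis using Suc a * by (auto intro!: hidden_SucI[of G n W k S' F' cost] intro: finite_subset simp del: hidden_layer.simps)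
qed auto

lemma hidden_empty: "hidden_layer n W L S {}"
proof (induction L arbitrary: S)
  case (Suc L) then show ?case by (intro hidden_SucI[of "{}" n W L S "{}"]) auto
qed simp

lemma hidden_Un: "hidden_layer n W L S F \<Longrightarrow> hidden_layer n W L T G \<Longrightarrow> hidden_layer n W L (S + T) (F \<union> G)"
proof (induction L arbitrary: S T F G)
  case (Suc L)
  obtain F' S' c where F: "finite F" "hidden_layer n W L S' F'"
     "\<forall>g\<in>F. neuron W F' g (c g)" "S' + (\<Sum>g\<in>F. c g) \<le> S" using Suc.prems by auto
  obtain G' T' d where G: "finite G" "hidden_layer n W L T' G'"
     "\<forall>g\<in>G. neuron W G' g (d g)" "T' + (\<Sum>g\<in>G. d g) \<le> T" using Suc.prems by auto
  define e where "e g = (if g \<in> F then c g else d g)" for g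
  have "(\<Sum>g\<in>F \<union> G. e g) = (\<Sum>g\<in>F. e g) + (\<Sum>g\<in>G - F. e g)"
    using F G sum.union_disjoint[of F "G - F" e] by auto
  moreover have "(\<Sum>g\<in>F. e g) = (\<Sum>g\<in>F. c g)" by (rule sum.cong) (auto simp: e_def)
  moreover have "(\<Sum>g\<in>G - F. e g) = (\<Sum>g\<in>G - F. d g)" by (rule sum.cong) (auto simp: e_def)
  moreover have "(\<Sum>g\<in>G - F. d g) \<le> (\<Sum>g\<in>G. d g)" using G by (intro sum_mono2) auto
  ultimately have le: "S' + T' + (\<Sum>g\<in>F \<union> G. e g) \<le> S + T" using F G by linarith
  have ne: "neuron W (F' \<union> G') g (e g)" if "g \<in> F \<union> G" for g
  proof (cases "g \<in> F")
    case True
    then have "neuron W F' g (e g)" using F(3) by (simp add: e_def)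
    then show ?thesis by (rule neuron_mono) auto
  next
    case False
    then have "neuron W G' g (e g)" using G(3) that by (simp add: e_def)
    then show ?thesis by (rule neuron_mono) auto
  qed
  show ?case
    by (rule hidden_SucI[OF _ Suc.IH[OF F(2) G(2)] ne le]) (use F(1) G(1) in auto)
qed simp

lemma hidden_UN:
  assumes "finite I" "\<And>i. i \<in> I \<Longrightarrow> hidden_layer n W L (S i) (F i)"
  shows "hidden_layer n W L (\<Sum>i\<in>I. S i) (\<Union>i\<in>I. F i)"
  using assms by (induction I rule: finite_induct) (simp_all add: hidden_empty hidden_Un)

text \<open>
  The family \<open>g\<close> need not be injective; every function in its image is charged for one of its indices.
\<close>
lemma hidden_next_layer:
  assumes "hidden_layer n W L S F" "finite I" "\<And>i. i \<in> I \<Longrightarrow> neuron W F (g i) (c i)"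
  shows "hidden_layer n W (Suc L) (S + (\<Sum>i\<in>I. c i)) (g ` I)"
proof -
  define J where "J = inv_into I g ` (g ` I)"
  have J: "J \<subseteq> I" "inj_on g J" "g ` J = g ` I"
    by (auto simp: J_def inv_into_into inj_on_def f_inv_into_f image_image)
  have "(\<Sum>h\<in>g ` I. c (inv_into J g h)) = (\<Sum>j\<in>J. c j)"
    unfolding J(3)[symmetric] by (subst sum.reindex[OF J(2)]) (auto intro!: sum.cong simp: inv_into_f_f J(2))
  also have "\<dots> \<le> (\<Sum>i\<in>I. c i)" by (rule sum_mono2) (use assms J in auto)
  finally have le: "(\<Sum>h\<in>g ` I. c (inv_into J g h)) \<le> (\<Sum>i\<in>I. c i)" .
  have "neuron W F h (c (inv_into J g h))" if "h \<in> g ` I" for h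
  proof -
    have "inv_into J g h \<in> I" "g (inv_into J g h) = h" using that J inv_into_into[of h g J] f_inv_into_f[of h g J] by auto
    then show ?thesis using assms(3)[of "inv_into J g h"] by simp
  qed
  then show ?thesis using assms(1,2) le
    by (intro hidden_SucI[of "g ` I" n W L S F "\<lambda>h. c (inv_into J g h)"]) auto
qed

lemma hidden_next_neuron:
  assumes "hidden_layer n W L S F" "neuron W F g c"
  shows "hidden_layer n W (Suc L) (S + c) {g}"
  using hidden_next_layer[OF assms(1), of "{()}" "\<lambda>_. g" "\<lambda>_. c"] assms(2) by simp

lemma hidden_nonneg: "hidden_layer n W (Suc L) S F \<Longrightarrow> f \<in> F \<Longrightarrow> 0 \<le> f x"
  by (auto simp: neuron_def)

declare hidden_layer.simps(2) [simp del]

text \<open>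
  Nonnegative functions pass unchanged through the rectifier. This replaces skip connections: a value
  is kept for later layers at the cost of one weight per layer.
\<close>
lemma neuron_carry:
  assumes "f \<in> F" "\<And>x. f x \<ge> 0" "1 \<le> W" shows "neuron W F f 2"
proof -
  have "f = (\<lambda>x. max 0 (0 + 1 * f x))" using assms by auto
  then show ?thesis using neuronI[OF _ wire_sum_wire[of f F 1 W], of 0] assms by auto
qed

lemma hidden_carry:
  assumes "hidden_layer n W (Suc L) S F" "1 \<le> W" "card F \<le> k"
  shows "hidden_layer n W (Suc L + q) (S + q * (2 * k)) F"
proof (induction q)
  case 0 then show ?case using assms by simp
next
  case (Suc q)
  have "hidden_layer n W (Suc (Suc L + q)) (S + q * (2 * k) + (\<Sum>f\<in>F. 2)) ((\<lambda>f. f) ` F)"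
  proof (rule hidden_next_layer[OF Suc])
    show "finite F" using assms hidden_finite by blast
    fix f assume "f \<in> F" then show "neuron W F f 2"
      using neuron_carry[of f F W] hidden_nonneg[OF assms(1)] assms(2) by blast
  qed
  then have "hidden_layer n W (Suc L + Suc q) (S + q * (2 * k) + (\<Sum>f\<in>F. 2)) F" by simp
  then show ?case by (rule hidden_mono) (use assms in auto)
qed

section \<open>From circuits to matrices\<close>

text \<open>
  Equal summands of a wire sum end up in the same matrix entry, which can enlarge the entry by
  the factor \<open>c\<close> at most.
\<close>
lemma wire_sum_row:
  assumes "wire_sum W F g c" "F \<subseteq> set fs" "0 \<le> W"
  shows "\<exists>r. (\<forall>j. \<bar>r j\<bar> \<le> real c * W) \<and> card {j. j < length fs \<and> r j \<noteq> 0} \<le> c \<and>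
     (\<forall>x. (\<Sum>j<length fs. r j * (fs ! j) x) = g x)"
proof -
  have row: "\<exists>r. (\<forall>j. \<bar>r j\<bar> \<le> real (length ts) * W) \<and> card {j. j < length fs \<and> r j \<noteq> 0} \<le> length ts \<and>
     (\<forall>x. (\<Sum>j<length fs. r j * (fs ! j) x) = (\<Sum>(w, f)\<leftarrow>ts. w * f x))"
    if "\<forall>(w, f)\<in>set ts. \<bar>w\<bar> \<le> W \<and> f \<in> F" for ts
    using that
  proof (induction ts)
    case Nil then show ?case by (intro exI[of _ "\<lambda>_. 0"]) auto
  next
    case (Cons t ts)
    obtain w f where t: "t = (w, f)" by (cases t)
    obtain r where r: "\<And>j. \<bar>r j\<bar> \<le> real (length ts) * W" "card {j. j < length fs \<and> r j \<noteq> 0} \<le> length ts"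
      "\<And>x. (\<Sum>j<length fs. r j * (fs ! j) x) = (\<Sum>(w, f)\<leftarrow>ts. w * f x)" using Cons by auto
    have w: "\<bar>w\<bar> \<le> W" "f \<in> set fs" using Cons.prems assms t by auto
    obtain i where i: "i < length fs" "fs ! i = f" using w by (auto simp: in_set_conv_nth)
    have 1: "\<bar>(r(i := r i + w)) j\<bar> \<le> real (length (t # ts)) * W" for j
      using r(1)[of j] w(1) assms(3) by (auto simp: algebra_simps)
    have "card {j. j < length fs \<and> (r(i := r i + w)) j \<noteq> 0} \<le> card (insert i {j. j < length fs \<and> r j \<noteq> 0})"
      by (rule card_mono) auto
    also have "\<dots> \<le> Suc (card {j. j < length fs \<and> r j \<noteq> 0})" by (simp add: card_insert_if)
    finally have 2: "card {j. j < length fs \<and> (r(i := r i + w)) j \<noteq> 0} \<le> length (t # ts)" using r(2) by simp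
    have 3: "(\<Sum>j<length fs. (r(i := r i + w)) j * (fs ! j) x) = (\<Sum>(w, f)\<leftarrow>t # ts. w * f x)" for x
    proof -
      have "(\<Sum>j<length fs. (r(i := r i + w)) j * (fs ! j) x)
          = (\<Sum>j<length fs. r j * (fs ! j) x + (if j = i then w * (fs ! j) x else 0))"
        by (rule sum.cong) (auto simp: algebra_simps)
      then show ?thesis using i r(3) by (simp add: sum.distrib t)
    qed
    show ?case using 1 2 3 by blast
  qed
  obtain ts where ts: "\<forall>(w, f)\<in>set ts. \<bar>w\<bar> \<le> W \<and> f \<in> F" "length ts \<le> c"
    "g = (\<lambda>x. \<Sum>(w, f)\<leftarrow>ts. w * f x)" using assms(1) unfolding wire_sum_def by auto
  obtain r where r: "\<And>j. \<bar>r j\<bar> \<le> real (length ts) * W" "card {j. j < length fs \<and> r j \<noteq> 0} \<le> length ts"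
      "\<And>x. (\<Sum>j<length fs. r j * (fs ! j) x) = g x" using row[OF ts(1)] unfolding ts(3) by auto
  have "real (length ts) * W \<le> real c * W" using ts(2) assms(3) by (simp add: mult_right_mono)
  then show ?thesis using r ts(2) by (intro exI[of _ r]) (auto intro: order_trans)
qed

text \<open>
  The shape conditions of a network, recursively and with the dimensions of the ends as parameters, so
  that networks can be extended at the end.
\<close>
primrec composable :: "nat \<Rightarrow> network \<Rightarrow> nat \<Rightarrow> bool" where
  "composable d [] d' \<longleftrightarrow> d = d'"
| "composable d (l # \<Phi>) d' \<longleftrightarrow> dim_col (fst l) = d \<and> d \<ge> 1 \<and> dim_vec (snd l) = dim_row (fst l) \<and>
     dim_row (fst l) \<ge> 1 \<and> composable (dim_row (fst l)) \<Phi> d'"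

lemma composable_append: "composable d (\<Phi> @ \<Psi>) d' \<longleftrightarrow> (\<exists>e. composable d \<Phi> e \<and> composable e \<Psi> d')"
  by (induction \<Phi> arbitrary: d) auto

lemma composable_nth: "composable d \<Phi> d' \<Longrightarrow> Suc k < length \<Phi> \<Longrightarrow> dim_col (fst (\<Phi> ! Suc k)) = dim_row (fst (\<Phi> ! k))"
proof (induction \<Phi> arbitrary: d k)
  case (Cons l \<Phi>)
  then show ?case by (cases k; cases \<Phi>) auto
qed auto

lemma composable_relu_network:
  assumes "composable d \<Phi> d'" "length \<Phi> \<ge> 2" shows "relu_network d d' \<Phi>"
proof -
  have "\<forall>(A, b)\<in>set \<Phi>. dim_vec b = dim_row A \<and> dim_row A \<ge> 1 \<and> dim_col A \<ge> 1"
    using assms(1) by (induction \<Phi> arbitrary: d) (auto simp del: One_nat_def)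
  moreover have ne: "\<Phi> \<noteq> []" using assms(2) by auto
  have "dim_row (fst (last \<Phi>)) = d'"
    using assms(1) ne by (induction \<Phi> arbitrary: d) auto
  moreover have "dim_col (fst (hd \<Phi>)) = d" using assms by (cases \<Phi>) auto
  ultimately show ?thesis using assms composable_nth[OF assms(1)] unfolding relu_network_def by auto
qed

lemma realize_snoc: "realize (\<Psi> @ [l]) v = affine l (foldl (\<lambda>v l. relu (affine l v)) v \<Psi>)"
proof (induction \<Psi> arbitrary: v)
  case (Cons a \<Psi>)
  then show ?case by (cases \<Psi>) auto
qed auto

definition layer_of :: "nat \<Rightarrow> nat \<Rightarrow> (nat \<Rightarrow> nat \<Rightarrow> real) \<Rightarrow> (nat \<Rightarrow> real) \<Rightarrow> real mat \<times> real Matrix.vec" where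
  "layer_of k d r b = (Matrix.mat k d (\<lambda>(i, j). r i j), Matrix.vec k b)"

lemma affine_layer_of:
  "affine (layer_of k d r b) (Matrix.vec d v) = Matrix.vec k (\<lambda>i. b i + (\<Sum>j<d. r i j * v j))"
  by (auto simp: affine_def layer_of_def scalar_prod_def lessThan_atLeast0 intro!: eq_vecI sum.cong)

lemma layer_of_size:
  assumes "\<And>i. i < k \<Longrightarrow> card {j. j < d \<and> r i j \<noteq> 0} \<le> c i"
  shows "net_size [layer_of k d r b] \<le> (\<Sum>i<k. Suc (c i))"
proof -
  have "{(i, j). i < k \<and> j < d \<and> r i j \<noteq> 0} = (SIGMA i:{..<k}. {j. j < d \<and> r i j \<noteq> 0})" by auto
  then have "card {(i, j). i < k \<and> j < d \<and> r i j \<noteq> 0} = (\<Sum>i<k. card {j. j < d \<and> r i j \<noteq> 0})" by simp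
  also have "\<dots> \<le> (\<Sum>i<k. c i)" by (rule sum_mono) (use assms in auto)
  finally have "card {(i, j). i < k \<and> j < d \<and> r i j \<noteq> 0} \<le> (\<Sum>i<k. c i)" .
  moreover have "card {i. i < k \<and> b i \<noteq> 0} \<le> card {..<k}" by (rule card_mono) auto
  moreover have "{(i, j). i < k \<and> j < d \<and> Matrix.mat k d (\<lambda>(i, j). r i j) $$ (i, j) \<noteq> 0}
     = {(i, j). i < k \<and> j < d \<and> r i j \<noteq> 0}" by auto
  moreover have "{i. i < k \<and> Matrix.vec k b $ i \<noteq> 0} = {i. i < k \<and> b i \<noteq> 0}" by auto
  ultimately show ?thesis by (simp add: net_size_def layer_of_def sum_Suc)
qed

definition entries_le :: "real \<Rightarrow> network \<Rightarrow> bool" where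
  "entries_le E \<Phi> \<longleftrightarrow> (\<forall>l\<in>set \<Phi>. \<forall>a\<in>elements_mat (fst l) \<union> set\<^sub>v (snd l). \<bar>a\<bar> \<le> E)"

lemma entries_le_layer_of:
  assumes "\<And>i j. i < k \<Longrightarrow> \<bar>r i j\<bar> \<le> E" "\<And>i. i < k \<Longrightarrow> \<bar>b i\<bar> \<le> E"
  shows "entries_le E [layer_of k d r b]"
  using assms by (auto simp: entries_le_def layer_of_def elements_mat_def vec_set_def)

lemma entries_le_append: "entries_le E (\<Phi> @ \<Psi>) \<longleftrightarrow> entries_le E \<Phi> \<and> entries_le E \<Psi>"
  by (auto simp: entries_le_def)

lemma entries_le_mono: "entries_le E \<Phi> \<Longrightarrow> E \<le> E' \<Longrightarrow> entries_le E' \<Phi>"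
  unfolding entries_le_def by (meson order_trans)

lemma net_size_append: "net_size (\<Phi> @ \<Psi>) = net_size \<Phi> + net_size \<Psi>"
  by (simp add: net_size_def)

lemma neuron_row:
  assumes "neuron W F g c" "F \<subseteq> set fs" "0 \<le> W"
  shows "\<exists>r b d. (\<forall>j. \<bar>r j\<bar> \<le> real c * W) \<and> \<bar>b\<bar> \<le> real c * W \<and> Suc d \<le> c \<and>
     card {j. j < length fs \<and> r j \<noteq> 0} \<le> d \<and>
     (\<forall>x. g x = max 0 (b + (\<Sum>j<length fs. r j * (fs ! j) x)))"
proof -
  obtain b h d where h: "\<bar>b\<bar> \<le> W" "wire_sum W F h d" "Suc d \<le> c" "g = (\<lambda>x. max 0 (b + h x))"
    using assms(1) unfolding neuron_def by auto
  obtain r where r: "\<forall>j. \<bar>r j\<bar> \<le> real d * W" "card {j. j < length fs \<and> r j \<noteq> 0} \<le> d"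
     "\<forall>x. (\<Sum>j<length fs. r j * (fs ! j) x) = h x" using wire_sum_row[OF h(2) assms(2,3)] by auto
  have 1: "real d * W \<le> real c * W" using h(3) assms(3) by (simp add: mult_right_mono)
  have "1 * W \<le> real c * W" using h(3) assms(3) by (intro mult_right_mono) auto
  then have 2: "\<bar>b\<bar> \<le> real c * W" using h(1) by linarith
  have 3: "\<forall>j. \<bar>r j\<bar> \<le> real c * W" using r(1) 1 order_trans by blast
  show ?thesis
    by (rule exI[of _ r], rule exI[of _ b], rule exI[of _ d]) (use 2 3 h r in auto)
qed

text \<open>
  Enumerating the functions of every layer turns a circuit into weight matrices.
\<close>
lemma hidden_matrices:
  assumes "hidden_layer n W L S F" "n \<ge> 1" "0 \<le> W"
  shows "\<exists>\<Psi> fs. length \<Psi> = L \<and> F \<subseteq> set fs \<and> fs \<noteq> [] \<and> composable n \<Psi> (length fs) \<and> net_size \<Psi> \<le> S \<and>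
    entries_le (real S * W) \<Psi> \<and>
    (\<forall>x. foldl (\<lambda>v l. relu (affine l v)) (Matrix.vec n x) \<Psi> = Matrix.vec (length fs) (\<lambda>i. (fs ! i) x))"
  using assms(1)
proof (induction L arbitrary: S F)
  case 0
  show ?case
    by (rule exI[of _ "[]"], rule exI[of _ "map (\<lambda>j x. x j) [0..<n]"])
       (use 0 assms in \<open>auto simp: lessThan_atLeast0 net_size_def entries_le_def\<close>)
next
  case (Suc L)
  obtain F' S' cost where F': "finite F" "hidden_layer n W L S' F'"
     "\<And>g. g \<in> F \<Longrightarrow> neuron W F' g (cost g)" "S' + (\<Sum>g\<in>F. cost g) \<le> S"
    using Suc.prems by (auto simp: hidden_layer.simps)
  obtain \<Psi> fs where \<Psi>: "length \<Psi> = L" "F' \<subseteq> set fs" "fs \<noteq> []" "composable n \<Psi> (length fs)" "net_size \<Psi> \<le> S'"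
    "entries_le (real S' * W) \<Psi>"
    "\<And>x. foldl (\<lambda>v l. relu (affine l v)) (Matrix.vec n x) \<Psi> = Matrix.vec (length fs) (\<lambda>i. (fs ! i) x)"
    using Suc.IH[OF F'(2)] by auto
  obtain gs where gs: "set gs = F" "distinct gs" using finite_distinct_list[OF F'(1)] by auto
  define P where "P g r b d \<longleftrightarrow> (\<forall>j. \<bar>r j\<bar> \<le> real (cost g) * W) \<and> \<bar>b\<bar> \<le> real (cost g) * W \<and> Suc d \<le> cost g \<and>
     card {j. j < length fs \<and> r j \<noteq> 0} \<le> d \<and>
     (\<forall>x. g x = max 0 (b + (\<Sum>j<length fs. r j * (fs ! j) x)))" for g r b d
  have "\<forall>g\<in>F. \<exists>t. P g (fst t) (fst (snd t)) (snd (snd t))"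
  proof
    fix g assume "g \<in> F"
    from neuron_row[OF F'(3)[OF this] \<Psi>(2) assms(3)] obtain r b d where "P g r b d"
      unfolding P_def by auto
    then have "P g (fst (r, b, d)) (fst (snd (r, b, d))) (snd (snd (r, b, d)))" by simp
    then show "\<exists>t. P g (fst t) (fst (snd t)) (snd (snd t))" by (rule exI)
  qed
  from bchoice[OF this] obtain T where T: "\<forall>g\<in>F. P g (fst (T g)) (fst (snd (T g))) (snd (snd (T g)))" ..
  define r where "r g = fst (T g)" for g
  define b where "b g = fst (snd (T g))" for g
  define d where "d g = snd (snd (T g))" for g
  have rbd: "\<And>g j. g \<in> F \<Longrightarrow> \<bar>r g j\<bar> \<le> real (cost g) * W"
      "\<And>g. g \<in> F \<Longrightarrow> \<bar>b g\<bar> \<le> real (cost g) * W" "\<And>g. g \<in> F \<Longrightarrow> Suc (d g) \<le> cost g"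
      "\<And>g. g \<in> F \<Longrightarrow> card {j. j < length fs \<and> r g j \<noteq> 0} \<le> d g"
      "\<And>g x. g \<in> F \<Longrightarrow> g x = max 0 (b g + (\<Sum>j<length fs. r g j * (fs ! j) x))"
    using T unfolding r_def b_def d_def P_def by simp_all
  define r' where "r' i j = (if i < length gs then r (gs ! i) j else (0::real))" for i j
  define b' where "b' i = (if i < length gs then b (gs ! i) else (0::real))" for i
  \<comment> \<open>one extra neuron that is constantly 0 keeps every layer nonempty\<close>
  define k where "k = Suc (length gs)"
  define l where "l = layer_of k (length fs) r' b'"
  define fs' where "fs' = gs @ [\<lambda>_. 0]"
  have inF: "i < length gs \<Longrightarrow> gs ! i \<in> F" for i using gs by auto
  have costS: "cost g \<le> S" if "g \<in> F" for g
    using member_le_sum[of g F cost] F'(1,4) that by linarith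
  have costW: "real (cost g) * W \<le> real S * W" if "g \<in> F" for g
    using costS[OF that] assms(3) by (simp add: mult_right_mono)
  have "net_size [layer_of (length gs) (length fs) r' b'] \<le> (\<Sum>i<length gs. Suc (d (gs ! i)))"
    by (rule layer_of_size) (use rbd(4) inF in \<open>auto simp: r'_def\<close>)
  moreover have "net_size [l] = net_size [layer_of (length gs) (length fs) r' b']"
  proof -
    have "{(i, j). i < k \<and> j < length fs \<and> Matrix.mat k (length fs) (\<lambda>(i, j). r' i j) $$ (i, j) \<noteq> 0} =
       {(i, j). i < length gs \<and> j < length fs \<and> Matrix.mat (length gs) (length fs) (\<lambda>(i, j). r' i j) $$ (i, j) \<noteq> 0}"
      by (auto simp: k_def r'_def split: if_splits)
    moreover have "{i. i < k \<and> Matrix.vec k b' $ i \<noteq> 0} = {i. i < length gs \<and> Matrix.vec (length gs) b' $ i \<noteq> 0}"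
      by (auto simp: k_def b'_def split: if_splits)
    ultimately show ?thesis by (simp add: l_def layer_of_def net_size_def)
  qed
  moreover have "(\<Sum>i<length gs. Suc (d (gs ! i))) \<le> (\<Sum>i<length gs. cost (gs ! i))"
    by (rule sum_mono) (use rbd(3) inF in auto)
  moreover have "(\<Sum>i<length gs. cost (gs ! i)) = (\<Sum>g\<in>F. cost g)"
    using sum_list_distinct_conv_sum_set[OF gs(2), of cost] gs(1)
    by (simp add: sum_list_sum_nth lessThan_atLeast0)
  ultimately have 1: "net_size (\<Psi> @ [l]) \<le> S" using F'(4) \<Psi>(5) by (simp add: net_size_append)
  have "entries_le (real S * W) [l]" unfolding l_def
  proof (rule entries_le_layer_of)
    have SW: "0 \<le> real S * W" using assms(3) by simp
    fix i j
    show "\<bar>r' i j\<bar> \<le> real S * W" "\<bar>b' i\<bar> \<le> real S * W"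
      using order_trans[OF rbd(1) costW, OF inF inF, of i j] order_trans[OF rbd(2) costW, OF inF inF, of i] SW
      by (auto simp: r'_def b'_def)
  qed
  moreover have "real S' * W \<le> real S * W" using F'(4) assms(3) by (intro mult_right_mono) auto
  ultimately have 2: "entries_le (real S * W) (\<Psi> @ [l])"
    using \<Psi>(6) by (auto simp: entries_le_append intro: entries_le_mono)
  have 3: "composable n (\<Psi> @ [l]) (length fs')"
    using \<Psi>(3,4) unfolding composable_append
    by (intro exI[of _ "length fs"]) (auto simp: l_def layer_of_def k_def fs'_def Suc_le_eq)
  have 4: "foldl (\<lambda>v l. relu (affine l v)) (Matrix.vec n x) (\<Psi> @ [l]) = Matrix.vec (length fs') (\<lambda>i. (fs' ! i) x)" for x
  proof -
    have "foldl (\<lambda>v l. relu (affine l v)) (Matrix.vec n x) (\<Psi> @ [l]) =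
      relu (Matrix.vec k (\<lambda>i. b' i + (\<Sum>j<length fs. r' i j * (fs ! j) x)))"
      by (simp add: \<Psi>(7) l_def affine_layer_of)
    also have "\<dots> = Matrix.vec (length fs') (\<lambda>i. (fs' ! i) x)"
    proof (rule eq_vecI)
      fix i assume i: "i < dim_vec (Matrix.vec (length fs') (\<lambda>i. (fs' ! i) x))"
      show "relu (Matrix.vec k (\<lambda>i. b' i + (\<Sum>j<length fs. r' i j * (fs ! j) x))) $ i
          = Matrix.vec (length fs') (\<lambda>i. (fs' ! i) x) $ i"
        using i rbd(5)[OF inF, of i x] by (auto simp: relu_def fs'_def k_def r'_def b'_def nth_append less_Suc_eq)
    qed (auto simp: relu_def k_def fs'_def)
    finally show ?thesis .
  qed
  show ?case
  proof (rule exI[of _ "\<Psi> @ [l]"], rule exI[of _ fs'], intro conjI allI)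
    show "length (\<Psi> @ [l]) = Suc L" using \<Psi>(1) by simp
    show "F \<subseteq> set fs'" "fs' \<noteq> []" using gs by (auto simp: fs'_def)
  qed (use 1 2 3 4 in \<open>simp_all only:\<close>)
qed

lemma hidden_network:
  assumes "hidden_layer n W L S F" "n \<ge> 1" "0 \<le> W" "L \<ge> 1" "wire_sum W F g c" "\<bar>b\<bar> \<le> W"
  shows "\<exists>\<Phi>. relu_network n 1 \<Phi> \<and> net_depth \<Phi> = L \<and> net_size \<Phi> \<le> S + Suc c \<and>
    net_max \<Phi> \<le> real (S + Suc c) * W \<and> (\<forall>x. net_fun n \<Phi> x = b + g x)"
proof -
  obtain \<Psi> fs where \<Psi>: "length \<Psi> = L" "F \<subseteq> set fs" "fs \<noteq> []" "composable n \<Psi> (length fs)" "net_size \<Psi> \<le> S"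
    "entries_le (real S * W) \<Psi>"
    "\<And>x. foldl (\<lambda>v l. relu (affine l v)) (Matrix.vec n x) \<Psi> = Matrix.vec (length fs) (\<lambda>i. (fs ! i) x)"
    using hidden_matrices[OF assms(1-3)] by auto
  obtain r where r: "\<forall>j. \<bar>r j\<bar> \<le> real c * W" "card {j. j < length fs \<and> r j \<noteq> 0} \<le> c"
     "\<forall>x. (\<Sum>j<length fs. r j * (fs ! j) x) = g x" using wire_sum_row[OF assms(5) \<Psi>(2) assms(3)] by auto
  define l where "l = layer_of 1 (length fs) (\<lambda>_. r) (\<lambda>_. b)"
  define E where "E = real (S + Suc c) * W"
  have E: "real S * W \<le> E" "real c * W \<le> E" "W \<le> E" using assms(3) by (auto simp: E_def algebra_simps)
  have size: "net_size (\<Psi> @ [l]) \<le> S + Suc c"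
    using \<Psi>(5) layer_of_size[of 1 "length fs" "\<lambda>_. r" "\<lambda>_. c" "\<lambda>_. b"] r(2) by (simp add: net_size_append l_def)
  have "entries_le E [l]" unfolding l_def
  proof (rule entries_le_layer_of)
    fix i j
    show "\<bar>r j\<bar> \<le> E" using r(1)[rule_format, of j] E(2) by linarith
    show "\<bar>b\<bar> \<le> E" using assms(6) E(3) by linarith
  qed
  then have ent: "entries_le E (\<Psi> @ [l])" using \<Psi>(6) E(1) by (auto simp: entries_le_append intro: entries_le_mono)
  have composable: "composable n (\<Psi> @ [l]) 1" unfolding composable_append
    using \<Psi>(3,4) by (intro exI[of _ "length fs"]) (auto simp: l_def layer_of_def Suc_le_eq)
  have "net_max (\<Psi> @ [l]) \<le> E" unfolding net_max_def
  proof (rule Max.boundedI)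
    show "finite (\<Union>(A, b)\<in>set (\<Psi> @ [l]). abs ` (elements_mat A \<union> set\<^sub>v b))"
      by (auto simp: elements_mat_def vec_set_def split: prod.split)
    have "b \<in> set\<^sub>v (snd l)" by (auto simp: l_def layer_of_def vec_set_def)
    then have "\<bar>b\<bar> \<in> (\<Union>(A, b)\<in>set (\<Psi> @ [l]). abs ` (elements_mat A \<union> set\<^sub>v b))"
      by (cases l) auto
    then show "(\<Union>(A, b)\<in>set (\<Psi> @ [l]). abs ` (elements_mat A \<union> set\<^sub>v b)) \<noteq> {}" by blast
  qed (use ent in \<open>auto simp: entries_le_def\<close>)
  moreover have "net_fun n (\<Psi> @ [l]) x = b + g x" for x
    using r(3) by (simp add: net_fun_def realize_snoc \<Psi>(7) l_def affine_layer_of)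
  moreover have "relu_network n 1 (\<Psi> @ [l])" using composable_relu_network[OF composable] \<Psi>(1) assms(4) by simp
  ultimately show ?thesis using size \<Psi>(1) by (intro exI[of _ "\<Psi> @ [l]"]) (auto simp: net_depth_def E_def)
qed

section \<open>Repeated squaring with zigzag functions\<close>

text \<open>
  The zigzag function on \<open>{0..1}\<close> runs \<open>K\<close> times between 0 and 1 with slopes \<open>K\<close> and \<open>- K\<close>. Listed are
  its changes of slope at the points \<open>k / K\<close>.
\<close>
definition zig_slope :: "nat \<Rightarrow> nat \<Rightarrow> real" where
  "zig_slope K k = (if k = 0 then real K else 2 * real K * (-1) ^ k)"

text \<open>
  Changes of slope at the points \<open>k / K\<close> of the piecewise linear interpolant of \<open>t (1 - t)\<close>.
\<close>
definition arc_slope :: "nat \<Rightarrow> nat \<Rightarrow> real" where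
  "arc_slope K k = (if k = 0 then 1 - 1 / real K else - 2 / real K)"

definition hinge_sum :: "nat \<Rightarrow> (nat \<Rightarrow> real) \<Rightarrow> real \<Rightarrow> real" where
  "hinge_sum K \<alpha> t = (\<Sum>k<K. \<alpha> k * max 0 (t - real k / real K))"

lemma hinge_sum_on_piece:
  assumes "j < K" "real j \<le> real K * t" "real K * t \<le> real (Suc j)"
  shows "hinge_sum K \<alpha> t = (\<Sum>k\<le>j. \<alpha> k * (t - real k / real K))"
proof -
  have K: "real K > 0" using assms(1) by simp
  have "hinge_sum K \<alpha> t = (\<Sum>k<K. if k \<le> j then \<alpha> k * (t - real k / real K) else 0)"
    unfolding hinge_sum_def
  proof (rule sum.cong[OF refl])
    fix k assume "k \<in> {..<K}"
    show "\<alpha> k * max 0 (t - real k / real K) = (if k \<le> j then \<alpha> k * (t - real k / real K) else 0)"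
    proof (cases "k \<le> j")
      case True
      then have "real k \<le> real K * t" using assms(2) by linarith
      then have "real k / real K \<le> t" using K by (simp add: field_simps)
      then show ?thesis using True by simp
    next
      case False
      then have "real K * t \<le> real k" using assms(3) by linarith
      then have "t \<le> real k / real K" using K by (simp add: field_simps)
      then show ?thesis using False by simp
    qed
  qed
  also have "\<dots> = (\<Sum>k\<in>{..<K} \<inter> {k. k \<le> j}. \<alpha> k * (t - real k / real K))" by (simp add: sum.If_cases)
  also have "{..<K} \<inter> {k. k \<le> j} = {..j}" using assms(1) by auto
  finally show ?thesis .
qed

lemma zig_piece:
  assumes "K \<ge> 1"
  shows "(\<Sum>k\<le>j. zig_slope K k * (t - real k / real K)) =
    (if even j then real K * t - real j else real j + 1 - real K * t)"
  using assms by (induction j) (auto simp: zig_slope_def field_simps)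

lemma arc_piece:
  assumes "K \<ge> 1"
  shows "(\<Sum>k\<le>j. arc_slope K k * (t - real k / real K)) = (1 - 1 / real K) * t - 2 * real j * t / real K + real j * (real j + 1) / (real K)\<^sup>2"
proof (induction j)
  case (Suc j)
  have K: "real K \<noteq> 0" using assms by simp
  have *: "arc_slope K (Suc j) = - 2 / real K" by (simp add: arc_slope_def)
  show ?case unfolding sum.atMost_Suc Suc.IH * using K by (simp add: field_simps power2_eq_square)
qed (auto simp: arc_slope_def)

text \<open>
  Between two neighbouring points \<open>j / K\<close> the parabola \<open>t (1 - t)\<close> exceeds its chord by
  \<open>\<sigma> (1 - \<sigma>) / K\<^sup>2\<close>, where \<open>\<sigma> = K t - j\<close>. The zigzag function equals \<open>\<sigma>\<close> or \<open>1 - \<sigma>\<close>, and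
  \<open>\<sigma> (1 - \<sigma>)\<close> is the same for both. Hence a continuous function can play the part of the discontinuous
  fractional part, and no exceptional set arises.
\<close>
lemma zigzag_arc:
  assumes "K \<ge> 1" "t \<in> {0..1}"
  shows "hinge_sum K (zig_slope K) t \<in> {0..1}"
    and "0 \<le> hinge_sum K (arc_slope K) t"
    and "t * (1 - t) = hinge_sum K (arc_slope K) t +
      (let s = hinge_sum K (zig_slope K) t in s * (1 - s)) / (real K)\<^sup>2"
proof -
  have K: "real K \<ge> 1" using assms(1) by simp
  define j where "j = (if t = 1 then K - 1 else nat \<lfloor>real K * t\<rfloor>)"
  have j: "j < K" "real j \<le> real K * t" "real K * t \<le> real (Suc j)"
  proof -
    have "real K * t < real K" if "t \<noteq> 1" using that assms K by (simp add: mult_less_cancel_left2)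
    moreover have "0 \<le> real K * t" using assms by simp
    ultimately show "j < K" "real j \<le> real K * t" "real K * t \<le> real (Suc j)"
      using assms(1) by (cases "t = 1"; auto simp: j_def of_nat_diff; linarith)+
  qed
  define \<sigma> where "\<sigma> = real K * t - real j"
  have \<sigma>: "0 \<le> \<sigma>" "\<sigma> \<le> 1" using j by (auto simp: \<sigma>_def)
  have z: "hinge_sum K (zig_slope K) t = (if even j then \<sigma> else 1 - \<sigma>)"
    using zig_piece[OF assms(1), of t j] by (simp add: hinge_sum_on_piece[OF j] \<sigma>_def)
  have a: "hinge_sum K (arc_slope K) t = (1 - 1 / real K) * t - 2 * real j * t / real K + real j * (real j + 1) / (real K)\<^sup>2"
    using arc_piece[OF assms(1), of t j] by (simp add: hinge_sum_on_piece[OF j])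
  have t: "t = (real j + \<sigma>) / real K" using K by (simp add: \<sigma>_def)
  show "hinge_sum K (zig_slope K) t \<in> {0..1}" using z \<sigma> by simp
  have h: "hinge_sum K (arc_slope K) t =
      ((1 - \<sigma>) * (real j * (real K - real j)) + \<sigma> * ((real j + 1) * (real K - real j - 1))) / (real K)\<^sup>2"
    unfolding a using K by (subst (1 2) t) (simp add: field_simps power2_eq_square)
  have "t * (1 - t) = hinge_sum K (arc_slope K) t + \<sigma> * (1 - \<sigma>) / (real K)\<^sup>2"
    unfolding h using K by (subst (1 2) t) (simp add: field_simps power2_eq_square)
  then show "t * (1 - t) = hinge_sum K (arc_slope K) t +
      (let s = hinge_sum K (zig_slope K) t in s * (1 - s)) / (real K)\<^sup>2"
    by (auto simp: z Let_def algebra_simps)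
  have jK: "real j + 1 \<le> real K" using j(1) by linarith
  show "0 \<le> hinge_sum K (arc_slope K) t"
    unfolding h using \<sigma> jK by (intro divide_nonneg_nonneg add_nonneg_nonneg mult_nonneg_nonneg) auto
qed

lemma wire_sum_hinge:
  assumes "\<And>k. k < K \<Longrightarrow> (\<lambda>x. max 0 (s x - real k / real K)) \<in> F" "\<And>k. k < K \<Longrightarrow> \<bar>c * \<alpha> k\<bar> \<le> W"
  shows "wire_sum W F (\<lambda>x. c * hinge_sum K \<alpha> (s x)) K"
proof -
  have "wire_sum W F (\<lambda>x. \<Sum>k<K. (c * \<alpha> k) * max 0 (s x - real k / real K)) (card {..<K})"
    by (rule wire_sum_wires) (use assms in auto)
  then show ?thesis by (simp add: hinge_sum_def sum_distrib_left mult.assoc)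
qed

text \<open>
  Starting from \<open>s = a = t\<close>, where \<open>t = t\<^sup>2 + t (1 - t)\<close>, every round subtracts the interpolant of
  \<open>s (1 - s)\<close>, suitably scaled, from \<open>a\<close> and applies the zigzag function to \<open>s\<close>. The values of \<open>a\<close>
  decrease from \<open>t\<close>, so they stay in \<open>{0..1}\<close>.
\<close>
lemma hidden_square_iterate:
  assumes "hidden_layer n W (Suc L) S {t}" "K \<ge> 1" "W \<ge> 2 * real K"
  shows "\<exists>s a. hidden_layer n W (Suc L + 2 * i) (S + i * (4 * K + 6)) {s, a} \<and>
    (\<forall>x. t x \<in> {0..1} \<longrightarrow> s x \<in> {0..1} \<and> a x \<in> {0..1} \<and>
       a x = (t x)\<^sup>2 + s x * (1 - s x) / real K ^ (2 * i))"
proof (induction i)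
  case 0
  show ?case
    by (rule exI[of _ t], rule exI[of _ t]) (use assms in \<open>auto simp: algebra_simps power2_eq_square\<close>)
next
  case (Suc i)
  have W: "W \<ge> 1" and K: "real K \<ge> 1" using assms(2,3) by linarith+
  obtain s a where sa: "hidden_layer n W (Suc L + 2 * i) (S + i * (4 * K + 6)) {s, a}"
    "\<And>x. t x \<in> {0..1} \<Longrightarrow> s x \<in> {0..1}" "\<And>x. t x \<in> {0..1} \<Longrightarrow> a x \<in> {0..1}"
    "\<And>x. t x \<in> {0..1} \<Longrightarrow> a x = (t x)\<^sup>2 + s x * (1 - s x) / real K ^ (2 * i)" using Suc by blast
  have a0: "a x \<ge> 0" for x using hidden_nonneg[of n W "L + 2 * i" _ "{s, a}" a x] sa(1) by simp
  define g where "g k = (if k < K then (\<lambda>x. max 0 (s x - real k / real K)) else a)" for k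
  define F where "F = g ` {..<Suc K}"
  have "hidden_layer n W (Suc (Suc L + 2 * i)) (S + i * (4 * K + 6) + (\<Sum>k<Suc K. 2)) F" unfolding F_def
  proof (rule hidden_next_layer[OF sa(1)])
    fix k assume "k \<in> {..<Suc K}"
    show "neuron W {s, a} (g k) 2"
    proof (cases "k < K")
      case True
      have "real k / real K \<le> 1" using True by simp
      then have "\<bar>- (real k / real K)\<bar> \<le> W" using W by simp
      then show ?thesis
        using neuronI[OF _ wire_sum_wire[of s "{s, a}" 1 W], of "- (real k / real K)" 2] True W by (simp add: g_def)
    next
      case False
      then show ?thesis using neuron_carry[of a "{s, a}" W] a0 W by (simp add: g_def)
    qed
  qed simp
  then have F: "hidden_layer n W (Suc (Suc L + 2 * i)) (S + i * (4 * K + 6) + (2 * K + 2)) F" by (simp add: mult.commute)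
  have inF: "(\<lambda>x. max 0 (s x - real k / real K)) \<in> F" if "k < K" for k
    unfolding F_def by (rule image_eqI[of _ _ k]) (use that in \<open>auto simp: g_def\<close>)
  have aF: "a \<in> F" unfolding F_def by (rule image_eqI[of _ _ K]) (auto simp: g_def)
  define q where "q = 1 / real K ^ (2 * i)"
  have q: "0 \<le> q" "q \<le> 1" using K by (auto simp: q_def)
  define s' where "s' x = max 0 (0 + 1 * hinge_sum K (zig_slope K) (s x))" for x
  define a' where "a' x = max 0 (0 + (1 * a x + (- q) * hinge_sum K (arc_slope K) (s x)))" for x
  have "\<bar>arc_slope K k\<bar> \<le> 2" for k using K by (auto simp: arc_slope_def field_simps abs_le_iff)
  then have qa: "\<bar>- q * arc_slope K k\<bar> \<le> 1 * 2" for k unfolding abs_mult using q by (intro mult_mono) auto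
  have wa: "\<bar>- q * arc_slope K k\<bar> \<le> W" for k using qa[of k] assms(3) K by linarith
  have wz: "\<bar>1 * zig_slope K k\<bar> \<le> W" for k
    using assms(3) by (auto simp: zig_slope_def abs_mult power_abs)
  have s': "neuron W F s' (Suc K)" unfolding s'_def
    by (rule neuronI[OF _ wire_sum_hinge]) (use inF wz W in auto)
  have a': "neuron W F a' (K + 2)" unfolding a'_def
    by (rule neuronI[OF _ wire_sum_add[OF wire_sum_wire[OF aF] wire_sum_hinge]]) (use inF wa W in auto)
  have "hidden_layer n W (Suc (Suc (Suc L + 2 * i))) (S + i * (4 * K + 6) + (2 * K + 2) + (\<Sum>b\<in>UNIV. if b then Suc K else K + 2))
     ((\<lambda>b. if b then s' else a') ` UNIV)"
    by (rule hidden_next_layer[OF F]) (use s' a' in \<open>auto simp: UNIV_bool\<close>)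
  then have H: "hidden_layer n W (Suc L + 2 * Suc i) (S + Suc i * (4 * K + 6)) {s', a'}"
    using hidden_mono[of n W "Suc (Suc (Suc L + 2 * i))" _ _ "{s', a'}" "S + Suc i * (4 * K + 6)"]
    by (simp add: UNIV_bool algebra_simps insert_commute)
  have "s' x \<in> {0..1} \<and> a' x \<in> {0..1} \<and> a' x = (t x)\<^sup>2 + s' x * (1 - s' x) / real K ^ (2 * Suc i)"
    if "t x \<in> {0..1}" for x
  proof -
    note sx = sa(2)[OF that] and ax = sa(3)[OF that] and eq = sa(4)[OF that]
    note za = zigzag_arc[OF assms(2) sx]
    have s'x: "s' x = hinge_sum K (zig_slope K) (s x)" using za(1) by (simp add: s'_def)
    have "s x * (1 - s x) / real K ^ (2 * i) = q * hinge_sum K (arc_slope K) (s x) + s' x * (1 - s' x) / real K ^ (2 * Suc i)"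
      unfolding za(3) Let_def s'x q_def using K by (simp add: field_simps power2_eq_square)
    then have *: "a x - q * hinge_sum K (arc_slope K) (s x) = (t x)\<^sup>2 + s' x * (1 - s' x) / real K ^ (2 * Suc i)"
      using eq by simp
    have s'01: "s' x \<in> {0..1}" using s'x za(1) by simp
    then have "0 \<le> (t x)\<^sup>2 + s' x * (1 - s' x) / real K ^ (2 * Suc i)" by auto
    then have a'x: "a' x = (t x)\<^sup>2 + s' x * (1 - s' x) / real K ^ (2 * Suc i)" "a' x \<ge> 0"
      using * by (auto simp: a'_def)
    have "a' x \<le> 1" using a'x(1) * ax za(2) q(1) mult_nonneg_nonneg[OF q(1) za(2)] by (simp del: mult_nonneg_nonneg)
    then show ?thesis using s'01 a'x by auto
  qed
  then show ?case using H by blast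
qed

lemma hidden_square:
  assumes "hidden_layer n W (Suc L) S {t}" "K \<ge> 1" "W \<ge> 2 * real K"
  shows "\<exists>a. hidden_layer n W (Suc L + 2 * R) (S + R * (4 * K + 6)) {a} \<and>
    (\<forall>x. t x \<in> {0..1} \<longrightarrow> a x \<in> {0..1} \<and> \<bar>a x - (t x)\<^sup>2\<bar> \<le> 1 / real K ^ (2 * R))"
proof -
  obtain s a where sa: "hidden_layer n W (Suc L + 2 * R) (S + R * (4 * K + 6)) {s, a}"
    "\<And>x. t x \<in> {0..1} \<Longrightarrow> s x \<in> {0..1} \<and> a x \<in> {0..1} \<and>
       a x = (t x)\<^sup>2 + s x * (1 - s x) / real K ^ (2 * R)" using hidden_square_iterate[OF assms] by blast
  have err: "\<bar>a x - (t x)\<^sup>2\<bar> \<le> 1 / real K ^ (2 * R)" if "t x \<in> {0..1}" for x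
  proof -
    have "s x * (1 - s x) \<le> 1 * 1" using sa(2)[OF that] by (intro mult_mono) auto
    moreover have "0 \<le> s x * (1 - s x)" using sa(2)[OF that] by (intro mult_nonneg_nonneg) auto
    ultimately show ?thesis using sa(2)[OF that] by (auto intro!: divide_right_mono)
  qed
  show ?thesis
  proof (intro exI[of _ a] conjI allI impI)
    show "hidden_layer n W (Suc L + 2 * R) (S + R * (4 * K + 6)) {a}" by (rule hidden_mono[OF sa(1)]) auto
    fix x assume t: "t x \<in> {0..1}"
    show "a x \<in> {0..1}" using sa(2)[OF t] by simp
    show "\<bar>a x - (t x)\<^sup>2\<bar> \<le> 1 / real K ^ (2 * R)" by (rule err[OF t])
  qed
qed

text \<open>
  Every squaring doubles the error at most and adds \<open>K\<^sup>-\<^sup>2\<^sup>R\<close>.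
\<close>
lemma hidden_power:
  assumes "hidden_layer n W (Suc L) S {t}" "K \<ge> 1" "W \<ge> 2 * real K"
  shows "\<exists>a. hidden_layer n W (Suc L + 2 * R * q) (S + q * (R * (4 * K + 6))) {a} \<and>
    (\<forall>x. t x \<in> {0..1} \<longrightarrow> a x \<in> {0..1} \<and> \<bar>a x - t x ^ (2 ^ q)\<bar> \<le> (2 ^ q - 1) / real K ^ (2 * R))"
proof (induction q)
  case 0 then show ?case by (intro exI[of _ t]) (use assms in auto)
next
  case (Suc q)
  define \<delta> where "\<delta> = 1 / real K ^ (2 * R)"
  obtain a where a: "hidden_layer n W (Suc (L + 2 * R * q)) (S + q * (R * (4 * K + 6))) {a}"
    "\<And>x. t x \<in> {0..1} \<Longrightarrow> a x \<in> {0..1}" "\<And>x. t x \<in> {0..1} \<Longrightarrow> \<bar>a x - t x ^ (2 ^ q)\<bar> \<le> (2 ^ q - 1) * \<delta>"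
    using Suc by (auto simp: \<delta>_def)
  obtain b where b: "hidden_layer n W (Suc (L + 2 * R * q) + 2 * R) (S + q * (R * (4 * K + 6)) + R * (4 * K + 6)) {b}"
    "\<And>x. a x \<in> {0..1} \<Longrightarrow> b x \<in> {0..1} \<and> \<bar>b x - (a x)\<^sup>2\<bar> \<le> \<delta>"
    using hidden_square[OF a(1) assms(2,3), of R] by (auto simp: \<delta>_def)
  have err: "\<bar>b x - t x ^ (2 ^ Suc q)\<bar> \<le> (2 ^ Suc q - 1) * \<delta>" if t: "t x \<in> {0..1}" for x
  proof -
    define u where "u = t x ^ (2 ^ q)"
    have u: "0 \<le> u" "u \<le> 1" using t by (auto simp: u_def power_le_one)
    have "t x ^ (2 ^ Suc q) = u\<^sup>2" by (simp add: u_def power_mult[symmetric] mult.commute)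
    moreover have "\<bar>(a x)\<^sup>2 - u\<^sup>2\<bar> = \<bar>a x + u\<bar> * \<bar>a x - u\<bar>" by (simp add: abs_mult[symmetric] algebra_simps power2_eq_square)
    moreover have "\<bar>a x + u\<bar> * \<bar>a x - u\<bar> \<le> 2 * ((2 ^ q - 1) * \<delta>)"
      using a(2,3)[OF t] u by (intro mult_mono) (auto simp: u_def)
    moreover have "\<bar>b x - (a x)\<^sup>2\<bar> \<le> \<delta>" using b(2) a(2)[OF t] by blast
    ultimately have "\<bar>b x - t x ^ (2 ^ Suc q)\<bar> \<le> \<delta> + 2 * ((2 ^ q - 1) * \<delta>)" by linarith
    then show ?thesis by (simp add: algebra_simps)
  qed
  show ?case
  proof (intro exI[of _ b] conjI allI impI)
    show "hidden_layer n W (Suc L + 2 * R * Suc q) (S + Suc q * (R * (4 * K + 6))) {b}"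
      using b(1) by (simp add: algebra_simps)
    fix x assume t: "t x \<in> {0..1}"
    show "b x \<in> {0..1}" using b(2)[OF a(2)[OF t]] by simp
    show "\<bar>b x - t x ^ (2 ^ Suc q)\<bar> \<le> (2 ^ Suc q - 1) / real K ^ (2 * R)"
      using err[OF t] by (simp add: \<delta>_def)
  qed
qed

section \<open>Local interpolation by powers of affine forms\<close>

definition lagrange_poly :: "(nat \<Rightarrow> real) \<Rightarrow> nat \<Rightarrow> nat \<Rightarrow> real poly" where
  "lagrange_poly z k q = (\<Prod>r\<in>{..<k} - {q}. Polynomial.smult (1 / (z q - z r)) [:- z r, 1:])"

lemma poly_lagrange_poly: "poly (lagrange_poly z k q) t = (\<Prod>r\<in>{..<k} - {q}. (t - z r) / (z q - z r))"
  by (simp add: lagrange_poly_def poly_prod diff_divide_distrib)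

text \<open>
  Both sides have degree less than \<open>k\<close> and agree at the \<open>k\<close> nodes.
\<close>
lemma lagrange_poly_reproduces:
  assumes "inj_on z {..<k}" "Polynomial.degree P < k"
  shows "P = (\<Sum>q<k. Polynomial.smult (poly P (z q)) (lagrange_poly z k q))"
proof (rule poly_eqI_degree[where A = "z ` {..<k}"])
  have node: "poly (lagrange_poly z k q) (z s) = (if s = q then 1 else 0)" if "q < k" "s < k" for q s
  proof (cases "s = q")
    case True
    have "z q - z r \<noteq> 0" if "r \<in> {..<k} - {q}" for r
      using that \<open>q < k\<close> inj_onD[OF assms(1), of q r] by auto
    then show ?thesis using True by (simp add: poly_lagrange_poly)
  next
    case False
    then have "(\<Prod>r\<in>{..<k} - {q}. (z s - z r) / (z q - z r)) = 0" using that by (intro prod_zero) auto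
    then show ?thesis using False by (simp add: poly_lagrange_poly)
  qed
  fix x assume "x \<in> z ` {..<k}"
  then obtain s where s: "x = z s" "s < k" by auto
  have "(\<Sum>q<k. poly P (z q) * poly (lagrange_poly z k q) (z s)) = (\<Sum>q<k. if s = q then poly P (z q) else 0)"
    by (rule sum.cong) (use node s in auto)
  then show "poly P x = poly (\<Sum>q<k. Polynomial.smult (poly P (z q)) (lagrange_poly z k q)) x"
    using s by (simp add: poly_sum)
next
  have "card (z ` {..<k}) = k" using assms(1) by (simp add: card_image)
  moreover have "Polynomial.degree (lagrange_poly z k q) < k" if "q < k" for q
  proof -
    have "Polynomial.degree (lagrange_poly z k q) \<le> (\<Sum>r\<in>{..<k} - {q}. Polynomial.degree (Polynomial.smult (1 / (z q - z r)) [:- z r, 1:]))"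
      unfolding lagrange_poly_def by (rule degree_prod_sum_le[of "{..<k} - {q}" "\<lambda>r. Polynomial.smult (1 / (z q - z r)) [:- z r, 1:]", unfolded o_def]) simp
    also have "\<dots> \<le> (\<Sum>r\<in>{..<k} - {q}. 1)" by (rule sum_mono) auto
    also have "\<dots> < k" using that by (simp add: card_Diff_singleton_if)
    finally show ?thesis .
  qed
  then have "Polynomial.degree (Polynomial.smult (poly P (z q)) (lagrange_poly z k q)) < k" if "q < k" for q
    using that degree_smult_le[of "poly P (z q)" "lagrange_poly z k q"] le_less_trans by blast
  then have "Polynomial.degree (\<Sum>q<k. Polynomial.smult (poly P (z q)) (lagrange_poly z k q)) < k"
    using assms(2) by (intro degree_sum_less) auto
  ultimately show "Polynomial.degree P < card (z ` {..<k})"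
      "Polynomial.degree (\<Sum>q<k. Polynomial.smult (poly P (z q)) (lagrange_poly z k q)) < card (z ` {..<k})" using assms by simp_all
qed

definition affine_form :: "nat \<Rightarrow> real \<times> (nat \<Rightarrow> real) \<Rightarrow> (nat \<Rightarrow> real) \<Rightarrow> real" where
  "affine_form d u y = fst u + (\<Sum>j<d. snd u j * y j)"

text \<open>
  Linear combinations of \<open>p\<close>-th powers of affine forms. For a power of two \<open>p\<close> repeated squaring
  computes them, so that no products of different functions have to be approximated.
\<close>
definition ridge :: "nat \<Rightarrow> nat \<Rightarrow> ((nat \<Rightarrow> real) \<Rightarrow> real) \<Rightarrow> bool" where
  "ridge d p g \<longleftrightarrow> (\<exists>us. g = (\<lambda>y. \<Sum>(c, u)\<leftarrow>us. c * affine_form d u y ^ p))"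

lemma ridge_single: "ridge d p (\<lambda>y. c * affine_form d u y ^ p)"
  unfolding ridge_def by (rule exI[of _ "[(c, u)]"]) simp

lemma ridge_zero: "ridge d p (\<lambda>y. 0)"
  unfolding ridge_def by (rule exI[of _ "[]"]) simp

lemma ridge_add: "ridge d p g \<Longrightarrow> ridge d p h \<Longrightarrow> ridge d p (\<lambda>y. g y + h y)"
proof -
  assume "ridge d p g" "ridge d p h"
  then obtain us vs where "g = (\<lambda>y. \<Sum>(c, u)\<leftarrow>us. c * affine_form d u y ^ p)" "h = (\<lambda>y. \<Sum>(c, u)\<leftarrow>vs. c * affine_form d u y ^ p)"
    unfolding ridge_def by auto
  then show ?thesis unfolding ridge_def by (intro exI[of _ "us @ vs"]) simp
qed

lemma ridge_sum: "finite I \<Longrightarrow> (\<And>i. i \<in> I \<Longrightarrow> ridge d p (g i)) \<Longrightarrow> ridge d p (\<lambda>y. \<Sum>i\<in>I. g i y)"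
  by (induction I rule: finite_induct) (simp_all add: ridge_zero ridge_add)

text \<open>
  The polynomial \<open>(a + b X)\<^sup>k\<^sup>+\<^sup>1\<close> has the coefficient \<open>(k + 1) a\<^sup>k b\<close> at \<open>X\<close>; interpolation at the points
  \<open>0, ..., k + 1\<close> expresses it by values of the polynomial.
\<close>
lemma power_times_as_powers:
  fixes a b :: real
  shows "a ^ k * b = (\<Sum>q<k + 2. (Polynomial.coeff (lagrange_poly real (k + 2) q) 1 / real (Suc k)) * (a + real q * b) ^ Suc k)"
proof -
  define P where "P = [:a, b:] ^ Suc k"
  have "Polynomial.degree P \<le> 1 * Suc k" unfolding P_def by (rule order_trans[OF degree_power_le]) simp
  then have P: "P = (\<Sum>q<k + 2. Polynomial.smult (poly P (real q)) (lagrange_poly real (k + 2) q))"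
    by (intro lagrange_poly_reproduces) (auto simp: inj_on_def)
  have "real (Suc k) * (a ^ k * b) = poly (pderiv P) 0"
    unfolding P_def pderiv_power_Suc by (simp add: pderiv_pCons)
  also have "\<dots> = Polynomial.coeff P 1" by (simp add: poly_0_coeff_0 coeff_pderiv)
  also have "\<dots> = (\<Sum>q<k + 2. poly P (real q) * Polynomial.coeff (lagrange_poly real (k + 2) q) 1)"
    by (subst P) (simp add: coeff_sum)
  also have "\<dots> = (\<Sum>q<k + 2. (a + real q * b) ^ Suc k * Polynomial.coeff (lagrange_poly real (k + 2) q) 1)"
    by (simp only: P_def poly_power poly_pCons poly_0 mult_zero_right add_0_right)
  finally have "a ^ k * b = (\<Sum>q<k + 2. (a + real q * b) ^ Suc k * Polynomial.coeff (lagrange_poly real (k + 2) q) 1) / real (Suc k)"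
    by (simp add: field_simps del: sum.lessThan_Suc)
  also have "\<dots> = (\<Sum>q<k + 2. (a + real q * b) ^ Suc k * Polynomial.coeff (lagrange_poly real (k + 2) q) 1 / real (Suc k))"
    by (rule sum_divide_distrib)
  also have "\<dots> = (\<Sum>q<k + 2. (Polynomial.coeff (lagrange_poly real (k + 2) q) 1 / real (Suc k)) * (a + real q * b) ^ Suc k)"
    by (rule sum.cong) simp_all
  finally show ?thesis .
qed

lemma ridge_mult_aff:
  assumes "ridge d k g" shows "ridge d (Suc k) (\<lambda>y. g y * affine_form d v y)"
proof -
  obtain us where us: "g = (\<lambda>y. \<Sum>(c, u)\<leftarrow>us. c * affine_form d u y ^ k)" using assms unfolding ridge_def by auto
  have "ridge d (Suc k) (\<lambda>y. (\<Sum>(c, u)\<leftarrow>us. c * affine_form d u y ^ k) * affine_form d v y)"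
  proof (induction us)
    case Nil then show ?case by (simp add: ridge_zero)
  next
    case (Cons t us)
    obtain c u where t: "t = (c, u)" by (cases t)
    define w where "w q = (fst u + real q * fst v, \<lambda>j. snd u j + real q * snd v j)" for q
    have w: "affine_form d (w q) y = affine_form d u y + real q * affine_form d v y" for q y
      by (simp add: affine_form_def w_def algebra_simps sum.distrib sum_distrib_left)
    have "ridge d (Suc k) (\<lambda>y. \<Sum>q<k + 2. (c * (Polynomial.coeff (lagrange_poly real (k + 2) q) 1 / real (Suc k))) * affine_form d (w q) y ^ Suc k)"
      by (rule ridge_sum[OF _ ridge_single]) simp
    also have "(\<lambda>y. \<Sum>q<k + 2. (c * (Polynomial.coeff (lagrange_poly real (k + 2) q) 1 / real (Suc k))) * affine_form d (w q) y ^ Suc k)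
       = (\<lambda>y. c * (affine_form d u y ^ k * affine_form d v y))"
      unfolding w power_times_as_powers sum_distrib_left mult.assoc ..
    finally have 1: "ridge d (Suc k) (\<lambda>y. c * (affine_form d u y ^ k * affine_form d v y))" .
    show ?case using ridge_add[OF 1 Cons] by (simp add: t algebra_simps)
  qed
  then show ?thesis using us by simp
qed

lemma ridge_mult_prod:
  assumes "finite S" "\<And>s. s \<in> S \<Longrightarrow> \<exists>v. h s = affine_form d v" "ridge d k g"
  shows "ridge d (k + card S) (\<lambda>y. g y * (\<Prod>s\<in>S. h s y))"
  using assms(1,2)
proof (induction S rule: finite_induct)
  case empty then show ?case using assms(3) by simp
next
  case (insert s S)
  obtain v where v: "h s = affine_form d v" using insert by blast
  have "ridge d (Suc (k + card S)) (\<lambda>y. (g y * (\<Prod>s\<in>S. h s y)) * affine_form d v y)"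
    by (rule ridge_mult_aff) (use insert in auto)
  then show ?case using insert v by (simp add: algebra_simps)
qed

text \<open>
  A product of Lagrange basis polynomials is a product of \<open>d (m - 1)\<close> affine forms; factors 1 raise
  their number to \<open>p\<close>.
\<close>
lemma ridge_tensor:
  assumes "d * (m - 1) \<le> p" "\<And>j. j < d \<Longrightarrow> q j < m"
  shows "ridge d p (\<lambda>y. \<Prod>j<d. poly (lagrange_poly z m (q j)) (y j))"
proof -
  define S where "S = (SIGMA j:{..<d}. {..<m} - {q j})"
  define h where "h s y = (y (fst s) - z (snd s)) / (z (q (fst s)) - z (snd s))" for s :: "nat \<times> nat" and y :: "nat \<Rightarrow> real"
  have fin: "finite S" by (simp add: S_def)
  have h: "\<exists>v. h s = affine_form d v" if sS: "s \<in> S" for s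
  proof -
    obtain j r where s: "s = (j, r)" "j < d" using sS unfolding S_def by blast
    define e where "e = 1 / (z (q j) - z r)"
    have "(\<Sum>i<d. (if i = j then e else 0) * y i) = e * y j" for y :: "nat \<Rightarrow> real"
      using s(2) sum.delta[of "{..<d}" j "\<lambda>i. e * y i"] by (simp add: if_distrib[of "\<lambda>c. c * _"] cong: if_cong)
    then have "affine_form d (- z r * e, \<lambda>i. if i = j then e else 0) y = h s y" for y
      by (simp add: h_def affine_form_def s diff_divide_distrib) (simp add: e_def)
    then have "h s = affine_form d (- z r * e, \<lambda>i. if i = j then e else 0)" by (intro ext) simp
    then show ?thesis by (rule exI)
  qed
  have "card S = (\<Sum>j<d. card ({..<m} - {q j}))" by (simp add: S_def)
  also have "\<dots> = (\<Sum>j<d. m - 1)" by (rule sum.cong) (use assms(2) in \<open>auto simp: card_Diff_singleton_if\<close>)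
  finally have card: "card S = d * (m - 1)" by simp
  have one: "(\<lambda>_. 1) = affine_form d (1, \<lambda>_. 0)" by (simp add: affine_form_def fun_eq_iff)
  then have "ridge d 0 (\<lambda>y. 1)" using ridge_single[of d 0 1 "(1, \<lambda>_. 0)"] by (simp add: affine_form_def)
  from ridge_mult_prod[of "{..<p - d * (m - 1)}" "\<lambda>_ _. 1", OF _ _ this]
  have "ridge d (p - d * (m - 1)) (\<lambda>y. 1)"
    using exI[of "\<lambda>v. (\<lambda>_. 1) = affine_form d v", OF one] by simp
  from ridge_mult_prod[OF fin h this]
  have "ridge d (p - d * (m - 1) + d * (m - 1)) (\<lambda>y. 1 * (\<Prod>s\<in>S. h s y))" by (simp only: card)
  moreover have "(\<Prod>s\<in>S. h s y) = (\<Prod>j<d. poly (lagrange_poly z m (q j)) (y j))" for y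
    unfolding S_def poly_lagrange_poly h_def by (subst prod.Sigma) (auto intro!: prod.cong)
  ultimately show ?thesis using assms(1) by simp
qed

definition unit_node :: "nat \<Rightarrow> nat \<Rightarrow> real" where "unit_node m q = real q / real m"

lemma lagrange_poly_bounded: "\<exists>\<Lambda>\<ge>1. \<forall>q<m. \<forall>t\<in>{0..1}. \<bar>poly (lagrange_poly z m q) t\<bar> \<le> \<Lambda>"
proof -
  have "\<exists>b. \<forall>t\<in>{0..1}. \<bar>poly (lagrange_poly z m q) t\<bar> \<le> b" for q
  proof -
    have "compact ((\<lambda>t. poly (lagrange_poly z m q) t) ` {0..1})"
      by (intro compact_continuous_image continuous_intros) auto
    then have "bounded ((\<lambda>t. poly (lagrange_poly z m q) t) ` {0..1})" by (rule compact_imp_bounded)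
    then show ?thesis by (auto simp: bounded_iff)
  qed
  then obtain b where b: "\<And>q t. t \<in> {0..1} \<Longrightarrow> \<bar>poly (lagrange_poly z m q) t\<bar> \<le> b q" by metis
  have "\<bar>poly (lagrange_poly z m q) t\<bar> \<le> 1 + (\<Sum>q<m. \<bar>b q\<bar>)" if "q < m" "t \<in> {0..1}" for q t
  proof -
    have "\<bar>b q\<bar> \<le> (\<Sum>q<m. \<bar>b q\<bar>)" by (rule member_le_sum) (use that in auto)
    then show ?thesis using b[OF that(2), of q] by linarith
  qed
  then show ?thesis by (intro exI[of _ "1 + (\<Sum>q<m. \<bar>b q\<bar>)"]) (auto simp: sum_nonneg)
qed

text \<open>
  Interpolation reproduces the Taylor polynomial, so only the Taylor remainder and its interpolant
  are left.
\<close>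
lemma lagrange_interpolation_error:
  fixes D :: "nat \<Rightarrow> real \<Rightarrow> real"
  assumes m: "m \<ge> 1" and h: "h \<ge> 0" and B: "B \<ge> 0"
    and der: "\<And>k t. k < m \<Longrightarrow> a \<le> t \<Longrightarrow> t \<le> a + h \<Longrightarrow> (D k has_real_derivative D (Suc k) t) (at t)"
    and bd: "\<And>t. a \<le> t \<Longrightarrow> t \<le> a + h \<Longrightarrow> \<bar>D m t\<bar> \<le> B"
    and \<Lambda>: "\<Lambda> \<ge> 1" "\<And>q t. q < m \<Longrightarrow> t \<in> {0..1} \<Longrightarrow> \<bar>poly (lagrange_poly (unit_node m) m q) t\<bar> \<le> \<Lambda>"
    and y: "y \<in> {0..1}"
  shows "\<bar>D 0 (a + h * y) - (\<Sum>q<m. D 0 (a + h * unit_node m q) * poly (lagrange_poly (unit_node m) m q) y)\<bar> \<le> (1 + real m * \<Lambda>) * (B * h ^ m)"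
proof -
  define P where "P = (\<Sum>k<m. Polynomial.monom (D k a / fact k * h ^ k) k)"
  have "Polynomial.degree P < m" unfolding P_def using m
    by (intro degree_sum_less) (auto intro: le_less_trans[OF degree_monom_le])
  moreover have "inj_on (unit_node m) {..<m}" using m by (auto simp: inj_on_def unit_node_def)
  ultimately have "P = (\<Sum>q<m. Polynomial.smult (poly P (unit_node m q)) (lagrange_poly (unit_node m) m q))" by (rule lagrange_poly_reproduces[rotated])
  from arg_cong[OF this, of "\<lambda>p. poly p y"]
  have rep: "poly P y = (\<Sum>q<m. poly P (unit_node m q) * poly (lagrange_poly (unit_node m) m q) y)" by (simp add: poly_sum)
  have R: "\<bar>D 0 (a + h * t) - poly P t\<bar> \<le> B * h ^ m" if t: "t \<in> {0..1}" for t
  proof (cases "h * t = 0")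
    case True
    have "poly P t = (\<Sum>k<m. D k a / fact k * (h * t) ^ k)"
      by (simp add: P_def poly_sum poly_monom power_mult_distrib mult.assoc)
    also have "\<dots> = (\<Sum>k<m. if k = 0 then D 0 a else 0)" by (rule sum.cong) (auto simp: True)
    also have "\<dots> = D 0 a" using m by simp
    finally have "poly P t = D 0 a" .
    then have "D 0 (a + h * t) - poly P t = 0" unfolding True by simp
    then show ?thesis using B h by simp
  next
    case False
    then have ht: "0 < h * t" using h t by (simp add: less_le)
    have hh: "h * t \<le> h" using t h by (simp add: mult_left_le)
    have "\<exists>s>a. s < a + h * t \<and> D 0 (a + h * t) = (\<Sum>k<m. D k a / fact k * ((a + h * t) - a) ^ k) + D m s / fact m * ((a + h * t) - a) ^ m"
    proof (rule Taylor_up[where a = a])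
      show "\<forall>k s. k < m \<and> a \<le> s \<and> s \<le> a + h * t \<longrightarrow> (D k has_real_derivative D (Suc k) s) (at s)"
        using der hh by auto
    qed (use m ht in auto)
    then obtain s where s: "a < s" "s < a + h * t"
      "D 0 (a + h * t) = (\<Sum>k<m. D k a / fact k * (h * t) ^ k) + D m s / fact m * (h * t) ^ m" by auto
    have "poly P t = (\<Sum>k<m. D k a / fact k * (h * t) ^ k)"
      by (simp add: P_def poly_sum poly_monom power_mult_distrib mult.assoc)
    then have "\<bar>D 0 (a + h * t) - poly P t\<bar> = \<bar>D m s\<bar> / fact m * (h * t) ^ m"
      using s(3) ht by (simp add: abs_mult)
    also have "\<dots> \<le> B * h ^ m"
    proof (intro mult_mono power_mono hh)
      have "\<bar>D m s\<bar> / fact m \<le> \<bar>D m s\<bar> / 1" by (intro divide_left_mono) (auto simp: fact_ge_1)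
      then show "\<bar>D m s\<bar> / fact m \<le> B" using bd[of s] s hh by simp
    qed (use B ht in auto)
    finally show ?thesis .
  qed
  have unit_node: "unit_node m q \<in> {0..1}" if "q < m" for q using that by (simp add: unit_node_def)
  have "D 0 (a + h * y) - (\<Sum>q<m. D 0 (a + h * unit_node m q) * poly (lagrange_poly (unit_node m) m q) y)
    = (D 0 (a + h * y) - poly P y) - (\<Sum>q<m. (D 0 (a + h * unit_node m q) - poly P (unit_node m q)) * poly (lagrange_poly (unit_node m) m q) y)"
    unfolding rep by (simp add: sum_subtractf algebra_simps)
  also have "\<bar>\<dots>\<bar> \<le> B * h ^ m + (\<Sum>q<m. (B * h ^ m) * \<Lambda>)"
  proof (rule order_trans[OF abs_triangle_ineq4 add_mono[OF R[OF y]]])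
    show "\<bar>\<Sum>q<m. (D 0 (a + h * unit_node m q) - poly P (unit_node m q)) * poly (lagrange_poly (unit_node m) m q) y\<bar> \<le> (\<Sum>q<m. (B * h ^ m) * \<Lambda>)"
      by (rule order_trans[OF sum_abs sum_mono], unfold abs_mult, rule mult_mono)
         (use R unit_node \<Lambda> y B h in auto)
  qed
  finally show ?thesis by (simp add: algebra_simps)
qed

text \<open>
  Tensor product interpolation changes one coordinate at a time. Therefore its error is controlled by
  the derivatives in the directions of the axes, and mixed derivatives do not occur.
\<close>
definition pure_smooth :: "nat \<Rightarrow> nat \<Rightarrow> real \<Rightarrow> ((nat \<Rightarrow> real) \<Rightarrow> real) \<Rightarrow> bool" where
  "pure_smooth d m B f \<longleftrightarrow> (\<forall>w\<in>Qcube d. \<bar>f w\<bar> \<le> B \<and> (\<forall>j<d. \<bar>(pd j ^^ m) f w\<bar> \<le> B \<and>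
     (\<forall>k<m. ((\<lambda>t. (pd j ^^ k) f (w(j := t))) has_real_derivative (pd j ^^ Suc k) f w) (at (w j)))))"

lemma sum_PiE_insert:
  fixes g :: "('a \<Rightarrow> 'b) \<Rightarrow> real"
  assumes "j \<notin> S"
  shows "(\<Sum>q\<in>PiE (insert j S) T. g q) = (\<Sum>q\<in>PiE S T. \<Sum>r\<in>T j. g (q(j := r)))"
proof -
  have "(\<Sum>q\<in>PiE (insert j S) T. g q) = (\<Sum>x\<in>T j \<times> PiE S T. g ((snd x)(j := fst x)))"
    unfolding PiE_insert_eq by (subst sum.reindex[OF inj_combinator[OF assms]]) (simp add: case_prod_beta)
  also have "\<dots> = (\<Sum>r\<in>T j. \<Sum>q\<in>PiE S T. g (q(j := r)))"
    by (simp add: sum.cartesian_product case_prod_beta)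
  also have "\<dots> = (\<Sum>q\<in>PiE S T. \<Sum>r\<in>T j. g (q(j := r)))" by (rule sum.swap)
  finally show ?thesis .
qed

definition cell_node :: "nat \<Rightarrow> nat \<Rightarrow> (nat \<Rightarrow> nat) \<Rightarrow> nat \<Rightarrow> nat \<Rightarrow> real" where
  "cell_node N m \<kappa> j r = real (\<kappa> j) / real N - 1 / 2 + 1 / real N * unit_node m r"

text \<open>
  The point after interpolation in the first \<open>j\<close> coordinates, with the nodes selected by \<open>q\<close>.
\<close>
definition at_nodes :: "nat \<Rightarrow> (nat \<Rightarrow> nat \<Rightarrow> real) \<Rightarrow> (nat \<Rightarrow> nat) \<Rightarrow> (nat \<Rightarrow> real) \<Rightarrow> nat \<Rightarrow> real" where
  "at_nodes j P q x = (\<lambda>i. if i < j then P i (q i) else x i)"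

lemma cell_node_in:
  assumes "N \<ge> 1" "\<kappa> i < N" "r < m" shows "cell_node N m \<kappa> i r \<in> {-1/2..1/2}"
proof -
  have "0 \<le> unit_node m r" "unit_node m r \<le> 1" using assms by (auto simp: unit_node_def)
  moreover have "real (\<kappa> i) + 1 \<le> real N" using assms by linarith
  ultimately have *: "0 \<le> real (\<kappa> i) + unit_node m r" "real (\<kappa> i) + unit_node m r \<le> real N" by auto
  have "0 \<le> (real (\<kappa> i) + unit_node m r) / real N" using * by simp
  moreover have "(real (\<kappa> i) + unit_node m r) / real N \<le> 1" using * assms(1) by (simp add: divide_le_eq)
  moreover have "cell_node N m \<kappa> i r = (real (\<kappa> i) + unit_node m r) / real N - 1 / 2"
    by (simp add: cell_node_def add_divide_distrib)
  ultimately show ?thesis unfolding atLeastAtMost_iff by linarith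
qed

text \<open>
  Passing from \<open>j\<close> to \<open>j + 1\<close> interpolated coordinates adds \<open>m\<^sup>j\<close> one-dimensional interpolation
  errors, weighted by products of \<open>j\<close> basis polynomials.
\<close>
lemma tensor_interpolation_error:
  assumes m: "m \<ge> 1" and f: "pure_smooth d m B f" and B: "B \<ge> 0" and N: "N \<ge> 1"
    and \<kappa>: "\<And>j. j < d \<Longrightarrow> \<kappa> j < N"
    and \<Lambda>: "\<Lambda> \<ge> 1" "\<And>q t. q < m \<Longrightarrow> t \<in> {0..1} \<Longrightarrow> \<bar>poly (lagrange_poly (unit_node m) m q) t\<bar> \<le> \<Lambda>"
    and x: "x \<in> Qcube d" and y: "\<And>j. j < d \<Longrightarrow> y j \<in> {0..1}" "\<And>j. j < d \<Longrightarrow> y j = real N * (x j + 1 / 2) - real (\<kappa> j)"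
    and j: "j \<le> d"
  shows "\<bar>f x - (\<Sum>q\<in>PiE {..<j} (\<lambda>_. {..<m}). f (at_nodes j (cell_node N m \<kappa>) q x) * (\<Prod>i<j. poly (lagrange_poly (unit_node m) m (q i)) (y i)))\<bar>
    \<le> real j * ((real m * \<Lambda>) ^ d * ((1 + real m * \<Lambda>) * (B * (1 / real N) ^ m)))"
  using j
proof (induction j)
  case 0
  have "at_nodes 0 (cell_node N m \<kappa>) q x = x" for q by (simp add: at_nodes_def)
  then show ?case by (simp add: PiE_empty_domain)
next
  case (Suc j)
  define E where "E = (1 + real m * \<Lambda>) * (B * (1 / real N) ^ m)"
  have E: "E \<ge> 0" using \<Lambda>(1) B by (simp add: E_def)
  have jd: "j < d" using Suc by simp
  have mL: "1 \<le> real m * \<Lambda>" using m \<Lambda>(1) by (simp add: mult_ge1_I)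
  let ?Q = "PiE {..<j} (\<lambda>_. {..<m})"
  let ?l = "\<lambda>r t. poly (lagrange_poly (unit_node m) m r) t"
  let ?P = "cell_node N m \<kappa>"
  have cell_in: "?P i r \<in> {-1/2..1/2}" if "i < d" "r < m" for i r
    by (rule cell_node_in) (use N \<kappa> that in auto)
  have at_Q: "at_nodes j ?P q x \<in> Qcube d" if "q \<in> ?Q" for q
    using x cell_in that jd unfolding Qcube_def at_nodes_def
    by (auto simp: PiE_iff extensional_def)
  have one: "\<bar>f (at_nodes j ?P q x) - (\<Sum>r<m. f (at_nodes (Suc j) ?P (q(j := r)) x) * ?l r (y j))\<bar> \<le> E" if q: "q \<in> ?Q" for q
  proof -
    define w where "w = at_nodes j ?P q x"
    define a where "a = real (\<kappa> j) / real N - 1 / 2"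
    have wj: "w j = x j" by (simp add: w_def at_nodes_def)
    have xj: "a + 1 / real N * y j = x j" using N y(2)[OF jd] by (simp add: a_def field_simps)
    have nodes: "at_nodes (Suc j) ?P (q(j := r)) x = w(j := a + 1 / real N * unit_node m r)" for r
      by (auto simp: at_nodes_def w_def a_def cell_node_def less_Suc_eq)
    have wQ: "w(j := t) \<in> Qcube d" if "a \<le> t" "t \<le> a + 1 / real N" for t
    proof -
      have "real (\<kappa> j) + 1 \<le> real N" using \<kappa>[OF jd] by linarith
      then have "(real (\<kappa> j) + 1) / real N \<le> 1" using N by simp
      then have "a + 1 / real N \<le> 1 / 2" unfolding a_def add_divide_distrib by linarith
      moreover have "- 1 / 2 \<le> a" by (simp add: a_def)
      ultimately have "t \<in> {-1/2..1/2}" using that by simp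
      then show ?thesis using at_Q[OF q] jd unfolding w_def Qcube_def by (auto simp: PiE_iff extensional_def)
    qed
    have "\<bar>(pd j ^^ 0) f (w(j := a + 1 / real N * y j)) - (\<Sum>r<m. (pd j ^^ 0) f (w(j := a + 1 / real N * unit_node m r)) * ?l r (y j))\<bar>
      \<le> (1 + real m * \<Lambda>) * (B * (1 / real N) ^ m)"
    proof (rule lagrange_interpolation_error[where D = "\<lambda>k t. (pd j ^^ k) f (w(j := t))", OF m _ B _ _ \<Lambda> y(1)[OF jd]])
      fix k t assume k: "k < m" and t: "a \<le> t" "t \<le> a + 1 / real N"
      show "((\<lambda>t. (pd j ^^ k) f (w(j := t))) has_real_derivative (pd j ^^ Suc k) f (w(j := t))) (at t)"
        using f wQ[OF t] jd k unfolding pure_smooth_def by fastforce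
    next
      fix t assume t: "a \<le> t" "t \<le> a + 1 / real N"
      show "\<bar>(pd j ^^ m) f (w(j := t))\<bar> \<le> B" using f wQ[OF t] jd unfolding pure_smooth_def by blast
    qed simp_all
    then show ?thesis unfolding E_def nodes w_def[symmetric] xj by (simp add: wj[symmetric])
  qed
  define T where "T j = (\<Sum>q\<in>PiE {..<j} (\<lambda>_. {..<m}). f (at_nodes j ?P q x) * (\<Prod>i<j. ?l (q i) (y i)))" for j
  have "T (Suc j) = (\<Sum>q\<in>?Q. \<Sum>r<m. f (at_nodes (Suc j) ?P (q(j := r)) x) * (\<Prod>i<Suc j. ?l ((q(j := r)) i) (y i)))"
    unfolding T_def lessThan_Suc by (rule sum_PiE_insert) simp
  also have "\<dots> = (\<Sum>q\<in>?Q. (\<Sum>r<m. f (at_nodes (Suc j) ?P (q(j := r)) x) * ?l r (y j)) * (\<Prod>i<j. ?l (q i) (y i)))"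
    by (simp add: sum_distrib_left sum_distrib_right mult_ac)
  finally have TT: "T j - T (Suc j) = (\<Sum>q\<in>?Q. (f (at_nodes j ?P q x) - (\<Sum>r<m. f (at_nodes (Suc j) ?P (q(j := r)) x) * ?l r (y j))) * (\<Prod>i<j. ?l (q i) (y i)))"
    by (simp add: T_def sum_subtractf algebra_simps)
  have "\<bar>T j - T (Suc j)\<bar> \<le> (\<Sum>q\<in>?Q. E * \<Lambda> ^ j)"
    unfolding TT
  proof (rule order_trans[OF sum_abs], rule sum_mono)
    fix q assume q: "q \<in> ?Q"
    have "(\<Prod>i<j. \<bar>?l (q i) (y i)\<bar>) \<le> (\<Prod>i<j. \<Lambda>)"
      by (rule prod_mono) (use \<Lambda>(2) y(1) q jd in \<open>auto simp: PiE_iff\<close>)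
    then have "\<bar>\<Prod>i<j. ?l (q i) (y i)\<bar> \<le> \<Lambda> ^ j" by (simp add: abs_prod)
    from mult_mono[OF one[OF q] this E abs_ge_zero]
    show "\<bar>(f (at_nodes j ?P q x) - (\<Sum>r<m. f (at_nodes (Suc j) ?P (q(j := r)) x) * ?l r (y j))) * (\<Prod>i<j. ?l (q i) (y i))\<bar> \<le> E * \<Lambda> ^ j"
      by (simp only: abs_mult)
  qed
  also have "\<dots> = (real m * \<Lambda>) ^ j * E" by (simp add: card_PiE power_mult_distrib)
  also have "\<dots> \<le> (real m * \<Lambda>) ^ d * E" using mL jd E by (intro mult_right_mono power_increasing) auto
  finally have "\<bar>T j - T (Suc j)\<bar> \<le> (real m * \<Lambda>) ^ d * E" .
  moreover have "\<bar>f x - T j\<bar> \<le> real j * ((real m * \<Lambda>) ^ d * E)"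
    using Suc by (simp add: T_def E_def)
  ultimately have "\<bar>f x - T (Suc j)\<bar> \<le> real (Suc j) * ((real m * \<Lambda>) ^ d * E)"
    by (simp add: algebra_simps)
  then show ?case by (simp only: T_def E_def)
qed

text \<open>
  The affine forms \<open>u\<close> and the constant \<open>C\<close> are the same for all functions and all cells; only the
  coefficients \<open>a\<close> vary. They are multiples of values of \<open>f\<close> at the nodes, which bounds them.
\<close>
lemma local_ridge_approximation:
  assumes m: "m \<ge> 1" and p: "d * (m - 1) \<le> p"
  shows "\<exists>(I :: ((nat \<Rightarrow> nat) \<times> nat) set) u C. finite I \<and> C \<ge> 0 \<and>
    (\<forall>i\<in>I. \<forall>y. (\<forall>j<d. y j \<in> {0..1}) \<longrightarrow> \<bar>affine_form d (u i) y\<bar> \<le> 1) \<and>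
    (\<forall>B N f \<kappa>. pure_smooth d m B f \<and> B \<ge> 0 \<and> N \<ge> 1 \<and> (\<forall>j<d. \<kappa> j < N) \<longrightarrow>
      (\<exists>a. (\<Sum>i\<in>I. \<bar>a i\<bar>) \<le> C * B \<and>
        (\<forall>x\<in>Qcube d. \<forall>y. (\<forall>j<d. y j \<in> {0..1} \<and> y j = real N * (x j + 1 / 2) - real (\<kappa> j)) \<longrightarrow>
          \<bar>f x - (\<Sum>i\<in>I. a i * affine_form d (u i) y ^ p)\<bar> \<le> C * B / real N ^ m)))"
proof -
  define Q where "Q = PiE {..<d} (\<lambda>_. {..<m})"
  have Q: "finite Q" by (simp add: Q_def finite_PiE)
  obtain \<Lambda> where \<Lambda>: "\<Lambda> \<ge> 1" "\<And>q t. q < m \<Longrightarrow> t \<in> {0..1} \<Longrightarrow> \<bar>poly (lagrange_poly (unit_node m) m q) t\<bar> \<le> \<Lambda>"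
    using lagrange_poly_bounded[of m "unit_node m"] by auto
  have "\<forall>q\<in>Q. \<exists>us. (\<lambda>y. \<Prod>j<d. poly (lagrange_poly (unit_node m) m (q j)) (y j)) = (\<lambda>y. \<Sum>(c, u)\<leftarrow>us. c * affine_form d u y ^ p)"
  proof
    fix q assume "q \<in> Q"
    then have "\<And>j. j < d \<Longrightarrow> q j < m" by (auto simp: Q_def PiE_iff)
    from ridge_tensor[OF p this, where z = "unit_node m"]
    show "\<exists>us. (\<lambda>y. \<Prod>j<d. poly (lagrange_poly (unit_node m) m (q j)) (y j)) = (\<lambda>y. \<Sum>(c, u)\<leftarrow>us. c * affine_form d u y ^ p)"
      unfolding ridge_def by simp
  qed
  from bchoice[OF this] obtain us where us:
    "\<forall>q\<in>Q. (\<lambda>y. \<Prod>j<d. poly (lagrange_poly (unit_node m) m (q j)) (y j)) = (\<lambda>y. \<Sum>(c, u)\<leftarrow>us q. c * affine_form d u y ^ p)" ..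
  define I where "I = (SIGMA q:Q. {..<length (us q)})"
  have I: "finite I" using Q by (simp add: I_def)
  define c where "c i = fst (us (fst i) ! snd i)" for i
  define v where "v i = snd (us (fst i) ! snd i)" for i
  define s where "s i = \<bar>fst (v i)\<bar> + (\<Sum>j<d. \<bar>snd (v i) j\<bar>) + 1" for i
  have s: "s i > 0" for i unfolding s_def by (simp add: add_nonneg_pos sum_nonneg)
  define u where "u i = (fst (v i) / s i, \<lambda>j. snd (v i) j / s i)" for i
  have aff_u: "affine_form d (u i) y = affine_form d (v i) y / s i" for i y
    by (simp add: affine_form_def u_def add_divide_distrib sum_divide_distrib)
  have u1: "\<bar>affine_form d (u i) y\<bar> \<le> 1" if y: "\<forall>j<d. y j \<in> {0..1}" for i y
  proof -
    have "\<bar>affine_form d (v i) y\<bar> \<le> \<bar>fst (v i)\<bar> + \<bar>\<Sum>j<d. snd (v i) j * y j\<bar>" unfolding affine_form_def by (rule abs_triangle_ineq)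
    also have "\<bar>\<Sum>j<d. snd (v i) j * y j\<bar> \<le> (\<Sum>j<d. \<bar>snd (v i) j\<bar> * 1)"
      by (rule order_trans[OF sum_abs sum_mono], unfold abs_mult, rule mult_left_mono) (use y in auto)
    finally have "\<bar>affine_form d (v i) y\<bar> \<le> s i" by (simp add: s_def)
    then show ?thesis unfolding aff_u using s[of i] by simp
  qed
  define C1 where "C1 = (\<Sum>i\<in>I. \<bar>c i * s i ^ p\<bar>)"
  define C2 where "C2 = real d * ((real m * \<Lambda>) ^ d * (1 + real m * \<Lambda>))"
  have C: "C1 \<ge> 0" "C2 \<ge> 0" using \<Lambda>(1) by (auto simp: C1_def C2_def sum_nonneg)
  have "\<exists>a. (\<Sum>i\<in>I. \<bar>a i\<bar>) \<le> (C1 + C2) * B \<and>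
        (\<forall>x\<in>Qcube d. \<forall>y. (\<forall>j<d. y j \<in> {0..1} \<and> y j = real N * (x j + 1 / 2) - real (\<kappa> j)) \<longrightarrow>
          \<bar>f x - (\<Sum>i\<in>I. a i * affine_form d (u i) y ^ p)\<bar> \<le> (C1 + C2) * B / real N ^ m)"
    if f: "pure_smooth d m B f" and B: "B \<ge> 0" and N: "N \<ge> 1" and \<kappa>: "\<forall>j<d. \<kappa> j < N" for B N f \<kappa>
  proof -
    define P where "P = cell_node N m \<kappa>"
    define w where "w q = at_nodes d P q (\<lambda>_. undefined)" for q
    have wQ: "w q \<in> Qcube d" if "q \<in> Q" for q
      using cell_node_in[OF N, of \<kappa> _ _ m] \<kappa> that unfolding w_def Qcube_def at_nodes_def Q_def P_def
      by (auto simp: PiE_iff extensional_def)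
    define a where "a i = f (w (fst i)) * (c i * s i ^ p)" for i
    have "(\<Sum>i\<in>I. \<bar>a i\<bar>) \<le> (\<Sum>i\<in>I. B * \<bar>c i * s i ^ p\<bar>)"
    proof (rule sum_mono)
      fix i assume "i \<in> I"
      then have "w (fst i) \<in> Qcube d" using wQ by (auto simp: I_def)
      then have "\<bar>f (w (fst i))\<bar> \<le> B" using f by (auto simp: pure_smooth_def)
      then show "\<bar>a i\<bar> \<le> B * \<bar>c i * s i ^ p\<bar>" unfolding a_def abs_mult[of "f _"] by (rule mult_right_mono) simp
    qed
    also have "\<dots> = C1 * B" by (simp add: C1_def sum_distrib_left mult.commute)
    also have "\<dots> \<le> (C1 + C2) * B" using C B by (intro mult_right_mono) auto
    finally have 1: "(\<Sum>i\<in>I. \<bar>a i\<bar>) \<le> (C1 + C2) * B" .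
    have 2: "\<bar>f x - (\<Sum>i\<in>I. a i * affine_form d (u i) y ^ p)\<bar> \<le> (C1 + C2) * B / real N ^ m"
      if x: "x \<in> Qcube d" and y: "\<forall>j<d. y j \<in> {0..1} \<and> y j = real N * (x j + 1 / 2) - real (\<kappa> j)" for x y
    proof -
      have wx: "at_nodes d P q x = w q" for q
        using x unfolding w_def at_nodes_def Qcube_def by (auto simp: PiE_iff extensional_def)
      have "(\<Sum>i\<in>I. a i * affine_form d (u i) y ^ p) = (\<Sum>i\<in>I. f (w (fst i)) * (c i * affine_form d (v i) y ^ p))"
      proof (rule sum.cong[OF refl])
        fix i assume "i \<in> I"
        have "s i ^ p * (affine_form d (v i) y / s i) ^ p = affine_form d (v i) y ^ p"
          using s[of i] by (simp add: power_divide)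
        then show "a i * affine_form d (u i) y ^ p = f (w (fst i)) * (c i * affine_form d (v i) y ^ p)"
          by (simp add: a_def aff_u mult.assoc)
      qed
      also have "\<dots> = (\<Sum>q\<in>Q. \<Sum>k<length (us q). f (w q) * (c (q, k) * affine_form d (v (q, k)) y ^ p))"
        unfolding I_def using Q by (subst sum.Sigma) (auto intro!: sum.cong)
      also have "\<dots> = (\<Sum>q\<in>Q. f (w q) * (\<Prod>j<d. poly (lagrange_poly (unit_node m) m (q j)) (y j)))"
      proof (rule sum.cong[OF refl])
        fix q assume q: "q \<in> Q"
        have "(\<Sum>(c, u)\<leftarrow>us q. c * affine_form d u y ^ p) = (\<Sum>k<length (us q). c (q, k) * affine_form d (v (q, k)) y ^ p)"
          by (simp add: sum_list_sum_nth lessThan_atLeast0 c_def v_def case_prod_beta)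
        moreover have "(\<Prod>j<d. poly (lagrange_poly (unit_node m) m (q j)) (y j)) = (\<Sum>(c, u)\<leftarrow>us q. c * affine_form d u y ^ p)"
          using fun_cong[OF bspec[OF us q], of y] .
        ultimately show "(\<Sum>k<length (us q). f (w q) * (c (q, k) * affine_form d (v (q, k)) y ^ p)) = f (w q) * (\<Prod>j<d. poly (lagrange_poly (unit_node m) m (q j)) (y j))"
          by (simp add: sum_distrib_left)
      qed
      finally have eq: "(\<Sum>i\<in>I. a i * affine_form d (u i) y ^ p) = (\<Sum>q\<in>Q. f (at_nodes d P q x) * (\<Prod>j<d. poly (lagrange_poly (unit_node m) m (q j)) (y j)))"
        by (simp add: wx)
      have "\<bar>f x - (\<Sum>i\<in>I. a i * affine_form d (u i) y ^ p)\<bar> \<le> real d * ((real m * \<Lambda>) ^ d * ((1 + real m * \<Lambda>) * (B * (1 / real N) ^ m)))"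
        unfolding eq P_def Q_def
        by (rule tensor_interpolation_error[OF m f B N _ \<Lambda> x]) (use \<kappa> y in auto)
      also have "\<dots> = C2 * B / real N ^ m" by (simp add: C2_def power_divide)
      also have "\<dots> \<le> (C1 + C2) * B / real N ^ m" using C B by (intro divide_right_mono mult_right_mono) auto
      finally show ?thesis .
    qed
    show ?thesis using 1 2 by blast
  qed
  note main = this
  show ?thesis
  proof (rule exI[of _ I], rule exI[of _ u], rule exI[of _ "C1 + C2"], intro conjI ballI allI impI)
    show "\<bar>affine_form d (u i) y\<bar> \<le> 1" if "\<forall>j<d. y j \<in> {0..1}" for i y using u1[OF that] .
  qed (use I C main in auto)
qed

section \<open>Pure derivatives on the cube and thin sets\<close>

lemma C_open_continuous: "C_open i m U f \<Longrightarrow> continuous_on U f"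
  by (cases m) auto

lemma C_open_pd: "C_open i m U f \<Longrightarrow> j < i \<Longrightarrow> k \<le> m \<Longrightarrow> C_open i (m - k) U ((pd j ^^ k) f)"
proof (induction k)
  case (Suc k)
  then have "C_open i (Suc (m - Suc k)) U ((pd j ^^ k) f)" by (simp add: Suc_diff_Suc)
  then show ?case using Suc.prems by simp
qed simp

lemma C_open_has_derivative:
  assumes "C_open i m U f" "j < i" "k < m" "x \<in> U"
  shows "((\<lambda>t. (pd j ^^ k) f (x(j := t))) has_real_derivative (pd j ^^ Suc k) f x) (at (x j))"
proof -
  have "C_open i (Suc (m - Suc k)) U ((pd j ^^ k) f)" using C_open_pd[OF assms(1,2), of k] assms(3) by (simp add: Suc_diff_Suc)
  then have "(\<lambda>t. (pd j ^^ k) f (x(j := t))) differentiable (at (x j))" using assms by simp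
  then show ?thesis by (simp add: DERIV_deriv_iff_real_differentiable[symmetric] pd_def)
qed

lemma finite_multi_indices: "finite (multi_indices i m)"
proof (rule finite_subset)
  show "multi_indices i m \<subseteq> PiE {..<i} (\<lambda>_. {..m})"
  proof
    fix \<alpha> assume a: "\<alpha> \<in> multi_indices i m"
    have "\<alpha> j \<le> m" if "j < i" for j
      using member_le_sum[of j "{..<i}" \<alpha>] a that by (auto simp: multi_indices_def)
    then show "\<alpha> \<in> PiE {..<i} (\<lambda>_. {..m})" using a by (auto simp: multi_indices_def PiE_iff)
  qed
qed (simp add: finite_PiE)

lemma multi_pd_zero: "(\<And>i. i \<in> set xs \<Longrightarrow> \<alpha> i = 0) \<Longrightarrow> foldr (\<lambda>i. pd i ^^ \<alpha> i) xs f = f"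
  by (induction xs) auto

lemma multi_pd_pure:
  assumes "j < d"
  shows "multi_pd d (\<lambda>i\<in>{..<d}. if i = j then k else 0) f = (pd j ^^ k) f"
proof -
  let ?\<alpha> = "\<lambda>i\<in>{..<d}. if i = j then k else (0::nat)"
  have split: "[0..<d] = [0..<j] @ j # [Suc j..<d]"
    using upt_add_eq_append[of 0 j "d - j"] upt_conv_Cons[of j d] assms by simp
  have "foldr (\<lambda>i. pd i ^^ ?\<alpha> i) [Suc j..<d] f = f" by (rule multi_pd_zero) auto
  moreover have "foldr (\<lambda>i. pd i ^^ ?\<alpha> i) [0..<j] g = g" for g by (rule multi_pd_zero) (use assms in auto)
  ultimately show ?thesis unfolding multi_pd_def split using assms by simp
qed

lemma Wnorm_pure:
  assumes "Wnorm d m f \<le> ereal B" "k \<le> m" "k = 0 \<or> j < d"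
  shows "Linf_norm d ((pd j ^^ k) f) \<le> ereal B"
proof -
  let ?\<alpha> = "\<lambda>i\<in>{..<d}. if i = j then k else (0::nat)"
  have "?\<alpha> \<in> multi_indices d m" using assms(2) by (auto simp: multi_indices_def)
  then have "Linf_norm d (multi_pd d ?\<alpha> f) \<le> Wnorm d m f"
    unfolding Wnorm_def using finite_multi_indices by (intro Max_ge) auto
  moreover have "multi_pd d ?\<alpha> f = (pd j ^^ k) f"
  proof (cases "j < d")
    case False
    then show ?thesis using assms(3) multi_pd_zero[of "[0..<d]" ?\<alpha> f] by (auto simp: multi_pd_def)
  qed (rule multi_pd_pure)
  ultimately show ?thesis using assms(1) by simp
qed

interpretation lebp: product_sigma_finite "\<lambda>_::nat. lborel :: real measure"
  by standard

lemma space_leb: "space (leb n) = RR n"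
  by (simp add: leb_def space_PiM RR_def)

lemma Qcube_sets [measurable]: "Qcube n \<in> sets (leb n)"
  unfolding Qcube_def leb_def by (rule sets_PiM_I_finite) auto

lemma Qcube_subset_RR: "Qcube n \<subseteq> RR n"
  by (auto simp: Qcube_def RR_def)

text \<open>
  If the bound failed at one point, it would fail by continuity on a box around the point, and a box has
  positive measure. For \<open>d = 0\<close> the box is the whole space and has the measure 1 of the empty product.
\<close>
lemma bounded_on_cube_from_Linf:
  assumes "continuous_on (Qcube d) g" "Linf_norm d g \<le> ereal B" "x \<in> Qcube d"
  shows "\<bar>g x\<bar> \<le> B"
proof (rule ccontr)
  assume "\<not> \<bar>g x\<bar> \<le> B"
  then have gx: "\<bar>g x\<bar> > B" by simp
  have "AE w in restrict_space (leb d) (Qcube d). ereal \<bar>g w\<bar> \<le> ereal B"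
    using esssup_AE[of "\<lambda>w. ereal \<bar>g w\<bar>" "restrict_space (leb d) (Qcube d)"]
    by eventually_elim (rule order_trans[OF _ assms(2)[unfolded Linf_norm_def]])
  then have ae: "AE w in leb d. w \<in> Qcube d \<longrightarrow> \<bar>g w\<bar> \<le> B"
    by (subst (asm) AE_restrict_space_iff) (use Qcube_sets Qcube_subset_RR space_leb in \<open>auto simp: Int_absorb2\<close>)
  have "openin (top_of_set (Qcube d)) (Qcube d \<inter> (\<lambda>w. \<bar>g w\<bar>) -` {B<..})"
    by (rule continuous_openin_preimage_gen) (use assms(1) in \<open>auto intro: continuous_intros\<close>)
  then obtain T where T: "open T" "Qcube d \<inter> (\<lambda>w. \<bar>g w\<bar>) -` {B<..} = Qcube d \<inter> T"
    unfolding openin_open by blast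
  have "x \<in> T" using T(2) gx assms(3) by blast
  then obtain X where X: "x \<in> PiE UNIV X" "\<And>i. openin euclidean (X i)" "PiE UNIV X \<subseteq> T"
    using product_topology_open_contains_basis[of "\<lambda>_. euclidean" UNIV T x] T(1) unfolding open_fun_def by blast
  have "\<exists>a b. a < b \<and> {a..b} \<subseteq> X i \<inter> {-1/2..1/2}" if "i < d" for i
  proof -
    have xi: "x i \<in> X i" "x i \<in> {-1/2..1/2}" using X(1) assms(3) that by (auto simp: Qcube_def PiE_iff)
    have "open (X i)" using X(2)[of i] by (simp only: open_openin)
    then obtain e where e: "e > 0" "cball (x i) e \<subseteq> X i" using xi(1) open_contains_cball by blast
    define a where "a = max (-1/2) (x i - e)"
    define b where "b = min (1/2) (x i + e)"
    have "a < b" using e(1) xi(2) unfolding a_def b_def atLeastAtMost_iff by linarith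
    moreover have "{a..b} \<subseteq> cball (x i) e" by (auto simp: a_def b_def cball_def dist_real_def)
    moreover have "- 1 / 2 \<le> a" "b \<le> 1 / 2" unfolding a_def b_def by linarith+
    then have "{a..b} \<subseteq> {-1/2..1/2}" by (simp only: atLeastatMost_subset_iff) simp
    ultimately show ?thesis using e(2) by blast
  qed
  then obtain a b where ab: "\<And>i. i < d \<Longrightarrow> a i < b i" "\<And>i. i < d \<Longrightarrow> {a i..b i} \<subseteq> X i \<inter> {-1/2..1/2}" by metis
  define J where "J = PiE {..<d} (\<lambda>i. {a i..b i})"
  have J: "J \<in> sets (leb d)" unfolding J_def leb_def by (rule sets_PiM_I_finite) auto
  have JB: "w \<in> Qcube d \<and> \<bar>g w\<bar> > B" if w: "w \<in> J" for w
  proof -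
    have wQ: "w \<in> Qcube d" using w ab(2) unfolding J_def Qcube_def PiE_iff by fastforce
    have "w i \<in> X i" for i
    proof (cases "i < d")
      case True then show ?thesis using w ab(2)[OF True] unfolding J_def PiE_iff by fastforce
    next
      case False
      then have "w i = x i" using wQ assms(3) by (auto simp: Qcube_def PiE_iff extensional_def)
      then show ?thesis using X(1) by auto
    qed
    then have "w \<in> T" using X(3) by (auto simp: PiE_iff)
    then show ?thesis using T(2) wQ by blast
  qed
  have "AE w in leb d. w \<notin> J" using ae
  proof (rule eventually_mono)
    show "w \<notin> J" if "w \<in> Qcube d \<longrightarrow> \<bar>g w\<bar> \<le> B" for w using JB[of w] that by linarith
  qed
  then have "emeasure (leb d) J = 0" using J AE_iff_null_sets[OF J] by blast
  moreover have "emeasure (leb d) J = (\<Prod>i<d. emeasure lborel {a i..b i})"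
    unfolding J_def leb_def by (rule lebp.emeasure_PiM) auto
  moreover have "emeasure lborel {a i..b i} \<noteq> 0" if "i < d" for i using ab(1)[OF that] by simp
  ultimately show False by simp
qed

lemma pure_smooth_from_Wnorm:
  assumes "Qcube d \<subseteq> U" "C_open d m U f" "Wnorm d m f \<le> ereal B"
  shows "pure_smooth d m B f"
proof -
  have cont: "continuous_on (Qcube d) ((pd j ^^ k) f)" if "k \<le> m" "k = 0 \<or> j < d" for j k
  proof (cases "k = 0")
    case True then show ?thesis using C_open_continuous[OF assms(2)] continuous_on_subset[OF _ assms(1)] by simp
  next
    case False
    then have "j < d" using that by simp
    from C_open_pd[OF assms(2) this that(1)] show ?thesis
      using C_open_continuous continuous_on_subset[OF _ assms(1)] by blast
  qed
  have bd: "\<bar>(pd j ^^ k) f w\<bar> \<le> B" if "k \<le> m" "k = 0 \<or> j < d" "w \<in> Qcube d" for j k w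
    by (rule bounded_on_cube_from_Linf[OF cont[OF that(1,2)] Wnorm_pure[OF assms(3) that(1,2)] that(3)])
  show ?thesis unfolding pure_smooth_def
  proof (intro ballI conjI allI impI)
    fix w assume w: "w \<in> Qcube d"
    show "\<bar>f w\<bar> \<le> B" using bd[of 0 0 w] w by simp
    fix j assume j: "j < d"
    show "\<bar>(pd j ^^ m) f w\<bar> \<le> B" using bd[of m j w] w j by simp
    fix k assume "k < m"
    then show "((\<lambda>t. (pd j ^^ k) f (w(j := t))) has_real_derivative (pd j ^^ Suc k) f w) (at (w j))"
      using C_open_has_derivative[OF assms(2) j] w assms(1) by blast
  qed
qed

lemma emeasure_Qcube: "emeasure (leb n) (Qcube n) = 1"
  unfolding Qcube_def leb_def by (subst lebp.emeasure_PiM) auto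

text \<open>
  Integrating over the \<open>i\<close>-th coordinate first, every line in the direction of this axis meets the set
  in an interval of length at most \<open>b - a\<close>.
\<close>
lemma emeasure_slab:
  assumes i: "i < n" and h [measurable]: "h \<in> borel_measurable (leb n)"
    and indep: "\<And>x y. h (x(i := y)) = h x" and ab: "a \<le> b"
  shows "{x \<in> Qcube n. h x + a \<le> x i \<and> x i \<le> h x + b} \<in> sets (leb n)"
    and "emeasure (leb n) {x \<in> Qcube n. h x + a \<le> x i \<and> x i \<le> h x + b} \<le> ennreal (b - a)"
proof -
  let ?S = "{x \<in> Qcube n. h x + a \<le> x i \<and> x i \<le> h x + b}"
  have xi [measurable]: "(\<lambda>x. x i) \<in> borel_measurable (leb n)"
    using measurable_component_singleton[of i "{..<n}" "\<lambda>_. lborel :: real measure"] i by (simp add: leb_def)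
  have "?S = Qcube n \<inter> {x \<in> space (leb n). h x + a \<le> x i \<and> x i \<le> h x + b}"
    using Qcube_subset_RR by (auto simp: space_leb)
  moreover have "{x \<in> space (leb n). h x + a \<le> x i} \<in> sets (leb n)"
    by (rule borel_measurable_le) (use xi h in auto)
  moreover have "{x \<in> space (leb n). x i \<le> h x + b} \<in> sets (leb n)"
    by (rule borel_measurable_le) (use xi h in auto)
  moreover have "Qcube n \<inter> {x \<in> space (leb n). h x + a \<le> x i \<and> x i \<le> h x + b} =
    Qcube n \<inter> ({x \<in> space (leb n). h x + a \<le> x i} \<inter> {x \<in> space (leb n). x i \<le> h x + b})" by blast
  ultimately show S: "?S \<in> sets (leb n)" using Qcube_sets[of n] by (simp only:) (intro sets.Int)
  define I where "I = {..<n} - {i}"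
  have I: "finite I" "i \<notin> I" "{..<n} = insert i I" using i by (auto simp: I_def)
  have leb: "leb n = PiM (insert i I) (\<lambda>_. lborel)" by (simp add: leb_def I(3))
  let ?Q = "PiE I (\<lambda>_. {-1/2..1/2::real})"
  define T where "T = ?S"
  have T: "T \<in> sets (PiM (insert i I) (\<lambda>_. lborel))" using S unfolding T_def leb .
  have ptw: "(\<integral>\<^sup>+y. indicator T (x(i := y)) \<partial>lborel) \<le> ennreal (b - a) * indicator ?Q x"
    if x: "x \<in> space (PiM I (\<lambda>_. lborel :: real measure))" for x
  proof -
    have "indicator T (x(i := y)) \<le> indicator ?Q x * (indicator {h x + a..h x + b} y :: ennreal)" for y
    proof (cases "x(i := y) \<in> T")
      case True
      then have xQ: "x(i := y) \<in> Qcube n" and y: "y \<in> {h x + a..h x + b}" by (auto simp: T_def indep)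
      have "x j \<in> {-1/2..1/2}" if "j \<in> I" for j
        using PiE_mem[OF xQ[unfolded Qcube_def], of j] that by (auto simp: I_def)
      moreover have "x \<in> extensional I" using x by (auto simp: space_PiM PiE_iff)
      ultimately have "x \<in> ?Q" unfolding PiE_iff by blast
      then show ?thesis using y True by simp
    qed simp
    then have "(\<integral>\<^sup>+y. indicator T (x(i := y)) \<partial>lborel) \<le> (\<integral>\<^sup>+y. indicator ?Q x * indicator {h x + a..h x + b} y \<partial>lborel)"
      by (rule nn_integral_mono)
    moreover have "(\<integral>\<^sup>+y. indicator ?Q x * indicator {h x + a..h x + b} y \<partial>lborel) = indicator ?Q x * ennreal (b - a)"
      using ab by (simp add: nn_integral_cmult)
    ultimately show ?thesis by (simp add: mult.commute)
  qed
  have "emeasure (PiM (insert i I) (\<lambda>_. lborel)) T = integral\<^sup>N (PiM (insert i I) (\<lambda>_. lborel)) (indicator T)"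
    using nn_integral_indicator[OF T] by simp
  moreover have "integral\<^sup>N (PiM (insert i I) (\<lambda>_. lborel)) (indicator T) =
     (\<integral>\<^sup>+x. (\<integral>\<^sup>+y. indicator T (x(i := y)) \<partial>lborel) \<partial>PiM I (\<lambda>_. lborel))"
    by (rule lebp.product_nn_integral_insert[OF I(1,2) borel_measurable_indicator[OF T]])
  moreover have "\<dots> \<le> (\<integral>\<^sup>+x. ennreal (b - a) * indicator ?Q x \<partial>PiM I (\<lambda>_. lborel))"
    by (rule nn_integral_mono) (rule ptw)
  moreover have "\<dots> = ennreal (b - a) * emeasure (PiM I (\<lambda>_. lborel)) ?Q"
    by (rule nn_integral_cmult_indicator) (rule sets_PiM_I_finite, use I in auto)
  moreover have "emeasure (PiM I (\<lambda>_. lborel)) ?Q = 1"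
    using I by (subst lebp.emeasure_PiM) auto
  ultimately show "emeasure (leb n) ?S \<le> ennreal (b - a)" unfolding leb T_def[symmetric] by simp
qed

text \<open>
  After restriction of the argument, \<open>F\<close> is continuous on the space of all sequences, whose Borel sets
  form the product \<open>\<sigma>\<close>-algebra.
\<close>
lemma measurable_restrict_continuous:
  assumes "continuous_on (RR d) F" "d \<le> n"
  shows "(\<lambda>x. F (restrict x {..<d})) \<in> borel_measurable (leb n)"
proof -
  define r where "r x = restrict x {..<d}" for x :: "nat \<Rightarrow> real"
  have "continuous_on UNIV r"
  proof (rule continuous_on_coordinatewise_then_product)
    fix i show "continuous_on UNIV (\<lambda>x. r x i)"
      by (cases "i < d") (auto simp: r_def intro: continuous_on_product_coordinates)
  qed
  moreover have "r ` UNIV \<subseteq> RR d"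
    by (rule image_subsetI) (simp add: r_def RR_def PiE_iff)
  ultimately have "continuous_on UNIV (\<lambda>x. F (r x))" using continuous_on_compose2[OF assms(1)] by blast
  then have "(\<lambda>x. F (r x)) \<in> borel_measurable borel" by (rule borel_measurable_continuous_onI)
  then have F: "(\<lambda>x. F (r x)) \<in> borel_measurable (PiM UNIV (\<lambda>_::nat. borel :: real measure))"
    using measurable_cong_sets[OF sets_PiM_equal_borel refl] by blast
  have "r \<in> measurable (leb n) (PiM UNIV (\<lambda>_::nat. borel :: real measure))"
  proof (rule measurable_PiM_single')
    fix i :: nat
    show "(\<lambda>x. r x i) \<in> borel_measurable (leb n)"
      by (cases "i < d") (use assms(2) in \<open>auto simp: r_def leb_def\<close>)
  qed auto
  from measurable_compose[OF this F] show ?thesis by (simp add: r_def)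
qed

section \<open>Step functions on a grid\<close>

text \<open>
  The places where the steep ramps that replace the step functions at the grid points are still rising.
\<close>
definition grid_slabs :: "nat \<Rightarrow> nat \<Rightarrow> real \<Rightarrow> (nat \<Rightarrow> real) set" where
  "grid_slabs d N \<eta> = {x. \<exists>j<d. \<exists>k\<le>N. real k / real N \<le> x j + 1 / 2 \<and> x j + 1 / 2 \<le> real k / real N + \<eta>}"

definition cell_of :: "nat \<Rightarrow> (nat \<Rightarrow> real) \<Rightarrow> nat \<Rightarrow> nat" where
  "cell_of N x j = nat \<lfloor>real N * (x j + 1 / 2)\<rfloor>"

lemma Qcube_coord: "x \<in> Qcube n \<Longrightarrow> j < n \<Longrightarrow> - 1 / 2 \<le> x j \<and> x j \<le> 1 / 2"
  unfolding Qcube_def by (drule PiE_mem[of _ _ _ j]) auto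

text \<open>
  Off the slabs the input has passed the walls on the left of its cell by more than \<open>\<eta>\<close>, so that every
  ramp has reached its final value.
\<close>
lemma cell_of_bounds:
  assumes "N \<ge> 1" "j < d" "x \<in> Qcube n" "d \<le> n" "x \<notin> grid_slabs d N \<eta>" "\<eta> > 0"
  shows "cell_of N x j < N"
    "real (cell_of N x j) \<le> real N * (x j + 1 / 2)" "real N * (x j + 1 / 2) < real (cell_of N x j) + 1"
    "\<And>k. k \<le> N \<Longrightarrow> k \<le> cell_of N x j \<Longrightarrow> real k / real N + \<eta> < x j + 1 / 2"
    "\<And>k. k \<le> N \<Longrightarrow> cell_of N x j < k \<Longrightarrow> x j + 1 / 2 < real k / real N"
proof -
  have xj: "0 \<le> x j + 1 / 2" "x j + 1 / 2 \<le> 1" using Qcube_coord[of x n j] assms(2-4) by auto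
  have N: "real N > 0" using assms(1) by simp
  have bad: "\<not> (real k / real N \<le> x j + 1 / 2 \<and> x j + 1 / 2 \<le> real k / real N + \<eta>)" if "k \<le> N" for k
    using assms(5) that assms(2) unfolding grid_slabs_def by blast
  have nn: "0 \<le> real N * (x j + 1 / 2)" using xj by simp
  show 1: "real (cell_of N x j) \<le> real N * (x j + 1 / 2)" "real N * (x j + 1 / 2) < real (cell_of N x j) + 1"
    using nn by (auto simp: cell_of_def)
  show gt: "real k / real N + \<eta> < x j + 1 / 2" if "k \<le> N" "k \<le> cell_of N x j" for k
  proof -
    have "real k \<le> real N * (x j + 1 / 2)" using that 1 by linarith
    then have "real k / real N \<le> x j + 1 / 2" using N by (simp add: pos_divide_le_eq mult.commute)
    then show ?thesis using bad[OF that(1)] by linarith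
  qed
  show lt: "x j + 1 / 2 < real k / real N" if "k \<le> N" "cell_of N x j < k" for k
  proof -
    have "real N * (x j + 1 / 2) < real k" using that 1 by linarith
    then show ?thesis using N by (simp add: pos_less_divide_eq mult.commute)
  qed
  show "cell_of N x j < N"
  proof (rule ccontr)
    assume "\<not> cell_of N x j < N"
    then have "real N / real N + \<eta> < x j + 1 / 2" using gt[of N] by simp
    then show False using xj N assms(6) by simp
  qed
qed

lemma hidden_inputs: "hidden_layer n W 0 0 ((\<lambda>j x. x j) ` {..<n})"
  by simp

definition ramp :: "real \<Rightarrow> real" where
  "ramp t = max 0 (max 0 t - max 0 (t - 1))"

lemma ramp_le_0: "t \<le> 0 \<Longrightarrow> ramp t = 0" and ramp_ge_1: "1 \<le> t \<Longrightarrow> ramp t = 1"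
  by (auto simp: ramp_def)

lemma neuron_ramp:
  assumes "(\<lambda>x. max 0 (g x)) \<in> F" "(\<lambda>x. max 0 (g x - 1)) \<in> F" "1 \<le> W"
  shows "neuron W F (\<lambda>x. ramp (g x)) 3"
proof -
  have "neuron W F (\<lambda>x. max 0 (0 + (1 * max 0 (g x) + (- 1) * max 0 (g x - 1)))) 3"
    by (rule neuronI[OF _ wire_sum_add[OF wire_sum_wire[OF assms(1)] wire_sum_wire[OF assms(2)]]]) (use assms(3) in auto)
  then show ?thesis by (simp add: ramp_def)
qed

text \<open>
  Each step function at a grid point is a ramp of slope \<open>1 / \<eta>\<close>. The coordinates are shifted by \<open>1 / 2\<close>,
  so that they are nonnegative on the cube and can be carried along.
\<close>
lemma hidden_steps:
  assumes "d \<le> n" "N \<ge> 1" "0 < \<eta>" "\<eta> \<le> 1" "W \<ge> 2 / \<eta>"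
  shows "hidden_layer n W 2 (d * (4 + 7 * Suc N))
     ((\<lambda>j x. max 0 (x j + 1 / 2)) ` {..<d} \<union>
      (\<lambda>(j, k) x. ramp ((x j + 1 / 2 - real k / real N) / \<eta>)) ` ({..<d} \<times> {..N}))"
proof -
  have "2 \<le> 2 / \<eta>" using assms by (simp add: field_simps)
  then have W: "W \<ge> 1" "W \<ge> 2" using assms(5) by linarith+
  define u where "u j x = max 0 (x j + 1 / 2)" for j and x :: "nat \<Rightarrow> real"
  define g where "g p x = (x (fst p) + 1 / 2 - real (snd p) / real N) / \<eta>" for p and x :: "nat \<Rightarrow> real"
  let ?X = "(\<lambda>j x. x j) ` {..<n} :: ((nat \<Rightarrow> real) \<Rightarrow> real) set"
  let ?D = "{..<d} \<times> {..N}"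
  have "hidden_layer n W (Suc 0) (0 + (\<Sum>j<d. 2)) (u ` {..<d})"
  proof (rule hidden_next_layer[OF hidden_inputs])
    fix j assume "j \<in> {..<d}"
    then have j: "(\<lambda>x. x j) \<in> ?X" using assms(1) by auto
    have "neuron W ?X (\<lambda>x. max 0 (1 / 2 + 1 * x j)) 2"
      by (rule neuronI[OF _ wire_sum_wire[OF j]]) (use W in auto)
    then show "neuron W ?X (u j) 2" by (simp add: u_def[abs_def] add.commute)
  qed simp
  then have u1: "hidden_layer n W (Suc 0) (2 * d) (u ` {..<d})" by (simp add: mult.commute)
  have g: "neuron W ?X (\<lambda>x. max 0 (g p x - e)) 2" if p: "p \<in> ?D" and e: "e \<in> {0, 1}" for p e
  proof -
    obtain j k where jk: "p = (j, k)" "j < d" "k \<le> N" using p by (cases p) auto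
    then have j: "(\<lambda>x. x j) \<in> ?X" using assms(1) by auto
    have kN: "0 \<le> real k / real N" "real k / real N \<le> 1" using jk(3) assms(2) by (auto simp: divide_le_eq)
    have "\<bar>(1 / 2 - real k / real N) / \<eta>\<bar> \<le> (1 / 2) / \<eta>"
      unfolding abs_divide abs_of_pos[OF assms(3)]
    proof (rule divide_right_mono)
      show "\<bar>1 / 2 - real k / real N\<bar> \<le> 1 / 2" using kN by linarith
    qed (use assms(3) in simp)
    moreover have "(1 / 2) / \<eta> + 1 \<le> 2 / \<eta>" using assms(3,4) by (simp add: field_simps)
    moreover have "0 \<le> e" "e \<le> 1" using e by auto
    moreover have "\<bar>A - e\<bar> \<le> W" if "\<bar>A\<bar> \<le> c" "c + 1 \<le> c'" "0 \<le> e" "e \<le> 1" "c' \<le> W" for A c c'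
      using that by linarith
    ultimately have b: "\<bar>(1 / 2 - real k / real N) / \<eta> - e\<bar> \<le> W" using assms(5) by blast
    have "1 / \<eta> \<le> 2 / \<eta>" using assms(3) by (simp add: field_simps)
    then have w: "\<bar>1 / \<eta>\<bar> \<le> W" using assms(3,5) by simp
    have "neuron W ?X (\<lambda>x. max 0 ((1 / 2 - real k / real N) / \<eta> - e + (1 / \<eta>) * x j)) 2"
      by (rule neuronI[OF b wire_sum_wire[OF j w]]) auto
    moreover have "(1 / 2 - real k / real N) / \<eta> - e + (1 / \<eta>) * x j = g p x - e" for x
      by (simp add: g_def jk(1) add_divide_distrib diff_divide_distrib)
    ultimately show ?thesis by (simp only:)
  qed
  have "hidden_layer n W (Suc 0) (0 + (\<Sum>i\<in>?D \<times> {0, 1 :: real}. 2)) ((\<lambda>i x. max 0 (g (fst i) x - snd i)) ` (?D \<times> {0, 1}))"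
  proof (rule hidden_next_layer[OF hidden_inputs])
    fix i :: "(nat \<times> nat) \<times> real" assume "i \<in> ?D \<times> {0, 1}"
    then show "neuron W ?X (\<lambda>x. max 0 (g (fst i) x - snd i)) 2" by (intro g) auto
  qed simp
  moreover have "(\<Sum>i\<in>?D \<times> {0, 1 :: real}. 2 :: nat) = d * (4 * Suc N)" by (simp add: card_cartesian_product algebra_simps)
  ultimately have r1: "hidden_layer n W (Suc 0) (d * (4 * Suc N)) ((\<lambda>i x. max 0 (g (fst i) x - snd i)) ` (?D \<times> {0, 1}))" by simp
  have "hidden_layer n W (Suc (Suc 0)) (d * (4 * Suc N) + (\<Sum>p\<in>?D. 3)) ((\<lambda>p x. ramp (g p x)) ` ?D)"
  proof (rule hidden_next_layer[OF r1])
    fix p assume p: "p \<in> ?D"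
    show "neuron W ((\<lambda>i x. max 0 (g (fst i) x - snd i)) ` (?D \<times> {0, 1})) (\<lambda>x. ramp (g p x)) 3"
    proof (rule neuron_ramp)
      show "(\<lambda>x. max 0 (g p x)) \<in> (\<lambda>i x. max 0 (g (fst i) x - snd i)) ` (?D \<times> {0, 1})"
        by (rule image_eqI[of _ _ "(p, 0)"]) (use p in auto)
      show "(\<lambda>x. max 0 (g p x - 1)) \<in> (\<lambda>i x. max 0 (g (fst i) x - snd i)) ` (?D \<times> {0, 1})"
        by (rule image_eqI[of _ _ "(p, 1)"]) (use p in auto)
    qed (rule W)
  qed simp
  moreover have "d * (4 * Suc N) + (\<Sum>p\<in>?D. 3) = d * (7 * Suc N)" by (simp add: card_cartesian_product algebra_simps)
  ultimately have r2: "hidden_layer n W (Suc (Suc 0)) (d * (7 * Suc N)) ((\<lambda>p x. ramp (g p x)) ` ?D)" by simp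
  have "card (u ` {..<d}) \<le> d" using card_image_le[of "{..<d}" u] by simp
  from hidden_carry[OF u1 W(1) this, of 1]
  have u2: "hidden_layer n W (Suc (Suc 0)) (4 * d) (u ` {..<d})" by simp
  have "(\<lambda>p x. ramp (g p x)) ` ?D = (\<lambda>(j, k) x. ramp ((x j + 1 / 2 - real k / real N) / \<eta>)) ` ?D"
    by (rule image_cong) (auto simp: g_def)
  moreover have "4 * d + d * (7 * Suc N) = d * (4 + 7 * Suc N)" by (simp add: algebra_simps)
  ultimately show ?thesis using hidden_Un[OF u2 r2] unfolding u_def numeral_2_eq_2 by simp
qed

text \<open>
  The absolute value is good enough since the form is raised to an even power afterwards, and it is
  nonnegative, as the input of the squaring circuit has to be.
\<close>
lemma hidden_abs_aff:
  assumes "hidden_layer n W L S (y ` {..<d})" "1 \<le> W" "\<bar>fst u\<bar> \<le> W" "\<And>j. j < d \<Longrightarrow> \<bar>snd u j\<bar> \<le> W"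
  shows "hidden_layer n W (L + 2) (S + (2 * d + 5)) {\<lambda>x. \<bar>affine_form d u (\<lambda>j. y j x)\<bar>}"
proof -
  define g where "g e x = max 0 (e * fst u + (\<Sum>j<d. (e * snd u j) * y j x))" for e x
  have "hidden_layer n W (Suc L) (S + (\<Sum>e\<in>{1, - 1 :: real}. Suc d)) (g ` {1, - 1})"
  proof (rule hidden_next_layer[OF assms(1)])
    fix e :: real assume e: "e \<in> {1, - 1}"
    then have "wire_sum W (y ` {..<d}) (\<lambda>x. \<Sum>j<d. (e * snd u j) * y j x) (card {..<d})"
      by (intro wire_sum_wires) (use assms(4) in auto)
    then show "neuron W (y ` {..<d}) (g e) (Suc d)" unfolding g_def
      by (rule neuronI[rotated]) (use e assms(3) in auto)
  qed simp
  then have g: "hidden_layer n W (Suc L) (S + 2 * Suc d) {g 1, g (- 1)}" by (simp add: mult_2)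
  have "neuron W {g 1, g (- 1)} (\<lambda>x. max 0 (0 + (1 * g 1 x + 1 * g (- 1) x))) 3"
    by (rule neuronI[OF _ wire_sum_add[OF wire_sum_wire wire_sum_wire]]) (use assms(2) in auto)
  from hidden_next_neuron[OF g this]
  have "hidden_layer n W (Suc (Suc L)) (S + 2 * Suc d + 3) {\<lambda>x. max 0 (0 + (1 * g 1 x + 1 * g (- 1) x))}" .
  moreover have "max 0 (0 + (1 * g 1 x + 1 * g (- 1) x)) = \<bar>affine_form d u (\<lambda>j. y j x)\<bar>" for x
    by (simp add: g_def affine_form_def sum_negf max_def abs_if)
  ultimately show ?thesis by (simp add: add.commute add.left_commute)
qed

section \<open>Local coordinates and selection of a cell\<close>

text \<open>
  The index of the cell in direction \<open>j\<close> is the number of the grid points \<open>1 / N, ..., N / N\<close> that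
  the shifted coordinate has passed.
\<close>
lemma hidden_local_coordinates:
  assumes "d \<le> n" "N \<ge> 1" "0 < \<eta>" "\<eta> \<le> 1" "W \<ge> 2 / \<eta>" "W \<ge> real N"
  shows "\<exists>y :: nat \<Rightarrow> (nat \<Rightarrow> real) \<Rightarrow> real. hidden_layer n W 3 (d * (4 + 7 * Suc N) + d * (N + 2)) (y ` {..<d}) \<and>
    (\<forall>x\<in>Qcube n. x \<notin> grid_slabs d N \<eta> \<longrightarrow>
      (\<forall>j<d. y j x = real N * (x j + 1 / 2) - real (cell_of N x j)))"
proof -
  have "2 \<le> 2 / \<eta>" using assms by (simp add: field_simps)
  then have W: "W \<ge> 1" using assms(5) by linarith
  define u where "u j x = max 0 (x j + 1 / 2)" for j and x :: "nat \<Rightarrow> real"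
  define s where "s j k x = ramp ((x j + 1 / 2 - real k / real N) / \<eta>)" for j k and x :: "nat \<Rightarrow> real"
  define F where "F = u ` {..<d} \<union> (\<lambda>(j, k). s j k) ` ({..<d} \<times> {..N})"
  have F: "hidden_layer n W 2 (d * (4 + 7 * Suc N)) F"
    using hidden_steps[OF assms(1-5)] by (simp add: F_def u_def[abs_def] s_def[abs_def])
  define y where "y j x = max 0 (0 + (real N * u j x + (\<Sum>k\<in>{1..N}. (- 1) * s j k x)))" for j x
  have "hidden_layer n W (Suc 2) (d * (4 + 7 * Suc N) + (\<Sum>j<d. N + 2)) (y ` {..<d})"
  proof (rule hidden_next_layer[OF F])
    fix j assume j: "j \<in> {..<d}"
    have uF: "u j \<in> F" using j by (auto simp: F_def)
    have sF: "s j k \<in> F" if "k \<in> {1..N}" for k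
      unfolding F_def by (rule UnI2, rule image_eqI[of _ _ "(j, k)"]) (use that j in auto)
    have "wire_sum W F (\<lambda>x. \<Sum>k\<in>{1..N}. (- 1) * s j k x) (card {1..N})"
      by (rule wire_sum_wires) (use sF W in auto)
    then show "neuron W F (y j) (N + 2)" unfolding y_def
      by (intro neuronI[OF _ wire_sum_add[OF wire_sum_wire[OF uF]]]) (use W assms(6) in auto)
  qed simp
  then have hidden_layer: "hidden_layer n W 3 (d * (4 + 7 * Suc N) + d * (N + 2)) (y ` {..<d})" by (simp add: numeral_3_eq_3)
  have "y j x = real N * (x j + 1 / 2) - real (cell_of N x j)"
    if x: "x \<in> Qcube n" "x \<notin> grid_slabs d N \<eta>" and j: "j < d" for x j
  proof -
    note cb = cell_of_bounds[OF assms(2) j x(1) assms(1) x(2) assms(3)]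
    have "u j x = x j + 1 / 2" using Qcube_coord[OF x(1), of j] j assms(1) by (simp add: u_def)
    moreover have "s j k x = (if k \<le> cell_of N x j then 1 else 0)" if "k \<in> {1..N}" for k
    proof (cases "k \<le> cell_of N x j")
      case True
      then have "\<eta> \<le> x j + 1 / 2 - real k / real N" using cb(4)[of k] that by simp
      then have "1 \<le> (x j + 1 / 2 - real k / real N) / \<eta>" using assms(3) by simp
      then show ?thesis unfolding s_def using True by (simp add: ramp_ge_1)
    next
      case False
      then have "x j + 1 / 2 - real k / real N \<le> 0" using cb(5)[of k] that by simp
      then have "(x j + 1 / 2 - real k / real N) / \<eta> \<le> 0" using assms(3) by (simp add: divide_le_0_iff)
      then show ?thesis unfolding s_def using False by (simp add: ramp_le_0)
    qed
    then have "(\<Sum>k\<in>{1..N}. (- 1) * s j k x) = (\<Sum>k\<in>{1..N}. if k \<le> cell_of N x j then - 1 else 0)"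
      by (intro sum.cong) auto
    moreover have "(\<Sum>k\<in>{1..N}. if k \<le> cell_of N x j then - 1 else 0) = - real (cell_of N x j)"
    proof -
      have "{1..N} \<inter> {k. k \<le> cell_of N x j} = {1..cell_of N x j}" using cb(1) by auto
      then show ?thesis by (simp add: sum.If_cases)
    qed
    ultimately show ?thesis using cb(2) by (simp add: y_def)
  qed
  then show ?thesis using hidden_layer by blast
qed

text \<open>
  The index \<open>c\<close> is that of the cell containing the input, and \<open>s j k\<close> are the values of the step functions. In
  every direction \<open>j\<close> the difference \<open>1 - s j (\<mu> j) + s j (\<mu> j + 1)\<close> is 0 if \<open>\<mu> j = c j\<close> and 1
  otherwise. Weighted with \<open>2 D\<close> it switches off all cells but one; the shift by \<open>D\<close> keeps the rectifier
  from cutting off negative values in the active cell.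
\<close>
lemma cell_selection:
  fixes s :: "nat \<Rightarrow> nat \<Rightarrow> real" and D :: real
  assumes fin: "finite \<Lambda>" and c: "c \<in> \<Lambda>" and D: "D \<ge> 0"
    and inj: "\<And>\<mu>. \<mu> \<in> \<Lambda> \<Longrightarrow> (\<forall>j<d. \<mu> j = c j) \<Longrightarrow> \<mu> = c"
    and s: "\<And>\<mu> j. \<mu> \<in> \<Lambda> \<Longrightarrow> j < d \<Longrightarrow> s j (\<mu> j) = (if \<mu> j \<le> c j then 1 else 0)"
    and s': "\<And>\<mu> j. \<mu> \<in> \<Lambda> \<Longrightarrow> j < d \<Longrightarrow> s j (Suc (\<mu> j)) = (if Suc (\<mu> j) \<le> c j then 1 else 0)"
    and v: "\<And>\<mu>. \<mu> \<in> \<Lambda> \<Longrightarrow> \<bar>v \<mu>\<bar> \<le> D"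
  shows "(\<Sum>\<mu>\<in>\<Lambda>. max 0 (D - 2 * D * real d + (v \<mu> + ((\<Sum>j<d. 2 * D * s j (\<mu> j)) + (\<Sum>j<d. - (2 * D) * s j (Suc (\<mu> j)))))))
     = D + v c"
proof -
  have eq: "D - 2 * D * real d + (v \<mu> + ((\<Sum>j<d. 2 * D * s j (\<mu> j)) + (\<Sum>j<d. - (2 * D) * s j (Suc (\<mu> j)))))
      = D + v \<mu> - 2 * D * real (card {j. j < d \<and> \<mu> j \<noteq> c j})" if \<mu>: "\<mu> \<in> \<Lambda>" for \<mu>
  proof -
    have "(\<Sum>j<d. 2 * D * s j (\<mu> j)) + (\<Sum>j<d. - (2 * D) * s j (Suc (\<mu> j))) - 2 * D * real d
        = (\<Sum>j<d. 2 * D * s j (\<mu> j) + (- (2 * D) * s j (Suc (\<mu> j))) - 2 * D)"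
      by (simp add: sum.distrib sum_subtractf sum_negf)
    also have "\<dots> = (\<Sum>j<d. if \<mu> j \<noteq> c j then - (2 * D) else 0)"
    proof (rule sum.cong[OF refl])
      fix j assume "j \<in> {..<d}"
      then have j: "j < d" by simp
      show "2 * D * s j (\<mu> j) + (- (2 * D) * s j (Suc (\<mu> j))) - 2 * D = (if \<mu> j \<noteq> c j then - (2 * D) else 0)"
        unfolding s[OF \<mu> j] s'[OF \<mu> j] by auto
    qed
    also have "\<dots> = - (2 * D) * real (card {j. j < d \<and> \<mu> j \<noteq> c j})"
      by (simp add: sum.If_cases Int_def conj_commute)
    finally show ?thesis by simp
  qed
  have "max 0 (D - 2 * D * real d + (v \<mu> + ((\<Sum>j<d. 2 * D * s j (\<mu> j)) + (\<Sum>j<d. - (2 * D) * s j (Suc (\<mu> j))))))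
      = (if \<mu> = c then D + v c else 0)" if \<mu>: "\<mu> \<in> \<Lambda>" for \<mu>
  proof (cases "\<mu> = c")
    case True
    then show ?thesis unfolding eq[OF \<mu>] using v[OF c] by simp
  next
    case False
    then obtain j where "j < d" "\<mu> j \<noteq> c j" using inj[OF \<mu>] by blast
    then have "0 < card {j. j < d \<and> \<mu> j \<noteq> c j}" by (auto simp: card_gt_0_iff)
    then have "1 \<le> real (card {j. j < d \<and> \<mu> j \<noteq> c j})" by linarith
    then have "2 * D * 1 \<le> 2 * D * real (card {j. j < d \<and> \<mu> j \<noteq> c j})" using D by (intro mult_left_mono) auto
    then have "D + v \<mu> - 2 * D * real (card {j. j < d \<and> \<mu> j \<noteq> c j}) \<le> 0" using v[OF \<mu>] by simp
    then show ?thesis unfolding eq[OF \<mu>] using False by simp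
  qed
  then have "(\<Sum>\<mu>\<in>\<Lambda>. max 0 (D - 2 * D * real d + (v \<mu> + ((\<Sum>j<d. 2 * D * s j (\<mu> j)) + (\<Sum>j<d. - (2 * D) * s j (Suc (\<mu> j)))))))
     = (\<Sum>\<mu>\<in>\<Lambda>. if \<mu> = c then D + v c else 0)" by (rule sum.cong[OF refl])
  then show ?thesis using fin c by simp
qed

section \<open>Approximation of smooth functions on the cube\<close>

lemma restrict_Qcube: "x \<in> Qcube n \<Longrightarrow> d \<le> n \<Longrightarrow> restrict x {..<d} \<in> Qcube d"
  by (auto simp: Qcube_def PiE_iff)

text \<open>
  The rate of approximation on the cube of dimension \<open>d\<close>, by functions of the first \<open>d\<close> of \<open>n\<close> inputs.
  The circuit computes \<open>f\<close> shifted by a constant \<open>D\<close>, which makes it nonnegative. The accuracy is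
  governed by the two independent numbers \<open>N\<close>, of intervals per axis, and \<open>K\<close>, of pieces in the squaring
  circuit.
\<close>
definition cube_rate :: "nat \<Rightarrow> nat \<Rightarrow> nat \<Rightarrow> nat \<Rightarrow> nat \<Rightarrow> real \<Rightarrow> nat \<Rightarrow> real \<Rightarrow> bool" where
  "cube_rate n q R d m B C D \<longleftrightarrow> C \<ge> 1 \<and> 0 \<le> D \<and> D \<le> real C \<and>
    (\<forall>N K W \<eta> f. pure_smooth d m B f \<and> N \<ge> 1 \<and> K \<ge> 1 \<and> 0 < \<eta> \<and> \<eta> \<le> 1 \<and>
      W \<ge> 2 / \<eta> \<and> W \<ge> 2 * real K \<and> W \<ge> real N \<and> W \<ge> real C \<longrightarrow>
      (\<exists>h. hidden_layer n W (7 + 2 * R * q) (C * (N ^ d + N + K)) {h} \<and>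
        (\<forall>x\<in>Qcube n. x \<notin> grid_slabs d N \<eta> \<longrightarrow>
          \<bar>h x - (D + f (restrict x {..<d}))\<bar> \<le> real C * (1 / real N ^ m + 1 / real K ^ (2 * R)))))"

lemma cube_rateD:
  assumes "cube_rate n q R d m B C D" "pure_smooth d m B f" "N \<ge> 1" "K \<ge> 1" "0 < \<eta>" "\<eta> \<le> 1"
    "W \<ge> 2 / \<eta>" "W \<ge> 2 * real K" "W \<ge> real N" "W \<ge> real C"
  obtains h where "hidden_layer n W (7 + 2 * R * q) (C * (N ^ d + N + K)) {h}"
    "\<And>x. x \<in> Qcube n \<Longrightarrow> x \<notin> grid_slabs d N \<eta> \<Longrightarrow>
      \<bar>h x - (D + f (restrict x {..<d}))\<bar> \<le> real C * (1 / real N ^ m + 1 / real K ^ (2 * R))"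
proof -
  have "\<exists>h. hidden_layer n W (7 + 2 * R * q) (C * (N ^ d + N + K)) {h} \<and>
        (\<forall>x\<in>Qcube n. x \<notin> grid_slabs d N \<eta> \<longrightarrow>
          \<bar>h x - (D + f (restrict x {..<d}))\<bar> \<le> real C * (1 / real N ^ m + 1 / real K ^ (2 * R)))"
    using assms(2-10) by (intro assms(1)[unfolded cube_rate_def, THEN conjunct2, THEN conjunct2, THEN conjunct2, rule_format]) simp
  then show ?thesis using that by (elim exE conjE) simp
qed

text \<open>
  The powers of the affine forms and the step functions are computed side by side. Then follow one
  neuron per cell and one that adds the cells up. The number of affine forms is a constant, so that
  powers and steps together cost \<open>O(K + N)\<close>.
\<close>
lemma hidden_smooth_approximation:
  assumes dn: "d \<le> n" and m: "m \<ge> 1" and deg: "d * (m - 1) \<le> 2 ^ q" and q: "q \<ge> 1" and B: "B > 0"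
  shows "\<exists>C D. cube_rate n q R d m B C D"
proof -
  obtain I :: "((nat \<Rightarrow> nat) \<times> nat) set" and u C1 where I: "finite I" and C1: "C1 \<ge> 0"
    and u1: "\<forall>i\<in>I. \<forall>y. (\<forall>j<d. y j \<in> {0..1}) \<longrightarrow> \<bar>affine_form d (u i) y\<bar> \<le> 1"
    and approx: "\<forall>B N f \<kappa>. pure_smooth d m B f \<and> B \<ge> 0 \<and> N \<ge> 1 \<and> (\<forall>j<d. \<kappa> j < N) \<longrightarrow>
      (\<exists>a. (\<Sum>i\<in>I. \<bar>a i\<bar>) \<le> C1 * B \<and>
        (\<forall>x\<in>Qcube d. \<forall>y. (\<forall>j<d. y j \<in> {0..1} \<and> y j = real N * (x j + 1 / 2) - real (\<kappa> j)) \<longrightarrow>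
          \<bar>f x - (\<Sum>i\<in>I. a i * affine_form d (u i) y ^ (2 ^ q))\<bar> \<le> C1 * B / real N ^ m))"
    using local_ridge_approximation[OF m deg] by (elim exE conjE) (rule that; assumption)
  define D where "D = C1 * B"
  have D: "D \<ge> 0" using C1 B by (simp add: D_def)
  define Cu where "Cu = (\<Sum>i\<in>I. \<bar>fst (u i)\<bar> + (\<Sum>j<d. \<bar>snd (u i) j\<bar>))"
  have Cu: "\<bar>fst (u i)\<bar> \<le> Cu" "j < d \<Longrightarrow> \<bar>snd (u i) j\<bar> \<le> Cu" if i: "i \<in> I" for i j
  proof -
    have "\<bar>fst (u i)\<bar> + (\<Sum>j<d. \<bar>snd (u i) j\<bar>) \<le> Cu" unfolding Cu_def
      by (rule member_le_sum) (use i I in \<open>auto intro!: add_nonneg_nonneg sum_nonneg\<close>)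
    moreover have "0 \<le> (\<Sum>j<d. \<bar>snd (u i) j\<bar>)" by (rule sum_nonneg) simp
    moreover have "j < d \<Longrightarrow> \<bar>snd (u i) j\<bar> \<le> (\<Sum>j<d. \<bar>snd (u i) j\<bar>)" by (rule member_le_sum) auto
    ultimately show "\<bar>fst (u i)\<bar> \<le> Cu" "j < d \<Longrightarrow> \<bar>snd (u i) j\<bar> \<le> Cu" by linarith+
  qed
  define k1 where "k1 = card I * (23 * d + 5 + 10 * q * R) + (18 * d + (3 + 2 * R * q) * (4 * d)) + (card I + 2 * d + 1) + 2"
  define C where "C = k1 + nat \<lceil>Cu\<rceil> + nat \<lceil>2 * D * real d + 2 * D\<rceil> + nat \<lceil>D * 2 ^ q\<rceil> + 1"
  have C: "real C \<ge> Cu" "real C \<ge> 2 * D * real d + 2 * D" "real C \<ge> D * 2 ^ q" "C \<ge> k1" "C \<ge> 1"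
    unfolding C_def by linarith+
  have "1 * D \<le> 2 ^ q * D" using D by (intro mult_right_mono) auto
  then have CD: "D \<le> real C" using C(3) by (simp add: mult.commute)
  have "\<exists>h. hidden_layer n W (7 + 2 * R * q) (C * (N ^ d + N + K)) {h} \<and>
      (\<forall>x\<in>Qcube n. x \<notin> grid_slabs d N \<eta> \<longrightarrow>
        \<bar>h x - (D + f (restrict x {..<d}))\<bar> \<le> real C * (1 / real N ^ m + 1 / real K ^ (2 * R)))"
    if f: "pure_smooth d m B f" and N: "N \<ge> 1" and K: "K \<ge> 1" and \<eta>: "0 < \<eta>" "\<eta> \<le> 1"
      and W: "W \<ge> 2 / \<eta>" "W \<ge> 2 * real K" "W \<ge> real N" "W \<ge> real C" for N K W \<eta> f
  proof -
    have W1: "1 \<le> W" using W(4) C(5) by linarith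
    obtain y :: "nat \<Rightarrow> (nat \<Rightarrow> real) \<Rightarrow> real" where
      y: "hidden_layer n W 3 (d * (4 + 7 * Suc N) + d * (N + 2)) (y ` {..<d})"
      and yx: "\<forall>x\<in>Qcube n. x \<notin> grid_slabs d N \<eta> \<longrightarrow>
        (\<forall>j<d. y j x = real N * (x j + 1 / 2) - real (cell_of N x j))"
      using hidden_local_coordinates[OF dn N \<eta> W(1,3)] by (elim exE conjE) (rule that; assumption)
    define s where "s j k x = ramp ((x j + 1 / 2 - real k / real N) / \<eta>)" for j k and x :: "nat \<Rightarrow> real"
    define SF where "SF = (\<lambda>(j, k). s j k) ` ({..<d} \<times> {..N})"
      define t where "t i x = \<bar>affine_form d (u i) (\<lambda>j. y j x)\<bar>" for i x
    define Z1 where "Z1 = d * (4 + 7 * Suc N) + d * (N + 2) + (2 * d + 5) + q * (R * (4 * K + 6))"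
    have "\<exists>T. hidden_layer n W (5 + 2 * R * q) Z1 {T} \<and>
      (\<forall>x. t i x \<in> {0..1} \<longrightarrow> T x \<in> {0..1} \<and> \<bar>T x - t i x ^ (2 ^ q)\<bar> \<le> (2 ^ q - 1) / real K ^ (2 * R))"
      if i: "i \<in> I" for i
    proof -
      have "hidden_layer n W (3 + 2) (d * (4 + 7 * Suc N) + d * (N + 2) + (2 * d + 5)) {\<lambda>x. \<bar>affine_form d (u i) (\<lambda>j. y j x)\<bar>}"
      proof (rule hidden_abs_aff[OF y W1])
        show "\<bar>fst (u i)\<bar> \<le> W" using Cu(1)[OF i] C(1) W(4) by linarith
        show "\<bar>snd (u i) j\<bar> \<le> W" if "j < d" for j using Cu(2)[OF i that] C(1) W(4) by linarith
      qed
      then have "hidden_layer n W (Suc 4) (d * (4 + 7 * Suc N) + d * (N + 2) + (2 * d + 5)) {t i}"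
        by (simp add: t_def[abs_def])
      from hidden_power[OF this K W(2), of R q] show ?thesis by (simp add: Z1_def)
    qed
    then have "\<forall>i\<in>I. \<exists>T. hidden_layer n W (5 + 2 * R * q) Z1 {T} \<and>
      (\<forall>x. t i x \<in> {0..1} \<longrightarrow> T x \<in> {0..1} \<and> \<bar>T x - t i x ^ (2 ^ q)\<bar> \<le> (2 ^ q - 1) / real K ^ (2 * R))" by (rule ballI)
    from bchoice[OF this] obtain T where
      T: "\<forall>i\<in>I. hidden_layer n W (5 + 2 * R * q) Z1 {T i} \<and>
      (\<forall>x. t i x \<in> {0..1} \<longrightarrow> T i x \<in> {0..1} \<and> \<bar>T i x - t i x ^ (2 ^ q)\<bar> \<le> (2 ^ q - 1) / real K ^ (2 * R))" ..
    have "hidden_layer n W (5 + 2 * R * q) (\<Sum>i\<in>I. Z1) (\<Union>i\<in>I. {T i})"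
      by (rule hidden_UN[OF I]) (use T in blast)
    then have TF: "hidden_layer n W (5 + 2 * R * q) (card I * Z1) (T ` I)" by (simp add: UNION_singleton_eq_range)
    have "card SF \<le> card ({..<d} \<times> {..N})" unfolding SF_def by (rule card_image_le) simp
    then have cSF: "card SF \<le> d * Suc N" by (simp add: card_cartesian_product)
    have "hidden_layer n W (Suc 1) (d * (4 + 7 * Suc N)) SF"
      by (rule hidden_mono[OF hidden_steps[OF dn N \<eta> W(1), unfolded numeral_2_eq_2, folded One_nat_def]])
         (auto simp: SF_def s_def[abs_def])
    from hidden_carry[OF this W1 cSF, of "3 + 2 * R * q"]
    have SF: "hidden_layer n W (5 + 2 * R * q) (d * (4 + 7 * Suc N) + (3 + 2 * R * q) * (2 * (d * Suc N))) SF"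
      by (simp add: numeral_Bit0 numeral_Bit1 algebra_simps)
    define F where "F = T ` I \<union> SF"
    define Z2 where "Z2 = card I * Z1 + (d * (4 + 7 * Suc N) + (3 + 2 * R * q) * (2 * (d * Suc N)))"
    have F: "hidden_layer n W (5 + 2 * R * q) Z2 F" using hidden_Un[OF TF SF] by (simp add: F_def Z2_def)
    have TinF: "T i \<in> F" if "i \<in> I" for i using that by (auto simp: F_def)
    have sinF: "s j k \<in> F" if "j < d" "k \<le> N" for j k
      unfolding F_def SF_def by (rule UnI2, rule image_eqI[of _ _ "(j, k)"]) (use that in auto)
    define \<Lambda> where "\<Lambda> = PiE {..<d} (\<lambda>_. {..<N})"
    have fin\<Lambda>: "finite \<Lambda>" "card \<Lambda> = N ^ d" by (simp_all add: \<Lambda>_def finite_PiE card_PiE)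
    have "\<exists>a. (\<Sum>i\<in>I. \<bar>a i\<bar>) \<le> D \<and>
        (\<forall>x\<in>Qcube d. \<forall>y. (\<forall>j<d. y j \<in> {0..1} \<and> y j = real N * (x j + 1 / 2) - real (\<mu> j)) \<longrightarrow>
          \<bar>f x - (\<Sum>i\<in>I. a i * affine_form d (u i) y ^ (2 ^ q))\<bar> \<le> D / real N ^ m)" if "\<mu> \<in> \<Lambda>" for \<mu>
    proof -
      have "\<forall>j<d. \<mu> j < N" using that by (auto simp: \<Lambda>_def PiE_iff)
      then show ?thesis using f B N unfolding D_def by (intro approx[rule_format]) simp
    qed
    then have "\<forall>\<mu>\<in>\<Lambda>. \<exists>a. (\<Sum>i\<in>I. \<bar>a i\<bar>) \<le> D \<and>
        (\<forall>x\<in>Qcube d. \<forall>y. (\<forall>j<d. y j \<in> {0..1} \<and> y j = real N * (x j + 1 / 2) - real (\<mu> j)) \<longrightarrow>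
          \<bar>f x - (\<Sum>i\<in>I. a i * affine_form d (u i) y ^ (2 ^ q))\<bar> \<le> D / real N ^ m)" by (rule ballI)
    from bchoice[OF this] obtain a where a: "\<forall>\<mu>\<in>\<Lambda>. (\<Sum>i\<in>I. \<bar>a \<mu> i\<bar>) \<le> D \<and>
        (\<forall>x\<in>Qcube d. \<forall>y. (\<forall>j<d. y j \<in> {0..1} \<and> y j = real N * (x j + 1 / 2) - real (\<mu> j)) \<longrightarrow>
          \<bar>f x - (\<Sum>i\<in>I. a \<mu> i * affine_form d (u i) y ^ (2 ^ q))\<bar> \<le> D / real N ^ m)" ..
    have aD: "\<bar>a \<mu> i\<bar> \<le> D" if "\<mu> \<in> \<Lambda>" "i \<in> I" for \<mu> i
      using member_le_sum[of i I "\<lambda>i. \<bar>a \<mu> i\<bar>"] that I a by force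
    define v where "v \<mu> x = (\<Sum>i\<in>I. a \<mu> i * T i x)" for \<mu> x
    define g where "g \<mu> x = max 0 (D - 2 * D * real d + (v \<mu> x + ((\<Sum>j<d. 2 * D * s j (\<mu> j) x) + (\<Sum>j<d. - (2 * D) * s j (Suc (\<mu> j)) x))))" for \<mu> x
    have "hidden_layer n W (Suc (5 + 2 * R * q)) (Z2 + (\<Sum>\<mu>\<in>\<Lambda>. card I + 2 * d + 1)) (g ` \<Lambda>)"
    proof (rule hidden_next_layer[OF F fin\<Lambda>(1)])
      fix \<mu> assume \<mu>: "\<mu> \<in> \<Lambda>"
      have \<mu>N: "\<mu> j < N" if "j < d" for j using \<mu> that by (auto simp: \<Lambda>_def PiE_iff)
      have "wire_sum W F (v \<mu>) (card I)" unfolding v_def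
        by (rule wire_sum_wires[OF I]) (use TinF aD[OF \<mu>] CD W(4) in \<open>force+\<close>)
      moreover have DW: "2 * D \<le> W" "\<bar>D - 2 * D * real d\<bar> \<le> W"
        using C(2) W(4) D mult_nonneg_nonneg[of "2 * D" "real d"] unfolding abs_le_iff by linarith+
      have "wire_sum W F (\<lambda>x. \<Sum>j<d. 2 * D * s j (\<mu> j) x) (card {..<d})"
        by (rule wire_sum_wires) (use sinF \<mu>N DW D in \<open>auto simp: less_imp_le\<close>)
      moreover have "wire_sum W F (\<lambda>x. \<Sum>j<d. - (2 * D) * s j (Suc (\<mu> j)) x) (card {..<d})"
        by (rule wire_sum_wires) (use sinF \<mu>N DW D in \<open>auto simp: Suc_le_eq\<close>)
      ultimately have "wire_sum W F (\<lambda>x. v \<mu> x + ((\<Sum>j<d. 2 * D * s j (\<mu> j) x) + (\<Sum>j<d. - (2 * D) * s j (Suc (\<mu> j)) x))) (card I + (card {..<d} + card {..<d}))"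
        by (intro wire_sum_add)
      then show "neuron W F (g \<mu>) (card I + 2 * d + 1)" unfolding g_def
        by (rule neuronI[OF DW(2)]) simp
    qed
    then have G: "hidden_layer n W (6 + 2 * R * q) (Z2 + N ^ d * (card I + 2 * d + 1)) (g ` \<Lambda>)" by (simp add: fin\<Lambda>(2))
    define h where "h x = max 0 (0 + (\<Sum>\<mu>\<in>\<Lambda>. 1 * g \<mu> x))" for x
    have "wire_sum W (g ` \<Lambda>) (\<lambda>x. \<Sum>\<mu>\<in>\<Lambda>. 1 * g \<mu> x) (card \<Lambda>)"
      by (rule wire_sum_wires[OF fin\<Lambda>(1)]) (use W1 in auto)
    then have "neuron W (g ` \<Lambda>) h (Suc (N ^ d))" unfolding h_def
      by (rule neuronI[rotated]) (use W1 fin\<Lambda> in auto)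
    from hidden_next_neuron[OF G this]
    have H: "hidden_layer n W (7 + 2 * R * q) (Z2 + N ^ d * (card I + 2 * d + 1) + Suc (N ^ d)) {h}" by simp
    have size: "Z2 + N ^ d * (card I + 2 * d + 1) + Suc (N ^ d) \<le> C * (N ^ d + N + K)"
    proof -
      define X where "X = N ^ d + N + K"
      have X: "N \<le> X" "K \<le> X" "N ^ d \<le> X" "1 \<le> X" using N by (auto simp: X_def)
      have NX: "Suc N \<le> 2 * X" using X by linarith
      have "d * (4 + 7 * Suc N) \<le> d * (18 * X)" by (rule mult_le_mono2) (use X(1,4) in simp)
      then have 1: "d * (4 + 7 * Suc N) \<le> (18 * d) * X" by (simp add: mult_ac)
      have "d * (N + 2) \<le> d * (3 * X)" by (rule mult_le_mono2) (use X in linarith)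
      then have 2: "d * (N + 2) \<le> (3 * d) * X" by (simp add: mult_ac)
      have 3: "2 * d + 5 \<le> (2 * d + 5) * X" using X(4) by simp
      have "q * (R * (4 * K + 6)) \<le> q * (R * (10 * X))" by (intro mult_le_mono2) (use X in linarith)
      then have 4: "q * (R * (4 * K + 6)) \<le> (10 * q * R) * X" by (simp add: mult_ac)
      have "Z1 \<le> (18 * d) * X + (3 * d) * X + (2 * d + 5) * X + (10 * q * R) * X" unfolding Z1_def using 1 2 3 4 by linarith
      also have "\<dots> = (23 * d + 5 + 10 * q * R) * X" by (simp add: algebra_simps)
      finally have 5: "card I * Z1 \<le> card I * (23 * d + 5 + 10 * q * R) * X" by (metis mult.assoc mult_le_mono2)
      have "(3 + 2 * R * q) * (2 * (d * Suc N)) \<le> (3 + 2 * R * q) * (2 * (d * (2 * X)))" by (intro mult_le_mono2 NX)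
      then have 6: "(3 + 2 * R * q) * (2 * (d * Suc N)) \<le> ((3 + 2 * R * q) * (4 * d)) * X" by (simp add: mult_ac)
      have 7: "N ^ d * (card I + 2 * d + 1) \<le> (card I + 2 * d + 1) * X"
        by (subst mult.commute[of _ X]) (rule mult_le_mono1[OF X(3)])
      have 8: "Suc (N ^ d) \<le> 2 * X" using X by linarith
      have "Z2 + N ^ d * (card I + 2 * d + 1) + Suc (N ^ d) \<le> card I * (23 * d + 5 + 10 * q * R) * X + ((18 * d) * X + ((3 + 2 * R * q) * (4 * d)) * X) + (card I + 2 * d + 1) * X + 2 * X"
        unfolding Z2_def using 1 5 6 7 8 by linarith
      also have "\<dots> = k1 * X" by (simp add: k1_def algebra_simps)
      also have "\<dots> \<le> C * X" using C(4) by simp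
      finally show ?thesis by (simp add: X_def)
    qed
    have err: "\<bar>h x - (D + f (restrict x {..<d}))\<bar> \<le> real C * (1 / real N ^ m + 1 / real K ^ (2 * R))"
      if x: "x \<in> Qcube n" "x \<notin> grid_slabs d N \<eta>" for x
    proof -
      define c where "c = restrict (cell_of N x) {..<d}"
      note cb = cell_of_bounds[OF N _ x(1) dn x(2) \<eta>(1)]
      have c: "c \<in> \<Lambda>" using cb(1) by (auto simp: \<Lambda>_def c_def)
      have cj: "c j = cell_of N x j" if "j < d" for j using that by (simp add: c_def)
      have yj: "y j x = real N * (restrict x {..<d} j + 1 / 2) - real (c j)" if "j < d" for j
        using yx x that cj by simp
      have y01: "\<forall>j<d. y j x \<in> {0..1}" using yx x cb(2,3) by fastforce
      have t01: "t i x \<in> {0..1}" if "i \<in> I" for i using u1 that y01 by (auto simp: t_def)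
      have st: "s j k x = (if k \<le> c j then 1 else 0)" if "j < d" "k \<le> N" for j k
      proof (cases "k \<le> c j")
        case True
        then have "\<eta> \<le> x j + 1 / 2 - real k / real N" using cb(4)[OF that] cj[OF that(1)] by simp
        then have "1 \<le> (x j + 1 / 2 - real k / real N) / \<eta>" using \<eta> by simp
        then show ?thesis unfolding s_def using True by (simp add: ramp_ge_1)
      next
        case False
        then have "x j + 1 / 2 - real k / real N \<le> 0" using cb(5)[OF that] cj[OF that(1)] by simp
        then have "(x j + 1 / 2 - real k / real N) / \<eta> \<le> 0" using \<eta> by (simp add: divide_le_0_iff)
        then show ?thesis unfolding s_def using False by (simp add: ramp_le_0)
      qed
      have \<mu>N: "\<mu> j < N" if "\<mu> \<in> \<Lambda>" "j < d" for \<mu> j using that by (auto simp: \<Lambda>_def PiE_iff)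
      have vD: "\<bar>v \<mu> x\<bar> \<le> D" if \<mu>: "\<mu> \<in> \<Lambda>" for \<mu>
      proof -
        have "\<bar>v \<mu> x\<bar> \<le> (\<Sum>i\<in>I. \<bar>a \<mu> i\<bar> * 1)" unfolding v_def
          by (rule order_trans[OF sum_abs sum_mono], unfold abs_mult, rule mult_left_mono) (use T t01 in auto)
        then show ?thesis using a \<mu> by force
      qed
      have sel: "(\<Sum>\<mu>\<in>\<Lambda>. g \<mu> x) = D + v c x" unfolding g_def
      proof (rule cell_selection[OF fin\<Lambda>(1) c D _ _ _ vD])
        fix \<mu> assume "\<mu> \<in> \<Lambda>" "\<forall>j<d. \<mu> j = c j"
        then show "\<mu> = c" using c unfolding \<Lambda>_def by (intro PiE_ext) auto
      qed (use st \<mu>N in \<open>auto simp: less_imp_le Suc_le_eq\<close>)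
      then have hx: "h x = D + v c x" using vD[OF c] by (simp add: h_def)
      define p where "p = (\<Sum>i\<in>I. a c i * affine_form d (u i) (\<lambda>j. y j x) ^ (2 ^ q))"
      have e1: "\<bar>f (restrict x {..<d}) - p\<bar> \<le> D / real N ^ m"
        unfolding p_def by (rule bspec[OF a c, THEN conjunct2, rule_format]) (use restrict_Qcube[OF x(1) dn] y01 yj in auto)
      have "\<bar>v c x - p\<bar> = \<bar>\<Sum>i\<in>I. a c i * (T i x - t i x ^ (2 ^ q))\<bar>"
      proof -
        have "t i x ^ (2 ^ q) = affine_form d (u i) (\<lambda>j. y j x) ^ (2 ^ q)" for i
          unfolding t_def by (rule power_even_abs) (use q in simp)
        then show ?thesis by (simp add: v_def p_def sum_subtractf right_diff_distrib)
      qed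
      also have "\<dots> \<le> (\<Sum>i\<in>I. \<bar>a c i\<bar> * ((2 ^ q - 1) / real K ^ (2 * R)))"
        by (rule order_trans[OF sum_abs sum_mono], unfold abs_mult, rule mult_left_mono) (use T t01 in auto)
      also have "\<dots> = (\<Sum>i\<in>I. \<bar>a c i\<bar>) * ((2 ^ q - 1) / real K ^ (2 * R))" by (rule sum_distrib_right[symmetric])
      also have "\<dots> \<le> D * ((2 ^ q) / real K ^ (2 * R))"
        by (intro mult_mono divide_right_mono) (use a c D in auto)
      also have "\<dots> = (D * 2 ^ q) * (1 / real K ^ (2 * R))" by simp
      also have "\<dots> \<le> real C * (1 / real K ^ (2 * R))" using C(3) by (intro mult_right_mono) auto
      finally have e2: "\<bar>v c x - p\<bar> \<le> real C * (1 / real K ^ (2 * R))" .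
      have "D * (1 / real N ^ m) \<le> real C * (1 / real N ^ m)" using CD by (intro mult_right_mono) auto
      then have "D / real N ^ m \<le> real C * (1 / real N ^ m)" by simp
      then have "\<bar>h x - (D + f (restrict x {..<d}))\<bar> \<le> real C * (1 / real N ^ m) + real C * (1 / real K ^ (2 * R))"
        using e1 e2 unfolding hx by linarith
      then show ?thesis by (simp add: distrib_left)
    qed
    show ?thesis
      by (rule exI[of _ h]) (use hidden_mono[OF H order_refl size] err in blast)
  qed
  note main = this
  show ?thesis unfolding cube_rate_def
  proof (rule exI[of _ C], rule exI[of _ D], intro conjI allI impI)
    show "1 \<le> C" "0 \<le> D" "D \<le> real C" by (fact C(5) D CD)+
  qed (elim conjE, rule main)
qed

section \<open>Pieces enclosed by smooth boundaries\<close>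

text \<open>
  Coordinate \<open>k\<close> lies strictly between boundaries that depend on the coordinates before it.
\<close>
definition enclosed :: "nat \<Rightarrow> (nat \<Rightarrow> (nat \<Rightarrow> real) \<Rightarrow> real) \<Rightarrow> (nat \<Rightarrow> (nat \<Rightarrow> real) \<Rightarrow> real) \<Rightarrow> (nat \<Rightarrow> real) \<Rightarrow> bool" where
  "enclosed n F G x \<longleftrightarrow> (\<forall>k<n. F k (restrict x {..<k}) < x k \<and> x k < G k (restrict x {..<k}))"

text \<open>
  Going through the coordinates, the witness of traceability turns into inequalities between the
  globally defined boundary functions. If \<open>A\<close> is a graph in one of the coordinates, it has no points
  off this graph.
\<close>
lemma Kclass_boundaries:
  assumes "A \<in> Kclass m n B"
  shows "\<exists>F G. (\<forall>k<n. pure_smooth k m B (F k) \<and> pure_smooth k m B (G k) \<and>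
      continuous_on (RR k) (F k) \<and> continuous_on (RR k) (G k)) \<and>
    (\<forall>x\<in>Qcube n. (\<forall>k<n. x k \<noteq> F k (restrict x {..<k})) \<longrightarrow> (x \<in> A \<longleftrightarrow> enclosed n F G x))"
proof -
  obtain As f g where tw: "trace_witness m n A As f g"
    and FG: "\<forall>i\<in>{1..n}. \<exists>F G. C_open (i - 1) m (RR (i - 1)) F \<and> C_open (i - 1) m (RR (i - 1)) G \<and>
          (\<forall>x\<in>As (i - 1). F x = f i x) \<and> (\<forall>x\<in>As (i - 1). G x = g i x) \<and>
          Wnorm (i - 1) m F \<le> ereal B \<and> Wnorm (i - 1) m G \<le> ereal B"
    using assms unfolding Kclass_def by blast
  have "\<forall>k\<in>{..<n}. \<exists>FG. C_open k m (RR k) (fst FG) \<and> C_open k m (RR k) (snd FG) \<and>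
          (\<forall>x\<in>As k. fst FG x = f (Suc k) x) \<and> (\<forall>x\<in>As k. snd FG x = g (Suc k) x) \<and>
          Wnorm k m (fst FG) \<le> ereal B \<and> Wnorm k m (snd FG) \<le> ereal B"
  proof
    fix k assume "k \<in> {..<n}"
    then have "Suc k \<in> {1..n}" by auto
    from bspec[OF FG this] show "\<exists>FG. C_open k m (RR k) (fst FG) \<and> C_open k m (RR k) (snd FG) \<and>
          (\<forall>x\<in>As k. fst FG x = f (Suc k) x) \<and> (\<forall>x\<in>As k. snd FG x = g (Suc k) x) \<and>
          Wnorm k m (fst FG) \<le> ereal B \<and> Wnorm k m (snd FG) \<le> ereal B" by simp
  qed
  from bchoice[OF this] obtain FG where
    FG: "\<forall>k\<in>{..<n}. C_open k m (RR k) (fst (FG k)) \<and> C_open k m (RR k) (snd (FG k)) \<and>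
          (\<forall>x\<in>As k. fst (FG k) x = f (Suc k) x) \<and> (\<forall>x\<in>As k. snd (FG k) x = g (Suc k) x) \<and>
          Wnorm k m (fst (FG k)) \<le> ereal B \<and> Wnorm k m (snd (FG k)) \<le> ereal B" ..
  define opn where "opn k \<longleftrightarrow> As (Suc k) = open_region (Suc k) (f (Suc k)) (g (Suc k)) (As k)" for k
  define F where "F k = fst (FG k)" for k
  \<comment> \<open>for a graph both boundaries are taken equal, so that nothing lies strictly between them\<close>
  define G where "G k = (if opn k then snd (FG k) else F k)" for k
  have As0: "As 0 = RR 0" and Asn: "As n = A" using tw by (auto simp: trace_witness_def)
  have AsR: "As k \<subseteq> RR k" if "k \<le> n" for k
    using tw that As0 by (cases k) (auto simp: trace_witness_def)
  have type: "opn k \<or> As (Suc k) = graph_region (Suc k) (f (Suc k)) (As k)" if "k < n" for k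
  proof -
    have "Suc k \<in> {1..n}" using that by simp
    from tw[unfolded trace_witness_def, THEN conjunct2, THEN conjunct2, THEN bspec, OF this]
    show ?thesis by (elim conjE disjE) (simp_all add: opn_def)
  qed
  have mem: "restrict x {..<k} \<in> As k \<longleftrightarrow> (\<forall>i<k. F i (restrict x {..<i}) < x i \<and> x i < G i (restrict x {..<i}))"
    if x: "x \<in> Qcube n" and off: "\<forall>k<n. x k \<noteq> F k (restrict x {..<k})" and k: "k \<le> n" for x k
    using k
  proof (induction k)
    case 0 then show ?case by (simp add: As0 RR_def PiE_empty_domain restrict_def)
  next
    case (Suc k)
    define z where "z = restrict x {..<k}"
    have kn: "k < n" using Suc by simp
    have IH: "z \<in> As k \<longleftrightarrow> (\<forall>i<k. F i (restrict x {..<i}) < x i \<and> x i < G i (restrict x {..<i}))"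
      using Suc.IH[OF less_imp_le[OF kn]] unfolding z_def .
    have zk: "restrict x {..<Suc k} = z(k := x k)" by (auto simp: z_def restrict_def)
    have upd: "w = z \<and> y = x k" if "z(k := x k) = w(k := y)" "w \<in> As k" for w y
    proof
      have "w \<in> RR k" using AsR[of k] that(2) kn by auto
      then have "w k = undefined" by (auto simp: RR_def PiE_iff extensional_def)
      moreover have "z k = undefined" by (simp add: z_def)
      ultimately have "w i = z i" for i using fun_cong[OF that(1), of i] by (cases "i = k") auto
      then show "w = z" by (rule ext)
      show "y = x k" using fun_cong[OF that(1), of k] by simp
    qed
    have Fk: "w \<in> As k \<Longrightarrow> F k w = f (Suc k) w" for w using FG kn by (auto simp: F_def)
    have step: "restrict x {..<Suc k} \<in> As (Suc k) \<longleftrightarrow> z \<in> As k \<and> F k z < x k \<and> x k < G k z"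
    proof (cases "opn k")
      case True
      have Gk: "w \<in> As k \<Longrightarrow> G k w = g (Suc k) w" for w using FG kn True by (auto simp: G_def)
      have eq: "restrict x {..<Suc k} \<in> As (Suc k) \<longleftrightarrow>
          (\<exists>w y. z(k := x k) = w(k := y) \<and> w \<in> As k \<and> f (Suc k) w < y \<and> y < g (Suc k) w)"
        using True unfolding opn_def zk by (simp add: open_region_def)
      show ?thesis
      proof
        assume "restrict x {..<Suc k} \<in> As (Suc k)"
        then obtain w y where wy: "z(k := x k) = w(k := y)" "w \<in> As k" "f (Suc k) w < y" "y < g (Suc k) w"
          unfolding eq by blast
        from upd[OF wy(1,2)] show "z \<in> As k \<and> F k z < x k \<and> x k < G k z" using wy Fk Gk by simp
      next
        assume "z \<in> As k \<and> F k z < x k \<and> x k < G k z"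
        then show "restrict x {..<Suc k} \<in> As (Suc k)"
          unfolding eq by (intro exI[of _ z] exI[of _ "x k"]) (auto simp: Fk Gk)
      qed
    next
      case False
      then have "restrict x {..<Suc k} \<in> As (Suc k) \<longleftrightarrow> (\<exists>w. z(k := x k) = w(k := f (Suc k) w) \<and> w \<in> As k)"
        using type[OF kn] unfolding zk by (simp add: graph_region_def)
      moreover have "\<not> (\<exists>w. z(k := x k) = w(k := f (Suc k) w) \<and> w \<in> As k)"
      proof
        assume "\<exists>w. z(k := x k) = w(k := f (Suc k) w) \<and> w \<in> As k"
        then obtain w where w: "z(k := x k) = w(k := f (Suc k) w)" "w \<in> As k" by blast
        from upd[OF w] have "x k = F k z" using w(2) Fk by auto
        then show False using off kn by (simp add: z_def)
      qed
      ultimately show ?thesis using False by (auto simp: G_def)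
    qed
    show ?case unfolding All_less_Suc IH[symmetric] step unfolding z_def by (simp only: conj_ac)
  qed
  show ?thesis
  proof (rule exI[of _ F], rule exI[of _ G], intro conjI allI impI ballI)
    fix k assume k: "k < n"
    show "pure_smooth k m B (F k)"
      by (rule pure_smooth_from_Wnorm[OF Qcube_subset_RR]) (use FG k in \<open>auto simp: F_def\<close>)
    show "pure_smooth k m B (G k)"
      by (rule pure_smooth_from_Wnorm[OF Qcube_subset_RR]) (use FG k in \<open>auto simp: F_def G_def\<close>)
    show "continuous_on (RR k) (F k)" "continuous_on (RR k) (G k)"
      by (rule C_open_continuous[of k m]; use FG k in \<open>auto simp: F_def G_def\<close>)+
  next
    fix x assume x: "x \<in> Qcube n" "\<forall>k<n. x k \<noteq> F k (restrict x {..<k})"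
    have "restrict x {..<n} = x" using x(1) by (auto simp: Qcube_def PiE_iff extensional_def restrict_def)
    then show "x \<in> A \<longleftrightarrow> enclosed n F G x" using mem[OF x order_refl] by (simp add: Asn enclosed_def)
  qed
qed

lemma Fclass_pure_smooth:
  assumes "f \<in> Fclass M n B"
  shows "\<exists>F. pure_smooth n M B F \<and> (\<forall>x\<in>Qcube n. F x = f x)"
  using assms pure_smooth_from_Wnorm unfolding Fclass_def by blast

lemma hidden_ramp:
  assumes "hidden_layer n W L S F" "wire_sum W F g c" "\<bar>b\<bar> \<le> W" "\<bar>b - 1\<bar> \<le> W" "1 \<le> W"
  shows "hidden_layer n W (L + 2) (S + (2 * c + 5)) {\<lambda>x. ramp (b + g x)}"
proof -
  define r where "r e x = max 0 (b - e + g x)" for e :: real and x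
  have "hidden_layer n W (Suc L) (S + (\<Sum>e\<in>{0, 1 :: real}. Suc c)) (r ` {0, 1})"
  proof (rule hidden_next_layer[OF assms(1)])
    fix e :: real assume "e \<in> {0, 1}"
    then show "neuron W F (r e) (Suc c)" unfolding r_def
      by (intro neuronI[OF _ assms(2)]) (use assms(3,4) in auto)
  qed simp
  then have R: "hidden_layer n W (Suc L) (S + 2 * Suc c) {r 0, r 1}" by (simp add: mult_2)
  have "neuron W {r 0, r 1} (\<lambda>x. ramp (b + g x)) 3"
  proof (rule neuron_ramp[OF _ _ assms(5)])
    have "(\<lambda>x. max 0 (b + g x)) = r 0" "(\<lambda>x. max 0 (b + g x - 1)) = r 1" by (auto simp: r_def algebra_simps)
    then show "(\<lambda>x. max 0 (b + g x)) \<in> {r 0, r 1}" "(\<lambda>x. max 0 (b + g x - 1)) \<in> {r 0, r 1}" by auto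
  qed
  from hidden_next_neuron[OF R this] show ?thesis by (simp add: add.commute add.left_commute)
qed

text \<open>
  The \<open>2 n\<close> inequalities that describe a piece become ramps of slope \<open>1 / \<tau>\<close>; the bias lets \<open>h\<close> pass
  only if all of them are 1. The boundaries \<open>F k\<close> and \<open>G k\<close> come with the shift \<open>D k\<close>, the coordinates
  \<open>u k\<close> with the shift \<open>1 / 2\<close>.
\<close>
lemma hidden_gated_piece:
  assumes h: "hidden_layer n W (Suc L) Z {h}" and u: "\<And>k. k < n \<Longrightarrow> hidden_layer n W (Suc L) Z {u k}"
    and FG: "\<And>k. k < n \<Longrightarrow> hidden_layer n W (Suc L) Z {F k}" "\<And>k. k < n \<Longrightarrow> hidden_layer n W (Suc L) Z {G k}"
    and W: "1 \<le> W" "1 / \<tau> \<le> W" "\<And>k. k < n \<Longrightarrow> \<bar>(D k - 1 / 2) / \<tau>\<bar> + 1 \<le> W" "c * (2 * real n) \<le> W" "c \<le> W"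
    and \<tau>: "\<tau> > 0" and c: "c \<ge> 0"
  shows "hidden_layer n W (L + 4) (Z * (4 * n + 1) + 20 * n + 6)
    {\<lambda>x. max 0 (- (c * (2 * real n)) + (1 * h x + ((\<Sum>k<n. c * ramp ((u k x - 1 / 2 - F k x + D k) / \<tau>)) +
        (\<Sum>k<n. c * ramp ((G k x - D k - u k x + 1 / 2) / \<tau>)))))}"
proof -
  define SF where "SF k x = ramp ((u k x - 1 / 2 - F k x + D k) / \<tau>)" for k x
  define SG where "SG k x = ramp ((G k x - D k - u k x + 1 / 2) / \<tau>)" for k x
  have w: "\<bar>1 / \<tau>\<bar> \<le> W" "\<bar>- (1 / \<tau>)\<bar> \<le> W" using W(2) \<tau> by auto
  have SF: "hidden_layer n W (Suc L + 2) (2 * Z + 9) {SF k}" if k: "k < n" for k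
  proof -
    have b: "\<bar>(D k - 1 / 2) / \<tau>\<bar> \<le> W" "\<bar>(D k - 1 / 2) / \<tau> - 1\<bar> \<le> W" using W(3)[OF k] by linarith+
    have "wire_sum W ({u k} \<union> {F k}) (\<lambda>x. (1 / \<tau>) * u k x + (- (1 / \<tau>)) * F k x) (1 + 1)"
      by (intro wire_sum_add wire_sum_wire w) auto
    from hidden_ramp[OF hidden_Un[OF u[OF k] FG(1)[OF k]] this b W(1)]
    have H: "hidden_layer n W (Suc L + 2) (Z + Z + (2 * (1 + 1) + 5)) {\<lambda>x. ramp ((D k - 1 / 2) / \<tau> + ((1 / \<tau>) * u k x + (- (1 / \<tau>)) * F k x))}" .
    have eq: "(\<lambda>x. ramp ((D k - 1 / 2) / \<tau> + ((1 / \<tau>) * u k x + (- (1 / \<tau>)) * F k x))) = SF k"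
      by (rule ext, unfold SF_def, rule arg_cong[where f = ramp]) (use \<tau> in \<open>simp add: field_simps\<close>)
    show ?thesis by (rule hidden_mono[OF H[unfolded eq] order_refl]) simp
  qed
  have SG: "hidden_layer n W (Suc L + 2) (2 * Z + 9) {SG k}" if k: "k < n" for k
  proof -
    have "- ((D k - 1 / 2) / \<tau>) = (1 / 2 - D k) / \<tau>" by (simp add: minus_divide_left)
    then have b: "\<bar>(1 / 2 - D k) / \<tau>\<bar> \<le> W" "\<bar>(1 / 2 - D k) / \<tau> - 1\<bar> \<le> W" using W(3)[OF k] by linarith+
    have "wire_sum W ({u k} \<union> {G k}) (\<lambda>x. (1 / \<tau>) * G k x + (- (1 / \<tau>)) * u k x) (1 + 1)"
      by (intro wire_sum_add wire_sum_wire w) auto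
    from hidden_ramp[OF hidden_Un[OF u[OF k] FG(2)[OF k]] this b W(1)]
    have H: "hidden_layer n W (Suc L + 2) (Z + Z + (2 * (1 + 1) + 5)) {\<lambda>x. ramp ((1 / 2 - D k) / \<tau> + ((1 / \<tau>) * G k x + (- (1 / \<tau>)) * u k x))}" .
    have eq: "(\<lambda>x. ramp ((1 / 2 - D k) / \<tau> + ((1 / \<tau>) * G k x + (- (1 / \<tau>)) * u k x))) = SG k"
      by (rule ext, unfold SG_def, rule arg_cong[where f = ramp]) (use \<tau> in \<open>simp add: field_simps\<close>)
    show ?thesis by (rule hidden_mono[OF H[unfolded eq] order_refl]) simp
  qed
  have 1: "hidden_layer n W (Suc L + 2) (\<Sum>k<n. 2 * Z + 9) (\<Union>k\<in>{..<n}. {SF k})" by (rule hidden_UN) (use SF in auto)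
  have 2: "hidden_layer n W (Suc L + 2) (\<Sum>k<n. 2 * Z + 9) (\<Union>k\<in>{..<n}. {SG k})" by (rule hidden_UN) (use SG in auto)
  have 3: "hidden_layer n W (Suc L + 2) (Z + 2 * (2 * 1)) {h}" by (rule hidden_carry[OF h W(1)]) simp
  define E where "E = {h} \<union> ((\<Union>k\<in>{..<n}. {SF k}) \<union> (\<Union>k\<in>{..<n}. {SG k}))"
  have E: "hidden_layer n W (Suc L + 2) (Z + 4 + (n * (2 * Z + 9) + n * (2 * Z + 9))) E"
    using hidden_Un[OF 3 hidden_Un[OF 1 2]] by (simp add: E_def)
  have cW: "\<bar>c\<bar> \<le> W" using c W(5) by simp
  have "wire_sum W E (\<lambda>x. 1 * h x + ((\<Sum>k<n. c * SF k x) + (\<Sum>k<n. c * SG k x))) (1 + (card {..<n} + card {..<n}))"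
    by (intro wire_sum_add wire_sum_wire wire_sum_wires) (use W(1) cW in \<open>auto simp: E_def\<close>)
  then have "neuron W E (\<lambda>x. max 0 (- (c * (2 * real n)) + (1 * h x + ((\<Sum>k<n. c * SF k x) + (\<Sum>k<n. c * SG k x))))) (2 * n + 2)"
    by (rule neuronI[rotated]) (use W(4) c in \<open>auto simp: abs_mult\<close>)
  note nE = this
  have L: "Suc (Suc L + 2) = L + 4" by simp
  have size: "Z + 4 + (n * (2 * Z + 9) + n * (2 * Z + 9)) + (2 * n + 2) = Z * (4 * n + 1) + 20 * n + 6"
    by (simp add: algebra_simps)
  show ?thesis using hidden_next_neuron[OF E nE] unfolding L size unfolding SF_def SG_def .
qed

text \<open>
  A single failing inequality lowers the argument by \<open>c\<close>, which is at least \<open>h\<close>.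
\<close>
lemma gate_value:
  fixes a b :: "nat \<Rightarrow> real"
  assumes "\<And>k. k < n \<Longrightarrow> a k = (if P k then 1 else 0)" "\<And>k. k < n \<Longrightarrow> b k = (if Q k then 1 else 0)"
    and "0 \<le> h" "h \<le> c"
  shows "max 0 (- (c * (2 * real n)) + (1 * h + ((\<Sum>k<n. c * a k) + (\<Sum>k<n. c * b k)))) = (if \<forall>k<n. P k \<and> Q k then h else 0)"
proof (cases "\<forall>k<n. P k \<and> Q k")
  case True
  then have "(\<Sum>k<n. c * a k) = (\<Sum>k<n. c)" "(\<Sum>k<n. c * b k) = (\<Sum>k<n. c)"
    by (auto intro!: sum.cong simp: assms(1,2))
  then show ?thesis using True assms(3) by (simp add: algebra_simps)
next
  case False
  then obtain k where k: "k < n" "\<not> (P k \<and> Q k)" by blast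
  have c: "c \<ge> 0" using assms by linarith
  have le: "c * a i + c * b i \<le> 2 * c" if "i < n" for i using that c by (simp add: assms(1,2))
  have "(\<Sum>k<n. c * a k) + (\<Sum>k<n. c * b k) = (\<Sum>i<n. c * a i + c * b i)" by (simp add: sum.distrib)
  also have "\<dots> = (c * a k + c * b k) + (\<Sum>i\<in>{..<n} - {k}. c * a i + c * b i)" using k by (simp add: sum.remove)
  also have "\<dots> \<le> c + (\<Sum>i\<in>{..<n} - {k}. 2 * c)"
    by (intro add_mono sum_mono) (use le k c in \<open>auto simp: assms(1,2)\<close>)
  also have "(\<Sum>i\<in>{..<n} - {k}. 2 * c) = 2 * c * (real n - 1)" using k(1) by (simp add: of_nat_diff)
  finally have "(\<Sum>k<n. c * a k) + (\<Sum>k<n. c * b k) \<le> c * (2 * real n) - c" by (simp add: algebra_simps)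
  then show ?thesis unfolding if_not_P[OF False] using assms(4) by simp
qed

section \<open>Exceptional sets, norms and parameters\<close>

lemma emeasure_grid_slabs:
  assumes "d \<le> n" "\<eta> > 0"
  shows "Qcube n \<inter> grid_slabs d N \<eta> \<in> sets (leb n)"
    and "emeasure (leb n) (Qcube n \<inter> grid_slabs d N \<eta>) \<le> ennreal (real d * (real N + 1) * \<eta>)"
proof -
  define S where "S = (\<lambda>(j, k). {x \<in> Qcube n. (real k / real N - 1 / 2) + 0 \<le> x j \<and> x j \<le> (real k / real N - 1 / 2) + \<eta>})"
  have eq: "Qcube n \<inter> grid_slabs d N \<eta> = (\<Union>i\<in>{..<d} \<times> {..N}. S i)"
    by (auto simp: grid_slabs_def S_def algebra_simps)
  have S: "S i \<in> sets (leb n)" "emeasure (leb n) (S i) \<le> ennreal \<eta>" if iD: "i \<in> {..<d} \<times> {..N}" for i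
  proof -
    obtain j k where i: "i = (j, k)" "j < d" using iD by auto
    have "j < n" using i(2) assms(1) by simp
    note sl = emeasure_slab[OF this, of "\<lambda>_. real k / real N - 1 / 2" 0 \<eta>]
    show "S i \<in> sets (leb n)" unfolding S_def i(1) prod.case by (rule sl(1)) (use assms(2) in auto)
    have "emeasure (leb n) (S i) \<le> ennreal (\<eta> - 0)" unfolding S_def i(1) prod.case by (rule sl(2)) (use assms(2) in auto)
    then show "emeasure (leb n) (S i) \<le> ennreal \<eta>" by simp
  qed
  show "Qcube n \<inter> grid_slabs d N \<eta> \<in> sets (leb n)" unfolding eq by (rule sets.finite_UN) (use S in auto)
  have "emeasure (leb n) (\<Union>i\<in>{..<d} \<times> {..N}. S i) \<le> (\<Sum>i\<in>{..<d} \<times> {..N}. emeasure (leb n) (S i))"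
    by (rule emeasure_subadditive_finite) (use S in auto)
  also have "\<dots> \<le> (\<Sum>i\<in>{..<d} \<times> {..N}. ennreal \<eta>)" by (rule sum_mono) (rule S(2))
  also have "\<dots> = ennreal (\<Sum>i\<in>{..<d} \<times> {..N}. \<eta>)" using assms(2) by (intro sum_ennreal) auto
  also have "(\<Sum>i\<in>{..<d} \<times> {..N}. \<eta>) = real d * (real N + 1) * \<eta>" by (simp add: card_cartesian_product algebra_simps)
  finally show "emeasure (leb n) (Qcube n \<inter> grid_slabs d N \<eta>) \<le> ennreal (real d * (real N + 1) * \<eta>)" unfolding eq .
qed

lemma emeasure_near_graph:
  assumes "continuous_on (RR k) F" "k < n" "\<tau> \<ge> 0"
  shows "{x \<in> Qcube n. \<bar>x k - F (restrict x {..<k})\<bar> \<le> \<tau>} \<in> sets (leb n)"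
    and "emeasure (leb n) {x \<in> Qcube n. \<bar>x k - F (restrict x {..<k})\<bar> \<le> \<tau>} \<le> ennreal (2 * \<tau>)"
proof -
  have eq: "{x \<in> Qcube n. \<bar>x k - F (restrict x {..<k})\<bar> \<le> \<tau>}
      = {x \<in> Qcube n. F (restrict x {..<k}) + - \<tau> \<le> x k \<and> x k \<le> F (restrict x {..<k}) + \<tau>}"
    by (auto simp: abs_le_iff)
  have m: "(\<lambda>x. F (restrict x {..<k})) \<in> borel_measurable (leb n)"
    by (rule measurable_restrict_continuous[OF assms(1)]) (use assms(2) in simp)
  have ind: "F (restrict (x(k := y)) {..<k}) = F (restrict x {..<k})" for x y
    by (rule arg_cong[where f = F]) (auto simp: restrict_def)
  show "{x \<in> Qcube n. \<bar>x k - F (restrict x {..<k})\<bar> \<le> \<tau>} \<in> sets (leb n)"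
    unfolding eq by (rule emeasure_slab(1)[OF assms(2) m ind]) (use assms(3) in simp)
  have "emeasure (leb n) {x \<in> Qcube n. \<bar>x k - F (restrict x {..<k})\<bar> \<le> \<tau>} \<le> ennreal (\<tau> - - \<tau>)"
    unfolding eq by (rule emeasure_slab(2)[OF assms(2) m ind]) (use assms(3) in simp)
  then show "emeasure (leb n) {x \<in> Qcube n. \<bar>x k - F (restrict x {..<k})\<bar> \<le> \<tau>} \<le> ennreal (2 * \<tau>)" by simp
qed

text \<open>
  The bound \<open>\<delta>\<close> is used off the exceptional set \<open>E\<close> and the bound \<open>b\<close> on it. Comparing with a simple
  function leaves only the measures of the cube and of \<open>E\<close>.
\<close>
lemma Lp_norm_bound:
  assumes p: "p \<ge> 1" and E: "E \<in> sets (leb n)" "emeasure (leb n) E \<le> ennreal \<mu>" and \<mu>: "\<mu> \<ge> 0"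
    and good: "\<And>x. x \<in> Qcube n \<Longrightarrow> x \<notin> E \<Longrightarrow> \<bar>h x\<bar> \<le> \<delta>" and bad: "\<And>x. x \<in> Qcube n \<Longrightarrow> \<bar>h x\<bar> \<le> b"
    and e: "e \<ge> 0" "\<delta> powr p + b powr p * \<mu> \<le> e powr p"
  shows "Lp_norm n p h \<le> ennreal e"
proof -
  define I where "I = (\<integral>\<^sup>+x\<in>Qcube n. ennreal (\<bar>h x\<bar> powr p) \<partial>leb n)"
  have "I \<le> (\<integral>\<^sup>+x. ennreal (\<delta> powr p) * indicator (Qcube n) x + ennreal (b powr p) * indicator E x \<partial>leb n)"
    unfolding I_def
  proof (rule nn_integral_mono)
    fix x
    show "ennreal (\<bar>h x\<bar> powr p) * indicator (Qcube n) x \<le> ennreal (\<delta> powr p) * indicator (Qcube n) x + ennreal (b powr p) * indicator E x"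
    proof (cases "x \<in> Qcube n")
      case True
      show ?thesis
      proof (cases "x \<in> E")
        case True
        have "ennreal (\<bar>h x\<bar> powr p) \<le> ennreal (b powr p)"
          using bad[OF \<open>x \<in> Qcube n\<close>] p by (intro ennreal_leI powr_mono2) auto
        then have "ennreal (\<bar>h x\<bar> powr p) \<le> ennreal (\<delta> powr p) + ennreal (b powr p)" by (rule order_trans) simp
        then show ?thesis using True \<open>x \<in> Qcube n\<close> by simp
      next
        case False
        have "ennreal (\<bar>h x\<bar> powr p) \<le> ennreal (\<delta> powr p)"
          using good[OF \<open>x \<in> Qcube n\<close> False] p by (intro ennreal_leI powr_mono2) auto
        then show ?thesis using False \<open>x \<in> Qcube n\<close> by simp
      qed
    qed simp
  qed
  also have "\<dots> = ennreal (\<delta> powr p) * emeasure (leb n) (Qcube n) + ennreal (b powr p) * emeasure (leb n) E"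
    using E by (subst nn_integral_add) (auto simp: nn_integral_cmult_indicator)
  also have "\<dots> \<le> ennreal (\<delta> powr p) + ennreal (b powr p) * ennreal \<mu>"
    using E(2) by (intro add_mono mult_left_mono) (auto simp: emeasure_Qcube)
  also have "\<dots> = ennreal (\<delta> powr p + b powr p * \<mu>)" using \<mu> by (simp add: ennreal_mult ennreal_plus)
  also have "\<dots> \<le> ennreal (e powr p)" by (rule ennreal_leI[OF e(2)])
  finally have I: "I \<le> ennreal (e powr p)" .
  then have "I \<noteq> \<infinity>" by (auto simp: top_unique)
  have "enn2real I \<le> e powr p" using enn2real_mono[OF I] by simp
  then have "enn2real I powr (1 / p) \<le> (e powr p) powr (1 / p)" using p by (intro powr_mono2) auto
  also have "\<dots> = e" using p e(1) by (simp add: powr_powr)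
  finally show ?thesis using \<open>I \<noteq> \<infinity>\<close> unfolding Lp_norm_def Let_def I_def[symmetric] by (simp add: ennreal_leI)
qed

lemma nat_ceiling_bounds:
  assumes "1 \<le> (x :: real)"
  shows "1 \<le> nat \<lceil>x\<rceil>" "x \<le> real (nat \<lceil>x\<rceil>)" "real (nat \<lceil>x\<rceil>) \<le> 2 * x"
proof -
  show "x \<le> real (nat \<lceil>x\<rceil>)" by linarith
  then have "1 \<le> real (nat \<lceil>x\<rceil>)" using assms by linarith
  then show "1 \<le> nat \<lceil>x\<rceil>" by linarith
  show "real (nat \<lceil>x\<rceil>) \<le> 2 * x" using assms by linarith
qed

text \<open>
  The three numbers are the powers \<open>e\<^sup>-\<^sup>\<alpha>\<close>, \<open>e\<^sup>-\<^sup>p\<^sup>/\<^sup>m\<close> and \<open>e\<^sup>-\<^sup>1\<^sup>/\<^sup>M\<close> rounded up, which costs a factor 2 at most.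
  The choice of \<open>M\<close> gives \<open>n / M \<le> \<alpha>\<close>, and that of \<open>R\<close> gives \<open>p \<le> 2 R \<alpha>\<close>.
\<close>
lemma parameter_choice:
  fixes m n :: nat and p e :: real
  assumes m: "m \<ge> 1" and p: "p \<ge> 1" and n: "n \<ge> 2" and e: "0 < e" "e < 1"
  defines "\<alpha> \<equiv> p * real (n - 1) / real m"
    and "M \<equiv> nat \<lceil>real (m * n) / (p * real (n - 1))\<rceil>"
    and "R \<equiv> nat \<lceil>real m / (2 * real (n - 1))\<rceil>"
  shows "\<exists>K Nb Ng :: nat. K \<ge> 1 \<and> Nb \<ge> 1 \<and> Ng \<ge> 1 \<and> real K \<le> 2 * e powr (- \<alpha>) \<and>
    real (Nb ^ (n - 1)) \<le> 2 ^ n * e powr (- \<alpha>) \<and> real (Ng ^ n) \<le> 2 ^ n * e powr (- \<alpha>) \<and>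
    real Nb \<le> 2 * e powr (- p) \<and> real Ng \<le> 2 * e powr (- p) \<and>
    1 / real Nb ^ m \<le> e powr p \<and> 1 / real Ng ^ M \<le> e \<and> 1 / real K ^ (2 * R) \<le> e powr p"
proof -
  have n1: "real (n - 1) > 0" using n by simp
  have \<alpha>: "\<alpha> > 0" using n1 m p by (simp add: \<alpha>_def)
  have mn: "real (m * n) / (p * real (n - 1)) > 0" using m n p n1 by simp
  moreover have "1 \<le> nat \<lceil>x\<rceil> \<and> x \<le> real (nat \<lceil>x\<rceil>)" if "0 < x" for x :: real using that by linarith
  ultimately have M: "M \<ge> 1" "real (m * n) / (p * real (n - 1)) \<le> real M" unfolding M_def by blast+
  have R: "real m / (2 * real (n - 1)) \<le> real R" unfolding R_def by (rule real_nat_ceiling_ge)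
  have ge1: "1 \<le> e powr (- a)" if "a \<ge> 0" for a
    using powr_mono'[of "- a" 0 e] that e by simp
  define K where "K = nat \<lceil>e powr (- \<alpha>)\<rceil>"
  define Nb where "Nb = nat \<lceil>e powr (- (p / real m))\<rceil>"
  define Ng where "Ng = nat \<lceil>e powr (- (1 / real M))\<rceil>"
  have K: "1 \<le> K" "e powr (- \<alpha>) \<le> real K" "real K \<le> 2 * e powr (- \<alpha>)"
    unfolding K_def by (rule nat_ceiling_bounds[OF ge1]; use \<alpha> in simp)+
  have Nb: "1 \<le> Nb" "e powr (- (p / real m)) \<le> real Nb" "real Nb \<le> 2 * e powr (- (p / real m))"
    unfolding Nb_def by (rule nat_ceiling_bounds[OF ge1]; use p in simp)+
  have Ng: "1 \<le> Ng" "e powr (- (1 / real M)) \<le> real Ng" "real Ng \<le> 2 * e powr (- (1 / real M))"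
    unfolding Ng_def by (rule nat_ceiling_bounds[OF ge1]; simp)+
  have pw: "(e powr a) ^ k = e powr (a * real k)" for a k using e by (simp add: powr_power mult.commute)
  have anti: "e powr b \<le> e powr a" if "a \<le> b" for a b using powr_mono'[OF that] e by simp
  have inv: "1 / x \<le> e powr a" if "e powr (- a) \<le> x" for a x
  proof -
    have "0 < e powr (- a)" using e by simp
    moreover from this have "0 < x" using that by linarith
    ultimately have "1 / x \<le> 1 / e powr (- a)" using that by (intro divide_left_mono) auto
    then show ?thesis by (simp add: powr_minus divide_inverse)
  qed
  have "real (Nb ^ (n - 1)) \<le> (2 * e powr (- (p / real m))) ^ (n - 1)"
    unfolding of_nat_power by (rule power_mono[OF Nb(3)]) simp
  also have "\<dots> = 2 ^ (n - 1) * e powr (- \<alpha>)" by (simp add: power_mult_distrib pw \<alpha>_def)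
  also have "\<dots> \<le> 2 ^ n * e powr (- \<alpha>)" by (intro mult_right_mono power_increasing) auto
  finally have 1: "real (Nb ^ (n - 1)) \<le> 2 ^ n * e powr (- \<alpha>)" .
  have "real n / real M \<le> \<alpha>"
  proof -
    have "real (m * n) \<le> real M * (p * real (n - 1))" using M(2) p n1 by (simp add: pos_divide_le_eq)
    then show ?thesis using M(1) m by (simp add: \<alpha>_def field_simps)
  qed
  then have nM: "- \<alpha> \<le> - (1 / real M) * real n" by simp
  have "real (Ng ^ n) \<le> (2 * e powr (- (1 / real M))) ^ n"
    unfolding of_nat_power by (rule power_mono[OF Ng(3)]) simp
  also have "\<dots> = 2 ^ n * e powr (- (1 / real M) * real n)" by (simp only: power_mult_distrib pw)
  also have "\<dots> \<le> 2 ^ n * e powr (- \<alpha>)" by (intro mult_left_mono anti nM) simp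
  finally have 2: "real (Ng ^ n) \<le> 2 ^ n * e powr (- \<alpha>)" .
  have "p / real m \<le> p" using m p by (simp add: divide_le_eq mult_left_le)
  then have 3: "real Nb \<le> 2 * e powr (- p)" using Nb(3) anti[of "- p" "- (p / real m)"] by linarith
  have "1 / real M \<le> 1" using M(1) by simp
  then have 4: "real Ng \<le> 2 * e powr (- p)" using Ng(3) anti[of "- p" "- (1 / real M)"] p by linarith
  have "e powr (- p) = (e powr (- (p / real m))) ^ m" using m by (simp add: pw)
  also have "\<dots> \<le> real Nb ^ m" by (rule power_mono[OF Nb(2)]) simp
  finally have 5: "1 / real Nb ^ m \<le> e powr p" by (rule inv)
  have "e powr (- 1) = (e powr (- (1 / real M))) ^ M" using M(1) by (simp add: pw)
  also have "\<dots> \<le> real Ng ^ M" by (rule power_mono[OF Ng(2)]) simp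
  finally have "1 / real Ng ^ M \<le> e powr 1" by (rule inv)
  then have 6: "1 / real Ng ^ M \<le> e" using e by simp
  have "real m \<le> real R * (2 * real (n - 1))" using R n1 by (simp add: pos_divide_le_eq)
  then have "p * real m \<le> p * (real R * (2 * real (n - 1)))" using p by (intro mult_left_mono) auto
  then have "p \<le> \<alpha> * real (2 * R)" using m by (simp add: \<alpha>_def field_simps)
  then have "e powr (- p) \<le> e powr (- \<alpha> * real (2 * R))" by (intro anti) simp
  also have "\<dots> = (e powr (- \<alpha>)) ^ (2 * R)" by (simp only: pw)
  also have "\<dots> \<le> real K ^ (2 * R)" by (rule power_mono[OF K(2)]) simp
  finally have 7: "1 / real K ^ (2 * R) \<le> e powr p" by (rule inv)
  show ?thesis using K Nb(1) Ng(1) 1 2 3 4 5 6 7 by blast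
qed

section \<open>Gluing the pieces\<close>

text \<open>
  Measurability is included, so that finite unions preserve the property with the sum of the bounds.
\<close>
definition measure_at_most :: "'a measure \<Rightarrow> 'a set \<Rightarrow> real \<Rightarrow> bool" where
  "measure_at_most M A a \<longleftrightarrow> A \<in> sets M \<and> emeasure M A \<le> ennreal a \<and> 0 \<le> a"

lemma measure_at_most_Un: "measure_at_most M A a \<Longrightarrow> measure_at_most M B b \<Longrightarrow> measure_at_most M (A \<union> B) (a + b)"
  unfolding measure_at_most_def
  by (auto intro!: order_trans[OF emeasure_subadditive] add_mono simp: ennreal_plus)

lemma measure_at_most_UN:
  assumes "finite I" "\<And>i. i \<in> I \<Longrightarrow> measure_at_most M (A i) a" "0 \<le> a"
  shows "measure_at_most M (\<Union>i\<in>I. A i) (real (card I) * a)"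
  using assms(1,2)
proof (induction I rule: finite_induct)
  case empty then show ?case by (simp add: measure_at_most_def)
next
  case (insert i I)
  have "measure_at_most M (A i) a" "measure_at_most M (\<Union>i\<in>I. A i) (real (card I) * a)" using insert by simp_all
  from measure_at_most_Un[OF this] show ?case using insert.hyps by (simp add: distrib_right)
qed

lemma measure_at_most_mono: "measure_at_most M A a \<Longrightarrow> a \<le> b \<Longrightarrow> measure_at_most M A b"
  unfolding measure_at_most_def by (auto intro: order_trans ennreal_leI)

text \<open>
  Truncation of \<open>z\<close> to \<open>{- b..b}\<close>, written with two rectifiers. It bounds the network on the exceptional
  set and does not move away from values that satisfy the bound.
\<close>
definition clip :: "real \<Rightarrow> real \<Rightarrow> real" where
  "clip b z = max 0 (z + b) - max 0 (z - b) - b"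

lemma clip_bounds: "b \<ge> 0 \<Longrightarrow> \<bar>clip b z\<bar> \<le> b"
  by (auto simp: clip_def max_def)

lemma clip_nonexpansive: "\<bar>y\<bar> \<le> b \<Longrightarrow> \<bar>y - clip b z\<bar> \<le> \<bar>y - z\<bar>"
  by (auto simp: clip_def max_def)

lemma network_of_clipped_sum:
  assumes w: "\<And>i. i \<in> I \<Longrightarrow> hidden_layer n W L S {w i}" and I: "finite I" and n: "n \<ge> 1"
    and W: "1 \<le> W" "\<bar>D\<bar> + b \<le> W" and b: "b \<ge> 0"
  shows "\<exists>\<Phi>. relu_network n 1 \<Phi> \<and> net_depth \<Phi> = Suc L \<and> net_size \<Phi> \<le> card I * S + 2 * card I + 5 \<and>
    net_max \<Phi> \<le> real (card I * S + 2 * card I + 5) * W \<and> (\<forall>x. net_fun n \<Phi> x = clip b ((\<Sum>i\<in>I. w i x) - D))"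
proof -
  have "hidden_layer n W L (\<Sum>i\<in>I. S) (\<Union>i\<in>I. {w i})" by (rule hidden_UN[OF I w])
  then have H: "hidden_layer n W L (card I * S) (w ` I)" by (simp add: UNION_singleton_eq_range)
  define z where "z e x = max 0 (- D + e * b + (\<Sum>i\<in>I. 1 * w i x))" for e x
  have ws: "wire_sum W (w ` I) (\<lambda>x. \<Sum>i\<in>I. 1 * w i x) (card I)"
    by (rule wire_sum_wires[OF I]) (use W(1) in auto)
  have "hidden_layer n W (Suc L) (card I * S + (\<Sum>e\<in>{1, - 1 :: real}. Suc (card I))) (z ` {1, - 1})"
  proof (rule hidden_next_layer[OF H])
    fix e :: real assume "e \<in> {1, - 1}"
    then have "\<bar>- D + e * b\<bar> \<le> W" using W(2) b by auto
    then show "neuron W (w ` I) (z e) (Suc (card I))" unfolding z_def by (rule neuronI[OF _ ws]) simp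
  qed simp
  then have Z: "hidden_layer n W (Suc L) (card I * S + 2 * Suc (card I)) {z 1, z (- 1)}" by (simp add: mult_2)
  have out: "wire_sum W {z 1, z (- 1)} (\<lambda>x. 1 * z 1 x + (- 1) * z (- 1) x) (1 + 1)"
    by (intro wire_sum_add wire_sum_wire) (use W(1) in auto)
  have "\<bar>- b\<bar> \<le> W" using W b by linarith
  have size: "card I * S + 2 * Suc (card I) + Suc (1 + 1) = card I * S + 2 * card I + 5" by simp
  have W0: "0 \<le> W" "1 \<le> Suc L" using W(1) by simp_all
  from hidden_network[OF Z n W0 out \<open>\<bar>- b\<bar> \<le> W\<close>, unfolded size] obtain \<Phi> where
    \<Phi>: "relu_network n 1 \<Phi>" "net_depth \<Phi> = Suc L" "net_size \<Phi> \<le> card I * S + 2 * card I + 5"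
    "net_max \<Phi> \<le> real (card I * S + 2 * card I + 5) * W"
    "\<forall>x. net_fun n \<Phi> x = - b + (1 * z 1 x + (- 1) * z (- 1) x)" by (elim exE conjE) (rule that; assumption)
  have "- b + (1 * z 1 x + (- 1) * z (- 1) x) = clip b ((\<Sum>i\<in>I. w i x) - D)" for x
    by (simp add: z_def clip_def algebra_simps)
  then have "\<forall>x. net_fun n \<Phi> x = clip b ((\<Sum>i\<in>I. w i x) - D)" using \<Phi>(5) by simp
  then show ?thesis using \<Phi>(1-4) by blast
qed

text \<open>
  The two grids belong to the boundary functions and to the smooth pieces.
\<close>
definition bad_set :: "nat \<Rightarrow> nat \<Rightarrow> nat \<Rightarrow> real \<Rightarrow> real \<Rightarrow> nat set \<Rightarrow> (nat \<Rightarrow> nat \<Rightarrow> (nat \<Rightarrow> real) \<Rightarrow> real) \<Rightarrow>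
    (nat \<Rightarrow> nat \<Rightarrow> (nat \<Rightarrow> real) \<Rightarrow> real) \<Rightarrow> (nat \<Rightarrow> real) set" where
  "bad_set n N N' \<eta> \<tau> I F G = (Qcube n \<inter> grid_slabs n N \<eta>) \<union> (Qcube n \<inter> grid_slabs n N' \<eta>) \<union>
    (\<Union>i\<in>I. \<Union>k\<in>{..<n}. {x \<in> Qcube n. \<bar>x k - F i k (restrict x {..<k})\<bar> \<le> \<tau>} \<union>
       {x \<in> Qcube n. \<bar>x k - G i k (restrict x {..<k})\<bar> \<le> \<tau>})"

lemma measure_at_most_bad_set:
  assumes "finite I" "\<eta> > 0" "\<tau> \<ge> 0"
    and "\<And>i k. i \<in> I \<Longrightarrow> k < n \<Longrightarrow> continuous_on (RR k) (F i k)" "\<And>i k. i \<in> I \<Longrightarrow> k < n \<Longrightarrow> continuous_on (RR k) (G i k)"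
  shows "measure_at_most (leb n) (bad_set n N N' \<eta> \<tau> I F G)
    (real n * (real N + 1) * \<eta> + real n * (real N' + 1) * \<eta> + real (card I) * (real n * (4 * \<tau>)))"
proof -
  have grid: "measure_at_most (leb n) (Qcube n \<inter> grid_slabs n N \<eta>) (real n * (real N + 1) * \<eta>)" for N
    using emeasure_grid_slabs[of n n \<eta> N] assms(2) by (simp add: measure_at_most_def)
  have near: "measure_at_most (leb n) {x \<in> Qcube n. \<bar>x k - H (restrict x {..<k})\<bar> \<le> \<tau>} (2 * \<tau>)"
    if "k < n" "continuous_on (RR k) H" for k H
    using emeasure_near_graph[OF that(2,1) assms(3)] assms(3) by (simp add: measure_at_most_def)
  have "measure_at_most (leb n) ({x \<in> Qcube n. \<bar>x k - F i k (restrict x {..<k})\<bar> \<le> \<tau>} \<union>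
       {x \<in> Qcube n. \<bar>x k - G i k (restrict x {..<k})\<bar> \<le> \<tau>}) (4 * \<tau>)" if "i \<in> I" "k < n" for i k
    using measure_at_most_Un[OF near[OF that(2) assms(4)[OF that]] near[OF that(2) assms(5)[OF that]]] by simp
  then have "measure_at_most (leb n) (\<Union>k\<in>{..<n}. {x \<in> Qcube n. \<bar>x k - F i k (restrict x {..<k})\<bar> \<le> \<tau>} \<union>
       {x \<in> Qcube n. \<bar>x k - G i k (restrict x {..<k})\<bar> \<le> \<tau>}) (real (card {..<n}) * (4 * \<tau>))" if "i \<in> I" for i
    by (intro measure_at_most_UN) (use that assms(3) in auto)
  then have "measure_at_most (leb n) (\<Union>i\<in>I. \<Union>k\<in>{..<n}. {x \<in> Qcube n. \<bar>x k - F i k (restrict x {..<k})\<bar> \<le> \<tau>} \<union>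
       {x \<in> Qcube n. \<bar>x k - G i k (restrict x {..<k})\<bar> \<le> \<tau>}) (real (card I) * (real (card {..<n}) * (4 * \<tau>)))"
    by (intro measure_at_most_UN[OF assms(1)]) (use assms(3) in auto)
  from measure_at_most_Un[OF measure_at_most_Un[OF grid grid] this] show ?thesis unfolding bad_set_def by simp
qed

text \<open>
  The boundary value \<open>c\<close> is known up to \<open>\<tau>\<close> through \<open>t\<close>. Since \<open>y\<close> is at least \<open>2 \<tau>\<close> away from it, the ramp
  has reached its final value.
\<close>
lemma ramp_threshold:
  assumes "\<tau> > 0" "\<bar>t - (D + c)\<bar> \<le> \<tau>" "\<bar>y - c\<bar> > 2 * \<tau>"
  shows "ramp ((y + 1 / 2 - 1 / 2 - t + D) / \<tau>) = (if c < y then 1 else 0)"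
    "ramp ((t - D - (y + 1 / 2) + 1 / 2) / \<tau>) = (if y < c then 1 else 0)"
proof -
  show "ramp ((y + 1 / 2 - 1 / 2 - t + D) / \<tau>) = (if c < y then 1 else 0)"
  proof (cases "c < y")
    case True
    then have "1 \<le> (y + 1 / 2 - 1 / 2 - t + D) / \<tau>" using assms by (simp add: le_divide_eq)
    then show ?thesis using True by (simp only: ramp_ge_1 if_True)
  next
    case False
    then have "(y + 1 / 2 - 1 / 2 - t + D) / \<tau> \<le> 0" using assms by (simp add: divide_le_0_iff)
    then show ?thesis using False by (simp only: ramp_le_0 if_False)
  qed
  show "ramp ((t - D - (y + 1 / 2) + 1 / 2) / \<tau>) = (if y < c then 1 else 0)"
  proof (cases "y < c")
    case True
    then have "1 \<le> (t - D - (y + 1 / 2) + 1 / 2) / \<tau>" using assms by (simp add: le_divide_eq)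
    then show ?thesis using True by (simp only: ramp_ge_1 if_True)
  next
    case False
    then have "(t - D - (y + 1 / 2) + 1 / 2) / \<tau> \<le> 0" using assms by (simp add: divide_le_0_iff)
    then show ?thesis using False by (simp only: ramp_le_0 if_False)
  qed
qed

lemma hidden_shifted_coordinate:
  assumes "k < n" "1 \<le> W" shows "hidden_layer n W (Suc L) (2 + L * 2) {\<lambda>x. max 0 (x k + 1 / 2)}"
proof -
  have "neuron W ((\<lambda>j x. x j) ` {..<n}) (\<lambda>x. max 0 (1 / 2 + 1 * x k)) 2"
    by (rule neuronI[OF _ wire_sum_wire]) (use assms in auto)
  from hidden_next_neuron[OF hidden_inputs this] have "hidden_layer n W (Suc 0) 2 {\<lambda>x. max 0 (x k + 1 / 2)}"
    by (simp add: add.commute numeral_2_eq_2)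
  from hidden_carry[OF this assms(2), of 1 L] show ?thesis by simp
qed

text \<open>
  Off the exceptional set exactly one piece is active and all gates are exactly 0 or 1.
\<close>
lemma gated_pieces_value:
  assumes I: "finite I" and i: "i \<in> I" and enc: "enclosed n (F i) (G i) x" "\<And>j. j \<in> I \<Longrightarrow> j \<noteq> i \<Longrightarrow> \<not> enclosed n (F j) (G j) x"
    and x: "x \<in> Qcube n" and \<tau>: "\<tau> > 0"
    and far: "\<And>j k. j \<in> I \<Longrightarrow> k < n \<Longrightarrow> \<bar>x k - F j k (restrict x {..<k})\<bar> > 2 * \<tau> \<and> \<bar>x k - G j k (restrict x {..<k})\<bar> > 2 * \<tau>"
    and FG: "\<And>j k. j \<in> I \<Longrightarrow> k < n \<Longrightarrow> \<bar>F' j k x - (D k + F j k (restrict x {..<k}))\<bar> \<le> \<tau> \<and> \<bar>G' j k x - (D k + G j k (restrict x {..<k}))\<bar> \<le> \<tau>"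
    and h: "\<And>j. j \<in> I \<Longrightarrow> 0 \<le> h j x \<and> h j x \<le> c"
  shows "(\<Sum>j\<in>I. max 0 (- (c * (2 * real n)) + (1 * h j x +
      ((\<Sum>k<n. c * ramp ((max 0 (x k + 1 / 2) - 1 / 2 - F' j k x + D k) / \<tau>)) +
       (\<Sum>k<n. c * ramp ((G' j k x - D k - max 0 (x k + 1 / 2) + 1 / 2) / \<tau>)))))) = h i x"
proof -
  have xk: "max 0 (x k + 1 / 2) = x k + 1 / 2" if "k < n" for k using Qcube_coord[OF x that] by simp
  have "max 0 (- (c * (2 * real n)) + (1 * h j x +
      ((\<Sum>k<n. c * ramp ((max 0 (x k + 1 / 2) - 1 / 2 - F' j k x + D k) / \<tau>)) +
       (\<Sum>k<n. c * ramp ((G' j k x - D k - max 0 (x k + 1 / 2) + 1 / 2) / \<tau>))))) = (if j = i then h j x else 0)"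
    if j: "j \<in> I" for j
  proof -
    have a: "ramp ((max 0 (x k + 1 / 2) - 1 / 2 - F' j k x + D k) / \<tau>) = (if F j k (restrict x {..<k}) < x k then 1 else 0)"
      if k: "k < n" for k unfolding xk[OF k] by (rule ramp_threshold(1)[OF \<tau>]) (use FG[OF j k] far[OF j k] in auto)
    have b: "ramp ((G' j k x - D k - max 0 (x k + 1 / 2) + 1 / 2) / \<tau>) = (if x k < G j k (restrict x {..<k}) then 1 else 0)"
      if k: "k < n" for k unfolding xk[OF k] by (rule ramp_threshold(2)[OF \<tau>]) (use FG[OF j k] far[OF j k] in auto)
    have "(\<forall>k<n. F j k (restrict x {..<k}) < x k \<and> x k < G j k (restrict x {..<k})) \<longleftrightarrow> j = i"
      using enc j unfolding enclosed_def by blast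
    with gate_value[OF a b, where h = "h j x" and c = c] h[OF j] show ?thesis by simp
  qed
  then have "(\<Sum>j\<in>I. max 0 (- (c * (2 * real n)) + (1 * h j x +
      ((\<Sum>k<n. c * ramp ((max 0 (x k + 1 / 2) - 1 / 2 - F' j k x + D k) / \<tau>)) +
       (\<Sum>k<n. c * ramp ((G' j k x - D k - max 0 (x k + 1 / 2) + 1 / 2) / \<tau>)))))) = (\<Sum>j\<in>I. if j = i then h j x else 0)"
    by (rule sum.cong[OF refl])
  then show ?thesis using I i by simp
qed

section \<open>The rate for piecewise smooth functions\<close>

lemma grid_slabs_mono: "d \<le> n \<Longrightarrow> grid_slabs d N \<eta> \<subseteq> grid_slabs n N \<eta>"
  unfolding grid_slabs_def by (auto intro: less_le_trans)

lemma pure_smooth_bound: "pure_smooth d m B f \<Longrightarrow> w \<in> Qcube d \<Longrightarrow> \<bar>f w\<bar> \<le> B"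
  unfolding pure_smooth_def by blast

text \<open>
  Off the boundary graphs, the disjoint cover of the cube says that the inequalities of exactly one piece
  hold.
\<close>
lemma Gclass_pieces:
  assumes "f \<in> Gclass m n p B l"
  defines "M \<equiv> nat \<lceil>real (m * n) / (p * real (n - 1))\<rceil>"
  shows "\<exists>H F G. (\<forall>i\<in>{1..l}. pure_smooth n M B (H i)) \<and>
    (\<forall>i\<in>{1..l}. \<forall>k<n. pure_smooth k m B (F i k) \<and> pure_smooth k m B (G i k) \<and>
      continuous_on (RR k) (F i k) \<and> continuous_on (RR k) (G i k)) \<and>
    (\<forall>x\<in>Qcube n. \<bar>f x\<bar> \<le> B \<and> ((\<forall>i\<in>{1..l}. \<forall>k<n. x k \<noteq> F i k (restrict x {..<k})) \<longrightarrow>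
      (\<exists>i\<in>{1..l}. f x = H i x \<and> enclosed n (F i) (G i) x \<and> (\<forall>j\<in>{1..l}. j \<noteq> i \<longrightarrow> \<not> enclosed n (F j) (G j) x))))"
proof -
  obtain g A where g: "\<forall>i\<in>{1..l}. g i \<in> Fclass M n B" and A: "\<forall>i\<in>{1..l}. A i \<in> Kclass m n B"
    and disj: "disjoint_family_on A {1..l}" and cover: "Qcube n = (\<Union>i\<in>{1..l}. A i)"
    and f: "\<forall>x\<in>Qcube n. f x = (\<Sum>i\<in>{1..l}. g i x * indicator (A i) x)"
    using assms(1) unfolding Gclass_def M_def by blast
  have "\<forall>i\<in>{1..l}. \<exists>H. pure_smooth n M B H \<and> (\<forall>x\<in>Qcube n. H x = g i x)"
    using g Fclass_pure_smooth by blast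
  from bchoice[OF this] obtain H where H: "\<forall>i\<in>{1..l}. pure_smooth n M B (H i) \<and> (\<forall>x\<in>Qcube n. H i x = g i x)" ..
  define P where "P i FG \<longleftrightarrow> (\<forall>k<n. pure_smooth k m B (fst FG k) \<and> pure_smooth k m B (snd FG k) \<and>
      continuous_on (RR k) (fst FG k) \<and> continuous_on (RR k) (snd FG k)) \<and>
    (\<forall>x\<in>Qcube n. (\<forall>k<n. x k \<noteq> fst FG k (restrict x {..<k})) \<longrightarrow> (x \<in> A i \<longleftrightarrow> enclosed n (fst FG) (snd FG) x))" for i FG
  have "\<forall>i\<in>{1..l}. \<exists>FG. P i FG"
  proof
    fix i assume "i \<in> {1..l}"
    with A have "A i \<in> Kclass m n B" by blast
    from Kclass_boundaries[OF this] obtain F G where "P i (F, G)" unfolding P_def by auto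
    then show "\<exists>FG. P i FG" ..
  qed
  from bchoice[OF this] obtain FG where FG: "\<forall>i\<in>{1..l}. P i (FG i)" ..
  have piece: "\<exists>i\<in>{1..l}. x \<in> A i \<and> f x = H i x \<and> (\<forall>j\<in>{1..l}. j \<noteq> i \<longrightarrow> x \<notin> A j)" if x: "x \<in> Qcube n" for x
  proof -
    obtain i where i: "i \<in> {1..l}" "x \<in> A i" using cover x by blast
    have other: "x \<notin> A j" if "j \<in> {1..l}" "j \<noteq> i" for j
      using disj i that unfolding disjoint_family_on_def by blast
    have "f x = (\<Sum>j\<in>{1..l}. if j = i then g i x else 0)"
      unfolding f[rule_format, OF x] by (rule sum.cong) (use i other in auto)
    then have "f x = g i x" using i(1) by simp
    then show ?thesis using H i x other by (intro bexI[of _ i]) auto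
  qed
  show ?thesis
  proof (rule exI[of _ H], rule exI[of _ "\<lambda>i. fst (FG i)"], rule exI[of _ "\<lambda>i. snd (FG i)"], intro conjI ballI allI impI)
    fix i assume i: "i \<in> {1..l}"
    show "pure_smooth n M B (H i)" using H i by blast
    fix k assume k: "k < n"
    show "pure_smooth k m B (fst (FG i) k)" "pure_smooth k m B (snd (FG i) k)"
      "continuous_on (RR k) (fst (FG i) k)" "continuous_on (RR k) (snd (FG i) k)"
      using FG i k unfolding P_def by blast+
  next
    fix x assume x: "x \<in> Qcube n"
    obtain i where i: "i \<in> {1..l}" "x \<in> A i" "f x = H i x" "\<forall>j\<in>{1..l}. j \<noteq> i \<longrightarrow> x \<notin> A j" using piece[OF x] by blast
    show "\<bar>f x\<bar> \<le> B" unfolding i(3) by (rule pure_smooth_bound[OF _ x]) (use H i(1) in blast)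
    assume off: "\<forall>i\<in>{1..l}. \<forall>k<n. x k \<noteq> fst (FG i) k (restrict x {..<k})"
    have mem: "x \<in> A j \<longleftrightarrow> enclosed n (fst (FG j)) (snd (FG j)) x" if "j \<in> {1..l}" for j
      using FG off x that unfolding P_def by blast
    show "\<exists>i\<in>{1..l}. f x = H i x \<and> enclosed n (fst (FG i)) (snd (FG i)) x \<and>
        (\<forall>j\<in>{1..l}. j \<noteq> i \<longrightarrow> \<not> enclosed n (fst (FG j)) (snd (FG j)) x)"
      by (rule bexI[OF _ i(1)]) (use i mem in blast)
  qed
qed

text \<open>
  The function is the sum of the gated pieces. Off the exceptional set the error is that of the active
  smooth piece, \<open>O(e)\<close>; on the exceptional set, of measure \<open>O(e\<^sup>p)\<close>, the clipped network and the function
  are bounded by \<open>B\<close>. Both contribute \<open>O(e\<^sup>p)\<close> to the \<open>p\<close>-th power of the norm.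
\<close>
lemma piecewise_smooth_rate:
  fixes m n l q :: nat and p B :: real
  assumes m: "m \<ge> 1" and p: "p \<ge> 1" and n: "n \<ge> 2" and B: "B > 0" and q: "q \<ge> 1" "2 * (m * n) \<le> 2 ^ q"
  defines "\<alpha> \<equiv> p * real (n - 1) / real m"
    and "R \<equiv> nat \<lceil>real m / (2 * real (n - 1))\<rceil>"
  shows "\<exists>C s :: real. C \<ge> 1 \<and> s > 0 \<and> (\<forall>f\<in>Gclass m n p B l. \<forall>e. 0 < e \<and> e < 1 \<longrightarrow>
    (\<exists>\<Phi>. relu_network n 1 \<Phi> \<and> net_max \<Phi> \<le> C * e powr (- s) \<and> real (net_size \<Phi>) \<le> C * e powr (- \<alpha>) \<and>
      net_depth \<Phi> = 11 + 2 * R * q \<and> Lp_norm n p (\<lambda>x. f x - net_fun n \<Phi> x) \<le> ennreal (C * e)))"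
proof -
  define M where "M = nat \<lceil>real (m * n) / (p * real (n - 1))\<rceil>"
  have n1: "real (n - 1) \<ge> 1" using n by simp
  have \<alpha>: "\<alpha> > 0" using n1 m p by (simp add: \<alpha>_def)
  have X0: "0 < real (m * n) / (p * real (n - 1))" using m n p n1 by simp
  have M1: "M \<ge> 1" using X0 unfolding M_def by (simp add: Suc_le_eq)
  have M2: "M \<le> 2 * m"
  proof -
    have "real n \<le> 2 * real (n - 1)" using n by (simp add: of_nat_diff)
    also have "\<dots> \<le> 2 * (p * real (n - 1))" using mult_right_mono[OF p, of "real (n - 1)"] by simp
    finally have "real m * real n \<le> real m * (2 * (p * real (n - 1)))" by (rule mult_left_mono) simp
    then have "real (m * n) / (p * real (n - 1)) \<le> real (2 * m)" using p n1 by (simp add: divide_le_eq mult_ac)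
    then have "\<lceil>real (m * n) / (p * real (n - 1))\<rceil> \<le> int (2 * m)" by (simp add: ceiling_le_iff)
    then show ?thesis unfolding M_def by linarith
  qed
  have degM: "n * (M - 1) \<le> 2 ^ q"
  proof -
    have "n * (M - 1) \<le> n * (2 * m)" using M2 by (intro mult_le_mono2) linarith
    also have "\<dots> = 2 * (m * n)" by simp
    also have "\<dots> \<le> 2 ^ q" by (rule q(2))
    finally show ?thesis .
  qed
  have degm: "k * (m - 1) \<le> 2 ^ q" if "k < n" for k
  proof -
    have "k * (m - 1) \<le> n * m" using that by (intro mult_le_mono) auto
    then show ?thesis using q(2) by (simp add: mult_ac)
  qed
  have "\<forall>k\<in>{..<n}. \<exists>CD. cube_rate n q R k m B (fst CD) (snd CD)"
  proof
    fix k assume "k \<in> {..<n}"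
    then have "k < n" by simp
    from hidden_smooth_approximation[OF less_imp_le[OF this] m degm[OF this] q(1) B, of R] obtain C D where
      "cube_rate n q R k m B C D" by blast
    then show "\<exists>CD. cube_rate n q R k m B (fst CD) (snd CD)" by (intro exI[of _ "(C, D)"]) simp
  qed
  from bchoice[OF this] obtain CD where CD: "\<forall>k\<in>{..<n}. cube_rate n q R k m B (fst (CD k)) (snd (CD k))" ..
  define Cb where "Cb k = fst (CD k)" for k
  define Db where "Db k = snd (CD k)" for k
  have rate_b: "cube_rate n q R k m B (Cb k) (Db k)" if "k < n" for k using CD that by (simp add: Cb_def Db_def)
  obtain Cg Dg where rate_g: "cube_rate n q R n M B Cg Dg"
    using hidden_smooth_approximation[OF order_refl M1 degM q(1) B, of R] by blast
  define C0 where "C0 = Cg + (\<Sum>k<n. Cb k)"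
  have CbC0: "Cb k \<le> C0" if "k < n" for k using member_le_sum[of k "{..<n}" Cb] that by (simp add: C0_def)
  have CgC0: "Cg \<le> C0" by (simp add: C0_def)
  have Cg1: "Cg \<ge> 1" and Dg: "0 \<le> Dg" "Dg \<le> real Cg" using rate_g unfolding cube_rate_def by blast+
  have Db: "0 \<le> Db k" "Db k \<le> real (Cb k)" if "k < n" for k using rate_b[OF that] unfolding cube_rate_def by blast+
  have C01: "1 \<le> real C0" using Cg1 CgC0 by linarith
  \<comment> \<open>an upper bound for the shifted smooth pieces, as the gates require it\<close>
  define c where "c = Dg + B + 2 * real C0"
  have c: "c \<ge> 0" using Dg B by (simp add: c_def)
  define L where "L = 6 + 2 * R * q"
  define Cw where "Cw = 8 + real C0 + c * (2 * real n) + c + Dg + B"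
  define Cz where "Cz = real C0 * (4 * 2 ^ n + 2) + 2 + 2 * real L"
  define Cs where "Cs = real l * (Cz * (4 * real n + 1) + 20 * real n + 6) + 2 * real l + 5"
  define Cm where "Cm = 6 * real n + 16 * real n * real l * real C0"
  define Ce where "Ce = ((2 * real C0) powr p + (2 * B) powr p * Cm) powr (1 / p)"
  define C where "C = 1 + Ce + Cs + Cs * Cw"
  define s where "s = 2 * p + 2 * \<alpha>"
  have cn: "0 \<le> c * (2 * real n)" using c by simp
  have Cw: "8 \<le> Cw" "real C0 \<le> Cw" "c * (2 * real n) \<le> Cw" "c \<le> Cw" "Dg + B \<le> Cw"
    using cn c Dg B C01 unfolding Cw_def by linarith+
  have Cz: "Cz \<ge> 0" by (simp add: Cz_def)
  have Cs: "Cs \<ge> 0" using Cz by (simp add: Cs_def)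
  have CC: "1 \<le> C" "Ce \<le> C" "Cs \<le> C" "Cs * Cw \<le> C"
    using Cs Cw(1) mult_nonneg_nonneg[of Cs Cw] powr_ge_zero[of "(2 * real C0) powr p + (2 * B) powr p * Cm" "1 / p"]
    unfolding C_def Ce_def by linarith+
  have s: "s > 0" using \<alpha> p by (simp add: s_def)
  have "\<exists>\<Phi>. relu_network n 1 \<Phi> \<and> net_max \<Phi> \<le> C * e powr (- s) \<and> real (net_size \<Phi>) \<le> C * e powr (- \<alpha>) \<and>
      net_depth \<Phi> = 11 + 2 * R * q \<and> Lp_norm n p (\<lambda>x. f x - net_fun n \<Phi> x) \<le> ennreal (C * e)"
    if f: "f \<in> Gclass m n p B l" and e: "0 < e" "e < 1" for f e
  proof -
    define I where "I = {1..l}"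
    have I: "finite I" "card I = l" by (simp_all add: I_def)
    obtain H F G where H: "\<forall>i\<in>I. pure_smooth n M B (H i)"
      and FG: "\<forall>i\<in>I. \<forall>k<n. pure_smooth k m B (F i k) \<and> pure_smooth k m B (G i k) \<and>
        continuous_on (RR k) (F i k) \<and> continuous_on (RR k) (G i k)"
      and fx: "\<forall>x\<in>Qcube n. \<bar>f x\<bar> \<le> B \<and> ((\<forall>i\<in>I. \<forall>k<n. x k \<noteq> F i k (restrict x {..<k})) \<longrightarrow>
        (\<exists>i\<in>I. f x = H i x \<and> enclosed n (F i) (G i) x \<and> (\<forall>j\<in>I. j \<noteq> i \<longrightarrow> \<not> enclosed n (F j) (G j) x)))"
      using Gclass_pieces[OF f, folded I_def M_def] by (elim exE conjE) (rule that; assumption)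
    obtain K Nb Ng :: nat where N1: "K \<ge> 1" "Nb \<ge> 1" "Ng \<ge> 1" and K2: "real K \<le> 2 * e powr (- \<alpha>)"
      and Nbn: "real (Nb ^ (n - 1)) \<le> 2 ^ n * e powr (- \<alpha>)" and Ngn: "real (Ng ^ n) \<le> 2 ^ n * e powr (- \<alpha>)"
      and Np: "real Nb \<le> 2 * e powr (- p)" "real Ng \<le> 2 * e powr (- p)"
      and err: "1 / real Nb ^ m \<le> e powr p" "1 / real Ng ^ M \<le> e" "1 / real K ^ (2 * R) \<le> e powr p"
      using parameter_choice[OF m p n e, folded M_def R_def \<alpha>_def] by (elim exE conjE) (rule that; assumption)
    have ep: "0 < e powr p" "e powr p \<le> e" "e powr p \<le> 1"
    proof -
      show "0 < e powr p" using e by simp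
      show "e powr p \<le> e" using powr_mono'[OF p, of e] e by simp
      then show "e powr p \<le> 1" using e by linarith
    qed
    have anti: "e powr b \<le> e powr a" if "a \<le> b" for a b using powr_mono'[OF that] e by simp
    have X1: "1 \<le> e powr (- a)" if "0 \<le> a" for a using anti[of "- a" 0] that e by simp
    \<comment> \<open>a grid has \<open>O(e\<^sup>-\<^sup>p)\<close> hyperplanes, so slabs of width \<open>e\<^sup>2\<^sup>p\<close> have total measure \<open>O(e\<^sup>p)\<close>\<close>
    define \<eta> where "\<eta> = e powr (2 * p)"
    \<comment> \<open>the accuracy of the approximate boundary functions\<close>
    define \<tau> where "\<tau> = 2 * real C0 * e powr p"
    define s0 where "s0 = 2 * p + \<alpha>"
    define W where "W = Cw * e powr (- s0)"
    have s0: "0 \<le> s0" using p \<alpha> by (simp add: s0_def)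
    have \<eta>: "0 < \<eta>" "\<eta> \<le> 1" using e anti[of 0 "2 * p"] p by (auto simp: \<eta>_def)
    have \<tau>: "\<tau> > 0" using C01 ep by (simp add: \<tau>_def)
    have Wge: "v \<le> W" if "v \<le> a * e powr (- b)" "a \<le> Cw" "b \<le> s0" "0 \<le> a" for v a b
    proof -
      have "a * e powr (- b) \<le> Cw * e powr (- s0)" using that by (intro mult_mono anti) auto
      then show ?thesis using that(1) by (simp add: W_def)
    qed
    have Wc: "v \<le> W" if "v \<le> a" "a \<le> Cw" "0 \<le> a" for v a
      by (rule Wge[of v a 0]) (use that s0 e in auto)
    have W1: "1 \<le> W" by (rule Wc[of 1 1]) (use Cw(1) in auto)
    have W\<eta>: "2 / \<eta> \<le> W"
      by (rule Wge[of _ 2 "2 * p"]) (use Cw(1) \<alpha> in \<open>auto simp: \<eta>_def s0_def powr_minus divide_inverse\<close>)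
    have WK: "2 * real K \<le> W"
      by (rule Wge[of _ 4 \<alpha>]) (use K2 Cw(1) p in \<open>auto simp: s0_def\<close>)
    have WN: "real Nb \<le> W" "real Ng \<le> W"
      by (rule Wge[of _ 2 p]; use Np Cw(1) p \<alpha> in \<open>auto simp: s0_def\<close>)+
    have WC0: "real C0 \<le> W" by (rule Wc[of _ "real C0"]) (use Cw(2) in auto)
    have inv\<tau>: "1 / \<tau> = e powr (- p) / (2 * real C0)" by (simp add: \<tau>_def powr_minus_divide)
    have "e powr (- p) / (2 * real C0) \<le> e powr (- p) / 1" using C01 by (intro divide_left_mono) auto
    then have W\<tau>: "1 / \<tau> \<le> W"
      unfolding inv\<tau> by (intro Wge[of _ 1 p]) (use Cw(1) p \<alpha> in \<open>auto simp: s0_def\<close>)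
    have W\<tau>D: "\<bar>(Db k - 1 / 2) / \<tau>\<bar> + 1 \<le> W" if k: "k < n" for k
    proof -
      have "real (Cb k) \<le> real C0" using CbC0[OF k] by simp
      then have "\<bar>Db k - 1 / 2\<bar> \<le> 2 * real C0" using Db[OF k] C01 by linarith
      then have "\<bar>Db k - 1 / 2\<bar> * (1 / \<tau>) \<le> 2 * real C0 * (1 / \<tau>)" using \<tau> by (intro mult_right_mono) auto
      also have "\<dots> = e powr (- p)" using C01 by (simp add: inv\<tau>)
      finally have "\<bar>(Db k - 1 / 2) / \<tau>\<bar> \<le> e powr (- p)" using \<tau> by (simp add: abs_divide)
      moreover have "1 \<le> e powr (- p)" using X1[of p] p by simp
      ultimately have "\<bar>(Db k - 1 / 2) / \<tau>\<bar> + 1 \<le> 2 * e powr (- p)" by linarith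
      then show ?thesis by (rule Wge) (use Cw(1) p \<alpha> in \<open>auto simp: s0_def\<close>)
    qed
    have Wcn: "c * (2 * real n) \<le> W" by (rule Wc[OF order_refl Cw(3) cn])
    have Wcc: "c \<le> W" by (rule Wc[OF order_refl Cw(4) c])
    have WDB: "\<bar>Dg\<bar> + B \<le> W" by (rule Wc[of _ "Dg + B"]) (use Cw(5) Dg B in auto)
    define Z where "Z = C0 * (2 * Nb ^ (n - 1) + 2 * Ng ^ n + K) + 2 + L * 2"
    have L7: "7 + 2 * R * q = Suc L" by (simp add: L_def)
    have n0: "n - 1 \<ge> 1" using n by simp
    \<comment> \<open>as \<open>h\<close> has to be nonnegative, it approximates \<open>U\<close> with a shift \<open>D\<close>\<close>
    define near where "near N D U \<delta> h \<longleftrightarrow> hidden_layer n W (Suc L) Z {h} \<and>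
      (\<forall>x\<in>Qcube n. x \<notin> grid_slabs n N \<eta> \<longrightarrow> \<bar>h x - (D + U x)\<bar> \<le> \<delta>)" for N D U \<delta> h
    have netb: "\<exists>h. near Nb (Db k) (\<lambda>x. U (restrict x {..<k})) \<tau> h" if k: "k < n" and U: "pure_smooth k m B U" for k U
    proof -
      have "real (Cb k) \<le> W" using CbC0[OF k] WC0 by linarith
      from cube_rateD[OF rate_b[OF k] U N1(2,1) \<eta> W\<eta> WK WN(1) this]
      obtain h where h: "hidden_layer n W (7 + 2 * R * q) (Cb k * (Nb ^ k + Nb + K)) {h}"
        "\<And>x. x \<in> Qcube n \<Longrightarrow> x \<notin> grid_slabs k Nb \<eta> \<Longrightarrow>
          \<bar>h x - (Db k + U (restrict x {..<k}))\<bar> \<le> real (Cb k) * (1 / real Nb ^ m + 1 / real K ^ (2 * R))" by blast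
      have "Nb ^ k \<le> Nb ^ (n - 1)" using k N1(2) by (intro power_increasing) auto
      moreover have "Nb \<le> Nb ^ (n - 1)" using power_increasing[OF n0 N1(2)] by simp
      ultimately have "Nb ^ k + Nb + K \<le> 2 * Nb ^ (n - 1) + 2 * Ng ^ n + K" by linarith
      then have "Cb k * (Nb ^ k + Nb + K) \<le> C0 * (2 * Nb ^ (n - 1) + 2 * Ng ^ n + K)" using CbC0[OF k] by (intro mult_le_mono)
      then have "Cb k * (Nb ^ k + Nb + K) \<le> Z" by (simp add: Z_def)
      from hidden_mono[OF h(1) order_refl this] have 1: "hidden_layer n W (Suc L) Z {h}" by (simp only: L7)
      have "real (Cb k) * (1 / real Nb ^ m + 1 / real K ^ (2 * R)) \<le> real C0 * (e powr p + e powr p)"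
        using CbC0[OF k] err by (intro mult_mono add_mono) auto
      then have le: "real (Cb k) * (1 / real Nb ^ m + 1 / real K ^ (2 * R)) \<le> \<tau>" by (simp add: \<tau>_def)
      have 2: "\<bar>h x - (Db k + U (restrict x {..<k}))\<bar> \<le> \<tau>" if "x \<in> Qcube n" "x \<notin> grid_slabs n Nb \<eta>" for x
      proof -
        have "x \<notin> grid_slabs k Nb \<eta>" using that(2) grid_slabs_mono[of k n] k by auto
        from h(2)[OF that(1) this] le show ?thesis by (rule order_trans)
      qed
      show ?thesis unfolding near_def using 1 2 by blast
    qed
    have netg: "\<exists>h. near Ng Dg U (2 * real C0 * e) h" if U: "pure_smooth n M B U" for U
    proof -
      have "real Cg \<le> W" using CgC0 WC0 by linarith
      from cube_rateD[OF rate_g U N1(3,1) \<eta> W\<eta> WK WN(2) this]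
      obtain h where h: "hidden_layer n W (7 + 2 * R * q) (Cg * (Ng ^ n + Ng + K)) {h}"
        "\<And>x. x \<in> Qcube n \<Longrightarrow> x \<notin> grid_slabs n Ng \<eta> \<Longrightarrow>
          \<bar>h x - (Dg + U (restrict x {..<n}))\<bar> \<le> real Cg * (1 / real Ng ^ M + 1 / real K ^ (2 * R))" by blast
      have "Ng \<le> Ng ^ n" using power_increasing[of 1 n Ng] n N1(3) by simp
      then have "Ng ^ n + Ng + K \<le> 2 * Nb ^ (n - 1) + 2 * Ng ^ n + K" by linarith
      then have "Cg * (Ng ^ n + Ng + K) \<le> C0 * (2 * Nb ^ (n - 1) + 2 * Ng ^ n + K)" using CgC0 by (intro mult_le_mono)
      then have "Cg * (Ng ^ n + Ng + K) \<le> Z" by (simp add: Z_def)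
      from hidden_mono[OF h(1) order_refl this] have 1: "hidden_layer n W (Suc L) Z {h}" by (simp only: L7)
      have "1 / real K ^ (2 * R) \<le> e" using err(3) ep(2) by linarith
      then have "real Cg * (1 / real Ng ^ M + 1 / real K ^ (2 * R)) \<le> real C0 * (e + e)"
        using CgC0 err(2) by (intro mult_mono add_mono) auto
      then have le: "real Cg * (1 / real Ng ^ M + 1 / real K ^ (2 * R)) \<le> 2 * real C0 * e" by simp
      have 2: "\<bar>h x - (Dg + U x)\<bar> \<le> 2 * real C0 * e" if x: "x \<in> Qcube n" "x \<notin> grid_slabs n Ng \<eta>" for x
      proof -
        have "restrict x {..<n} = x" using x(1) unfolding Qcube_def by (rule PiE_restrict)
        then show ?thesis using h(2)[OF x] le by simp
      qed
      show ?thesis unfolding near_def using 1 2 by blast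
    qed
    define F' where "F' i k = (SOME h. near Nb (Db k) (\<lambda>x. F i k (restrict x {..<k})) \<tau> h)" for i k
    define G' where "G' i k = (SOME h. near Nb (Db k) (\<lambda>x. G i k (restrict x {..<k})) \<tau> h)" for i k
    define h where "h i = (SOME h. near Ng Dg (H i) (2 * real C0 * e) h)" for i
    have F': "near Nb (Db k) (\<lambda>x. F i k (restrict x {..<k})) \<tau> (F' i k)" if "i \<in> I" "k < n" for i k
    proof -
      have "pure_smooth k m B (F i k)" using FG that by blast
      from someI_ex[OF netb[OF that(2) this]] show ?thesis unfolding F'_def .
    qed
    have G': "near Nb (Db k) (\<lambda>x. G i k (restrict x {..<k})) \<tau> (G' i k)" if "i \<in> I" "k < n" for i k
    proof -
      have "pure_smooth k m B (G i k)" using FG that by blast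
      from someI_ex[OF netb[OF that(2) this]] show ?thesis unfolding G'_def .
    qed
    have h: "near Ng Dg (H i) (2 * real C0 * e) (h i)" if "i \<in> I" for i
    proof -
      have "pure_smooth n M B (H i)" using H that by blast
      from someI_ex[OF netg[OF this]] show ?thesis unfolding h_def .
    qed
    have u: "hidden_layer n W (Suc L) Z {\<lambda>x. max 0 (x k + 1 / 2)}" if "k < n" for k
      by (rule hidden_mono[OF hidden_shifted_coordinate[OF that W1] order_refl]) (simp add: Z_def)
    define w where "w i x = max 0 (- (c * (2 * real n)) + (1 * h i x +
      ((\<Sum>k<n. c * ramp ((max 0 (x k + 1 / 2) - 1 / 2 - F' i k x + Db k) / \<tau>)) +
       (\<Sum>k<n. c * ramp ((G' i k x - Db k - max 0 (x k + 1 / 2) + 1 / 2) / \<tau>)))))" for i x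
    define S where "S = Z * (4 * n + 1) + 20 * n + 6"
    have w: "hidden_layer n W (L + 4) S {w i}" if i: "i \<in> I" for i
      unfolding S_def w_def
      by (rule hidden_gated_piece[OF conjunct1[OF h[OF i, unfolded near_def]] u conjunct1[OF F'[OF i, unfolded near_def]] conjunct1[OF G'[OF i, unfolded near_def]] W1 W\<tau> W\<tau>D Wcn Wcc \<tau> c])
    have "1 \<le> n" using n by simp
    have "\<exists>\<Phi>. relu_network n 1 \<Phi> \<and> net_depth \<Phi> = Suc (L + 4) \<and> net_size \<Phi> \<le> l * S + 2 * l + 5 \<and>
        net_max \<Phi> \<le> real (l * S + 2 * l + 5) * W \<and> (\<forall>x. net_fun n \<Phi> x = clip B ((\<Sum>i\<in>I. w i x) - Dg))"
      by (rule network_of_clipped_sum[OF _ I(1) \<open>1 \<le> n\<close> W1 WDB less_imp_le[OF B], unfolded I(2)]) (rule w)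
    then obtain \<Phi> where
      \<Phi>: "relu_network n 1 \<Phi>" "net_depth \<Phi> = Suc (L + 4)" "net_size \<Phi> \<le> l * S + 2 * l + 5"
        "net_max \<Phi> \<le> real (l * S + 2 * l + 5) * W" "\<forall>x. net_fun n \<Phi> x = clip B ((\<Sum>i\<in>I. w i x) - Dg)"
      by (elim exE conjE) (rule that; assumption)
    have depth: "net_depth \<Phi> = 11 + 2 * R * q" using \<Phi>(2) by (simp add: L_def)
    define X where "X = e powr (- \<alpha>)"
    have X: "1 \<le> X" using X1[of \<alpha>] \<alpha> by (simp add: X_def)
    have Zle: "real Z \<le> Cz * X"
    proof -
      have "real (2 * Nb ^ (n - 1) + 2 * Ng ^ n + K) \<le> 2 * (2 ^ n * X) + 2 * (2 ^ n * X) + 2 * X"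
        using Nbn Ngn K2 unfolding X_def of_nat_add of_nat_mult of_nat_numeral by linarith
      then have "real (2 * Nb ^ (n - 1) + 2 * Ng ^ n + K) \<le> (4 * 2 ^ n + 2) * X" by (simp add: algebra_simps)
      then have "real C0 * real (2 * Nb ^ (n - 1) + 2 * Ng ^ n + K) \<le> real C0 * ((4 * 2 ^ n + 2) * X)" by (rule mult_left_mono) simp
      moreover have "2 + 2 * real L \<le> (2 + 2 * real L) * X" using mult_left_mono[OF X, of "2 + 2 * real L"] by simp
      ultimately have "real C0 * real (2 * Nb ^ (n - 1) + 2 * Ng ^ n + K) + (2 + 2 * real L) \<le> Cz * X"
        unfolding Cz_def by (simp add: algebra_simps)
      then show ?thesis unfolding Z_def by simp
    qed
    have size: "real (l * S + 2 * l + 5) \<le> Cs * X"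
    proof -
      have "real S = real Z * (4 * real n + 1) + (20 * real n + 6)" by (simp add: S_def algebra_simps)
      also have "\<dots> \<le> (Cz * X) * (4 * real n + 1) + (20 * real n + 6) * X"
        using Zle mult_left_mono[OF X, of "20 * real n + 6"] by (intro add_mono mult_right_mono) auto
      finally have "real l * real S \<le> real l * ((Cz * X) * (4 * real n + 1) + (20 * real n + 6) * X)" by (rule mult_left_mono) simp
      moreover have "2 * real l + 5 \<le> (2 * real l + 5) * X" using mult_left_mono[OF X, of "2 * real l + 5"] by simp
      ultimately have "real l * real S + (2 * real l + 5) \<le> Cs * X" unfolding Cs_def by (simp add: algebra_simps)
      then show ?thesis by simp
    qed
    have net_size: "real (net_size \<Phi>) \<le> C * e powr (- \<alpha>)"
    proof -
      have "real (net_size \<Phi>) \<le> Cs * X" using \<Phi>(3) size by linarith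
      also have "\<dots> \<le> C * X" using CC(3) X by (intro mult_right_mono) auto
      finally show ?thesis by (simp add: X_def)
    qed
    have net_max: "net_max \<Phi> \<le> C * e powr (- s)"
    proof -
      have "net_max \<Phi> \<le> (Cs * X) * W" using \<Phi>(4) mult_right_mono[OF size, of W] W1 by linarith
      also have "\<dots> = (Cs * Cw) * (e powr (- \<alpha>) * e powr (- s0))" by (simp add: X_def W_def)
      also have "e powr (- \<alpha>) * e powr (- s0) = e powr (- s)" by (simp add: powr_add[symmetric] s_def s0_def algebra_simps)
      also have "(Cs * Cw) * e powr (- s) \<le> C * e powr (- s)" using CC(4) by (intro mult_right_mono) auto
      finally show ?thesis .
    qed
    define E where "E = bad_set n Nb Ng \<eta> (2 * \<tau>) I F G"
    define \<mu> where "\<mu> = Cm * e powr p"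
    have measure_at_most: "measure_at_most (leb n) E \<mu>"
    proof -
      have Ne: "(real N + 1) * \<eta> \<le> 3 * e powr p" if "real N \<le> 2 * e powr (- p)" for N
      proof -
        have "real N + 1 \<le> 3 * e powr (- p)" using that X1[of p] p by linarith
        then have "(real N + 1) * \<eta> \<le> 3 * e powr (- p) * \<eta>" using \<eta>(1) by (intro mult_right_mono) auto
        also have "\<dots> = 3 * e powr p" by (simp add: \<eta>_def powr_add[symmetric])
        finally show ?thesis .
      qed
      have a1: "real n * (real Nb + 1) * \<eta> \<le> real n * (3 * e powr p)"
        unfolding mult.assoc[of "real n"] by (rule mult_left_mono[OF Ne[OF Np(1)]]) simp
      have a2: "real n * (real Ng + 1) * \<eta> \<le> real n * (3 * e powr p)"
        unfolding mult.assoc[of "real n"] by (rule mult_left_mono[OF Ne[OF Np(2)]]) simp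
      have a3: "real (card I) * (real n * (4 * (2 * \<tau>))) = 16 * real n * real l * real C0 * e powr p" by (simp add: I(2) \<tau>_def)
      have "\<mu> = real n * (3 * e powr p) + real n * (3 * e powr p) + 16 * real n * real l * real C0 * e powr p"
        by (simp add: \<mu>_def Cm_def algebra_simps)
      then have "real n * (real Nb + 1) * \<eta> + real n * (real Ng + 1) * \<eta> + real (card I) * (real n * (4 * (2 * \<tau>))) \<le> \<mu>"
        unfolding a3 using a1 a2 by linarith
      moreover have "measure_at_most (leb n) E (real n * (real Nb + 1) * \<eta> + real n * (real Ng + 1) * \<eta> + real (card I) * (real n * (4 * (2 * \<tau>))))"
        unfolding E_def by (rule measure_at_most_bad_set[OF I(1) \<eta>(1)]) (use \<tau> FG in auto)
      ultimately show ?thesis using measure_at_most_mono by blast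
    qed
    have good: "\<bar>f x - net_fun n \<Phi> x\<bar> \<le> 2 * real C0 * e" if x: "x \<in> Qcube n" "x \<notin> E" for x
    proof -
      have grid: "x \<notin> grid_slabs n Nb \<eta>" "x \<notin> grid_slabs n Ng \<eta>" using x unfolding E_def bad_set_def by blast+
      have far: "\<bar>x k - F j k (restrict x {..<k})\<bar> > 2 * \<tau> \<and> \<bar>x k - G j k (restrict x {..<k})\<bar> > 2 * \<tau>"
        if "j \<in> I" "k < n" for j k
        using x that unfolding E_def bad_set_def by (auto simp: not_le)
      have off: "\<forall>i\<in>I. \<forall>k<n. x k \<noteq> F i k (restrict x {..<k})" using far \<tau> by force
      obtain i where i: "i \<in> I" "f x = H i x" "enclosed n (F i) (G i) x" "\<forall>j\<in>I. j \<noteq> i \<longrightarrow> \<not> enclosed n (F j) (G j) x"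
        using fx x(1) off by blast
      have hj: "0 \<le> h j x \<and> h j x \<le> c" if j: "j \<in> I" for j
      proof -
        have "\<bar>h j x - (Dg + H j x)\<bar> \<le> 2 * real C0 * e" using h[OF j] x(1) grid(2) unfolding near_def by blast
        moreover have "2 * real C0 * e \<le> 2 * real C0 * 1" using e by (intro mult_left_mono) auto
        moreover have "\<bar>H j x\<bar> \<le> B" using pure_smooth_bound[OF _ x(1)] H j by blast
        ultimately have "h j x \<le> c" unfolding c_def by linarith
        moreover have "0 \<le> h j x" by (rule hidden_nonneg[OF conjunct1[OF h[OF j, unfolded near_def]]]) simp
        ultimately show ?thesis by simp
      qed
      have "(\<Sum>j\<in>I. w j x) = h i x" unfolding w_def
      proof (rule gated_pieces_value[where F = F and G = G and F' = F' and G' = G' and h = h and D = Db and i = i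
            and c = c and x = x and \<tau> = \<tau> and I = I and n = n])
        show "\<not> enclosed n (F j) (G j) x" if "j \<in> I" "j \<noteq> i" for j using i(4) that by blast
        show "\<bar>F' j k x - (Db k + F j k (restrict x {..<k}))\<bar> \<le> \<tau> \<and> \<bar>G' j k x - (Db k + G j k (restrict x {..<k}))\<bar> \<le> \<tau>"
          if "j \<in> I" "k < n" for j k
          using F'[OF that] G'[OF that] x(1) grid(1) unfolding near_def by blast
      qed (fact I(1) i(1) i(3) x(1) \<tau> far hj)+
      then have "net_fun n \<Phi> x = clip B (h i x - Dg)" using \<Phi>(5) by simp
      then have "\<bar>f x - net_fun n \<Phi> x\<bar> \<le> \<bar>f x - (h i x - Dg)\<bar>"
        using clip_nonexpansive[of "f x" B "h i x - Dg"] fx x(1) by simp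
      moreover have "\<bar>h i x - (Dg + H i x)\<bar> \<le> 2 * real C0 * e" using h[OF i(1)] x(1) grid(2) unfolding near_def by blast
      ultimately show ?thesis unfolding i(2) by linarith
    qed
    have bad: "\<bar>f x - net_fun n \<Phi> x\<bar> \<le> 2 * B" if "x \<in> Qcube n" for x
    proof -
      have "\<bar>f x\<bar> \<le> B" using fx that by blast
      moreover have "\<bar>net_fun n \<Phi> x\<bar> \<le> B" using \<Phi>(5) clip_bounds[of B] B by simp
      ultimately show ?thesis by linarith
    qed
    have Lp: "Lp_norm n p (\<lambda>x. f x - net_fun n \<Phi> x) \<le> ennreal (Ce * e)"
    proof (rule Lp_norm_bound[OF p, where E = E and \<mu> = \<mu> and \<delta> = "2 * real C0 * e" and b = "2 * B"])
      show "E \<in> sets (leb n)" "emeasure (leb n) E \<le> ennreal \<mu>" "0 \<le> \<mu>" using measure_at_most by (auto simp: measure_at_most_def)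
      show "0 \<le> Ce * e" using e by (simp add: Ce_def)
      have "Ce powr p = (2 * real C0) powr p + (2 * B) powr p * Cm"
        using p by (simp add: Ce_def powr_powr Cm_def)
      then have "(Ce * e) powr p = ((2 * real C0) powr p + (2 * B) powr p * Cm) * e powr p"
        using e by (simp add: powr_mult Ce_def)
      moreover have "(2 * real C0 * e) powr p = (2 * real C0) powr p * e powr p" using e by (simp add: powr_mult)
      ultimately show "(2 * real C0 * e) powr p + (2 * B) powr p * \<mu> \<le> (Ce * e) powr p"
        by (simp add: \<mu>_def algebra_simps)
    qed (use good bad in auto)
    have "ennreal (Ce * e) \<le> ennreal (C * e)" using CC(2) e by (intro ennreal_leI mult_right_mono) auto
    then have "Lp_norm n p (\<lambda>x. f x - net_fun n \<Phi> x) \<le> ennreal (C * e)" using Lp by (rule order_trans[rotated])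
    then show ?thesis using \<Phi>(1) net_max net_size depth by blast
  qed
  then show ?thesis using CC(1) s by blast
qed

text \<open>
  Since \<open>n \<le> 2 (n - 1)\<close>, the number of rounds satisfies \<open>2 R \<le> 2 m / n + 2\<close>.
\<close>
lemma depth_bound:
  fixes m n q :: nat and p :: real
  assumes "m \<ge> 1" "p \<ge> 1" "n \<ge> 2"
  defines "R \<equiv> nat \<lceil>real m / (2 * real (n - 1))\<rceil>"
  shows "real (11 + 2 * R * q) \<le> (4 + real q) * (25 + 2 * real m / real n + real m / (p * real (n - 1)))"
proof -
  have n1: "real (n - 1) > 0" using assms(3) by simp
  have "real R \<le> real m / (2 * real (n - 1)) + 1"
  proof -
    have "real (nat \<lceil>x\<rceil>) \<le> x + 1" if "0 \<le> x" for x :: real using that by linarith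
    then show ?thesis unfolding R_def using n1 by simp
  qed
  moreover have "real m / (2 * real (n - 1)) \<le> real m / real n"
    using assms(3) by (intro divide_left_mono) (auto simp: of_nat_diff)
  ultimately have R: "2 * real R \<le> 2 * real m / real n + 2" by simp
  have y: "0 \<le> real m / (p * real (n - 1))" using assms(2) n1 by simp
  have z: "0 \<le> 2 * real m / real n" by simp
  have "real (11 + 2 * R * q) = 11 + real q * (2 * real R)" by simp
  also have "\<dots> \<le> 100 + real q * (25 + 2 * real m / real n + real m / (p * real (n - 1)))"
    by (intro add_mono mult_left_mono) (use R y in auto)
  also have "\<dots> \<le> (4 + real q) * (25 + 2 * real m / real n + real m / (p * real (n - 1)))"
  proof -
    have "100 + a * v \<le> (4 + a) * v" if "25 \<le> v" for a v :: real using that by (simp add: distrib_right)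
    then show ?thesis using y z by simp
  qed
  finally show ?thesis .
qed

theorem theorem7p13:
  fixes m n l :: nat and p B :: real
  assumes "m \<ge> 1" and "p \<ge> 1" and "n \<ge> 2" and "B > 0"
  shows "\<exists>c s :: real. c > 0 \<and> s > 0 \<and>
    (\<forall>f \<in> Gclass m n p B l. \<forall>\<epsilon> :: real. 0 < \<epsilon> \<and> \<epsilon> < 1/2 \<longrightarrow>
      (\<exists>\<Phi> :: network. relu_network n 1 \<Phi> \<and>
        net_max \<Phi> \<le> \<epsilon> powr (- s) \<and>
        real (net_size \<Phi>) \<le> c * \<epsilon> powr (- (p * real (n - 1) / real m)) \<and>
        real (net_depth \<Phi>) \<le> (5 + real_of_int \<lceil>log 2 (real (m * n))\<rceil>) *
          (25 + 2 * real m / real n + real m / (p * real (n - 1))) \<and>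
        Lp_norm n p (\<lambda>x. f x - net_fun n \<Phi> x) \<le> ennreal \<epsilon>))"
proof -
  define \<alpha> where "\<alpha> = p * real (n - 1) / real m"
  define R where "R = nat \<lceil>real m / (2 * real (n - 1))\<rceil>"
  \<comment> \<open>the interpolants have degree at most \<open>2 m n\<close>, which is at most \<open>2\<^sup>q\<close>\<close>
  define q where "q = Suc (nat \<lceil>log 2 (real (m * n))\<rceil>)"
  have "1 \<le> m * n" using assms(1,3) by (simp add: Suc_le_eq)
  then have mn: "real (m * n) \<ge> 1" using of_nat_mono[of 1 "m * n", where 'a = real] by simp
  have log0: "0 \<le> log 2 (real (m * n))" using mn by simp
  then have q': "real q = real_of_int \<lceil>log 2 (real (m * n))\<rceil> + 1" by (simp add: q_def)
  have "real (m * n) = 2 powr (log 2 (real (m * n)))" using mn by simp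
  also have "\<dots> \<le> 2 powr (real (nat \<lceil>log 2 (real (m * n))\<rceil>))" by (intro powr_mono real_nat_ceiling_ge) simp
  also have "\<dots> = real (2 ^ nat \<lceil>log 2 (real (m * n))\<rceil>)" by (simp add: powr_realpow)
  finally have "m * n \<le> 2 ^ nat \<lceil>log 2 (real (m * n))\<rceil>" by (simp only: of_nat_le_iff)
  then have q: "q \<ge> 1" "2 * (m * n) \<le> 2 ^ q" by (simp_all add: q_def)
  obtain C s where C: "C \<ge> 1" and s: "s > 0" and rate: "\<forall>f\<in>Gclass m n p B l. \<forall>e. 0 < e \<and> e < 1 \<longrightarrow>
    (\<exists>\<Phi>. relu_network n 1 \<Phi> \<and> net_max \<Phi> \<le> C * e powr (- s) \<and> real (net_size \<Phi>) \<le> C * e powr (- \<alpha>) \<and>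
      net_depth \<Phi> = 11 + 2 * R * q \<and> Lp_norm n p (\<lambda>x. f x - net_fun n \<Phi> x) \<le> ennreal (C * e))"
    using piecewise_smooth_rate[OF assms q, of l] unfolding \<alpha>_def[symmetric] R_def[symmetric]
    by (elim exE conjE) (rule that; assumption)
  \<comment> \<open>as \<open>\<epsilon> < 1/2\<close>, the constant \<open>C * C powr s\<close> is absorbed into a power of \<open>1 / \<epsilon>\<close>\<close>
  define t where "t = log 2 (C * C powr s)"
  have CC: "1 \<le> C * C powr s" using C s mult_mono[of 1 C 1 "C powr s"] ge_one_powr_ge_zero[of C s] by simp
  then have t: "0 \<le> t" by (simp add: t_def)
  have scale: "C * (\<epsilon> / C) powr (- a) = C * C powr a * \<epsilon> powr (- a)" if "\<epsilon> > 0" for \<epsilon> a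
    using that C by (simp add: powr_divide powr_minus_divide)
  have "\<exists>\<Phi>. relu_network n 1 \<Phi> \<and>
        net_max \<Phi> \<le> \<epsilon> powr (- (s + t)) \<and>
        real (net_size \<Phi>) \<le> (C * C powr \<alpha>) * \<epsilon> powr (- \<alpha>) \<and>
        real (net_depth \<Phi>) \<le> (5 + real_of_int \<lceil>log 2 (real (m * n))\<rceil>) *
          (25 + 2 * real m / real n + real m / (p * real (n - 1))) \<and>
        Lp_norm n p (\<lambda>x. f x - net_fun n \<Phi> x) \<le> ennreal \<epsilon>"
    if f: "f \<in> Gclass m n p B l" and \<epsilon>: "0 < \<epsilon>" "\<epsilon> < 1/2" for f \<epsilon>
  proof -
    have "\<epsilon> / C \<le> \<epsilon> / 1" using C \<epsilon> by (intro divide_left_mono) auto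
    then have "0 < \<epsilon> / C \<and> \<epsilon> / C < 1" using C \<epsilon> by auto
    with rate f obtain \<Phi> where \<Phi>: "relu_network n 1 \<Phi>" "net_max \<Phi> \<le> C * (\<epsilon> / C) powr (- s)"
      "real (net_size \<Phi>) \<le> C * (\<epsilon> / C) powr (- \<alpha>)" "net_depth \<Phi> = 11 + 2 * R * q"
      "Lp_norm n p (\<lambda>x. f x - net_fun n \<Phi> x) \<le> ennreal (C * (\<epsilon> / C))" by blast
    have "C * C powr s = 2 powr t" using CC by (simp add: t_def)
    also have "2 powr t \<le> (1 / \<epsilon>) powr t"
    proof (rule powr_mono2[OF t])
      show "2 \<le> 1 / \<epsilon>" using \<epsilon> by (simp add: le_divide_eq)
    qed simp
    also have "(1 / \<epsilon>) powr t = \<epsilon> powr (- t)" using \<epsilon> by (simp add: powr_minus_divide powr_divide)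
    finally have "C * C powr s * \<epsilon> powr (- s) \<le> \<epsilon> powr (- t) * \<epsilon> powr (- s)" by (intro mult_right_mono) auto
    also have "\<dots> = \<epsilon> powr (- (s + t))" by (simp add: powr_add[symmetric] algebra_simps)
    finally have "net_max \<Phi> \<le> \<epsilon> powr (- (s + t))" using \<Phi>(2) unfolding scale[OF \<epsilon>(1)] by linarith
    moreover have "real (net_size \<Phi>) \<le> (C * C powr \<alpha>) * \<epsilon> powr (- \<alpha>)" using \<Phi>(3) unfolding scale[OF \<epsilon>(1)] .
    moreover have "real (net_depth \<Phi>) \<le> (5 + real_of_int \<lceil>log 2 (real (m * n))\<rceil>) *
          (25 + 2 * real m / real n + real m / (p * real (n - 1)))"
      using depth_bound[OF assms(1-3), of q] unfolding \<Phi>(4) R_def[symmetric] q' by simp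
    moreover have "Lp_norm n p (\<lambda>x. f x - net_fun n \<Phi> x) \<le> ennreal \<epsilon>" using \<Phi>(5) C by simp
    ultimately show ?thesis using \<Phi>(1) by blast
  qed
  moreover have "0 < C * C powr \<alpha>" using C by simp
  moreover have "0 < s + t" using s t by simp
  ultimately show ?thesis unfolding \<alpha>_def[symmetric] by blast
qed

end
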